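(* For any $X\in\{F,G,H\}$ and $a,b\in\{0,1\}$, the intersection polynomial $X_{ab}(K;t)$ of long virtual knots $K$ is a finite-type invariant of degree two under crossing changes.
   Context: A long virtual knot diagram is an immersed line in $\mathbb{R}^2$ that agrees with the $x$-axis outside some $2$-disk and has finitely many transversal double points, each being either a real crossing (with over/under information) or a virtual crossing (without it); it is oriented from $-\infty$ to $\infty$. A long virtual knot is an equivalence class of such diagrams under generalized Reidemeister moves (the classical moves I, II, III on real crossings, the three analogous moves on virtual crossings, and the mixed move passing a strand having only virtual crossings across a real crossing). Let $D$ be a diagram of a long virtual knot $K$ with real crossings $c_1,\dots,c_n$, and let $\varepsilon_i\in\{1,-1\}$ be the sign of $c_i$. The crossing $c_i$ is of type $0$ if, travelling along $D$ from $-\infty$ to $\infty$, one passes $c_i$ first over and then under; otherwise it is of type $1$. For $a\in\{0,1\}$ put $I_a=\{i\mid c_i\text{ is of type }a\}$ and $\omega_a=\sum_{i\in I_a}\varepsilon_i$. A surface realization of $D$ is a closed, connected, oriented surface $\Sigma_g$ together with an oriented knot diagram on $\Sigma_g$ with a basepoint and with no virtual crossings, whose real crossings coincide with those of $D$ (same order of passage, over/under information and signs), and whose basepoint corresponds to $\pm\infty$ of $D$. Smoothing this diagram at $c_i$ (respecting orientation) gives two oriented loops on $\Sigma_g$: $\alpha_i$ is the one not containing the basepoint and $\beta_i$ is the one containing it; they are regarded as homology cycles on $\Sigma_g$. The intersection numbers $\gamma\cdot\gamma'\in\mathbb{Z}$ of such cycles are independent of the choice of surface realization. Put $W_a(K;t)=\sum_{i\in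 I_a}\varepsilon_i(t^{\alpha_i\cdot\beta_i}-1)$ and \[F_{ab}(K;t)=\sum_{i\in I_a,\,j\in I_b}\varepsilon_i\varepsilon_j(t^{\alpha_i\cdot\alpha_j}-1),\] \[G_{ab}(K;t)=\sum_{i\in I_a,\,j\in I_b}\varepsilon_i\varepsilon_j(t^{\alpha_i\cdot\beta_j}-1)-\omega_bW_a(K;t),\] \[H_{ab}(K;t)=\sum_{i\in I_a,\,j\in I_b}\varepsilon_i\varepsilon_j(t^{\beta_i\cdot\beta_j}-1)-\omega_aW_b(K;t)-\omega_bW_a(K;t^{-1}).\] These Laurent polynomials in $\mathbb{Z}[t,t^{-1}]$ (the intersection polynomials of $K$) depend only on $K$, not on $D$. A $k$-marked long virtual knot diagram $(D,C_k)$ is a diagram $D$ with a set $C_k=\{c_1,\dots,c_k\}$ of $k$ specified real crossings of $D$. For $\delta_1,\dots,\delta_k\in\{0,1\}$, $D_{\delta_1,\dots,\delta_k}$ is the diagram obtained from $D$ by performing a crossing change (switching the over/under information) at each $c_i$ with $\delta_i=1$ and leaving $c_i$ unchanged if $\delta_i=0$ ($1\le i\le k$); $K_{\delta_1,\dots,\delta_k}$ is the long virtual knot it presents. An invariant $v$ of long virtual knots with values in an abelian group is a finite-type invariant of degree $k$ under crossing changes if and only if \[v(D,C_{k+1})=\sum_{\delta_1,\dots,\delta_{k+1}\in\{0,1\}}(-1)^{\delta_1+\dots+\delta_{k+1}}v(K_{\delta_1,\dots,\delta_{k+1}})=0\] for every $(k+1)$-marked diagram $(D,C_{k+1})$, and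 there is a $k$-marked diagram $(D',C_k)$ with $v(D',C_k)\neq0$ (where $v(D',C_k)$ is the analogous alternating sum over $\delta_1,\dots,\delta_k$). *)

theory Defs
  imports "HOL-Analysis.Analysis" "HOL-Library.Poly_Mapping"
begin

section \<open>Long virtual knot diagrams\<close>

text \<open>
  The plane is the type of complex numbers.  A double point of a curve is recorded by its two
  parameters \<open>s < t\<close>, that is, by its first and its second passage.  The field \<open>real_cr\<close> collects
  the real crossings, \<open>first_over\<close> those real crossings whose first passage is the over-passage.
  All double points outside \<open>real_cr\<close> are virtual crossings.
\<close>

type_synonym crossing = "real \<times> real"

record diagram =
  curve :: "real \<Rightarrow> complex"
  real_cr :: "crossing set"
  first_over :: "crossing set"

definition double_points :: "(real \<Rightarrow> complex) \<Rightarrow> crossing set" where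
  "double_points \<gamma> = {(s, t). s < t \<and> \<gamma> s = \<gamma> t}"

definition velocity :: "diagram \<Rightarrow> real \<Rightarrow> complex" where
  "velocity D t = vector_derivative (curve D) (at t)"

text \<open>The determinant of the pair \<open>(z, w)\<close> of plane vectors.\<close>

definition wedge :: "complex \<Rightarrow> complex \<Rightarrow> real" where
  "wedge z w = Re z * Im w - Im z * Re w"

text \<open>
  The last two lines say that the line runs along the x-axis from \<open>-\<infinity>\<close> and back to \<open>\<infinity>\<close>; as
  the curve is regular, it then agrees with the x-axis outside some disc.
\<close>

definition is_diagram :: "diagram \<Rightarrow> bool" where
  "is_diagram D \<longleftrightarrow>
     curve D C1_differentiable_on UNIV \<and> (\<forall>t. velocity D t \<noteq> 0) \<and>
     finite (double_points (curve D)) \<and>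
     (\<forall>s t u. s < t \<and> t < u \<longrightarrow> \<not> (curve D s = curve D t \<and> curve D t = curve D u)) \<and>
     (\<forall>(s, t) \<in> double_points (curve D). wedge (velocity D s) (velocity D t) \<noteq> 0) \<and>
     real_cr D \<subseteq> double_points (curve D) \<and> first_over D \<subseteq> real_cr D \<and>
     (\<exists>N. \<forall>t. N \<le> \<bar>t\<bar> \<longrightarrow> Im (curve D t) = 0) \<and>
     filterlim (\<lambda>t. Re (curve D t)) at_bot at_bot \<and> filterlim (\<lambda>t. Re (curve D t)) at_top at_top"

definition cr_sign :: "diagram \<Rightarrow> crossing \<Rightarrow> int" where
  "cr_sign D c =
     (let over = (if c \<in> first_over D then fst c else snd c);
          under = (if c \<in> first_over D then snd c else fst c)
      in if wedge (velocity D over) (velocity D under) > 0 then 1 else - 1)"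

definition cr_type :: "diagram \<Rightarrow> crossing \<Rightarrow> nat" where
  "cr_type D c = (if c \<in> first_over D then 0 else 1)"


section \<open>Generalized Reidemeister moves\<close>

text \<open>
  Plane isotopy and reparametrization.  A diffeomorphism of the plane that is the identity outside
  a disc is isotopic to the identity.
\<close>

definition plane_diffeo :: "(complex \<Rightarrow> complex) \<Rightarrow> bool" where
  "plane_diffeo h \<longleftrightarrow> bij h \<and>
     (\<exists>h'. (\<forall>z. (h has_derivative h' z) (at z)) \<and> (\<forall>v. continuous_on UNIV (\<lambda>z. h' z v)) \<and>
           (\<forall>z. wedge (h' z 1) (h' z \<i>) > 0)) \<and>
     (\<exists>r. \<forall>z. r \<le> norm z \<longrightarrow> h z = z)"

definition reparametrization :: "(real \<Rightarrow> real) \<Rightarrow> bool" where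
  "reparametrization \<phi> \<longleftrightarrow> bij \<phi> \<and> \<phi> C1_differentiable_on UNIV \<and> (\<forall>t. deriv \<phi> t > 0)"

definition isotopic :: "diagram \<Rightarrow> diagram \<Rightarrow> bool" where
  "isotopic D D' \<longleftrightarrow>
     (\<exists>h \<phi>. plane_diffeo h \<and> reparametrization \<phi> \<and>
        curve D' = h \<circ> curve D \<circ> \<phi> \<and>
        real_cr D = map_prod \<phi> \<phi> ` real_cr D' \<and>
        first_over D = map_prod \<phi> \<phi> ` first_over D')"

text \<open>
  Two diagrams differ only inside a topological disc, which both lines meet exactly in the
  parameters \<open>J\<close>.  Every double point then has either both or none of its parameters in \<open>J\<close>.
\<close>

definition agree_off_disc :: "real set \<Rightarrow> diagram \<Rightarrow> diagram \<Rightarrow> bool" where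
  "agree_off_disc J D D' \<longleftrightarrow>
     (\<exists>B. B homeomorphic cball (0::complex) 1 \<and> curve D -` B = J \<and> curve D' -` B = J) \<and>
     (\<forall>t. t \<notin> J \<longrightarrow> curve D t = curve D' t) \<and>
     {c \<in> real_cr D. fst c \<notin> J} = {c \<in> real_cr D'. fst c \<notin> J} \<and>
     {c \<in> first_over D. fst c \<notin> J} = {c \<in> first_over D'. fst c \<notin> J}"

definition inside :: "real set \<Rightarrow> diagram \<Rightarrow> crossing set" where
  "inside J D = {c \<in> double_points (curve D). fst c \<in> J \<and> snd c \<in> J}"

text \<open>Move I, real or virtual: the disc contains one arc, with one double point or none.\<close>

definition move_I :: "diagram \<Rightarrow> diagram \<Rightarrow> bool" where
  "move_I D D' \<longleftrightarrow>
     (\<exists>l u c. l < u \<and> agree_off_disc {l..u} D D' \<and> inside {l..u} D = {c} \<and> inside {l..u} D' = {})"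

text \<open>
  Move II, real or virtual: the disc contains two arcs, with two double points or none.  That the
  second arc crosses the first one in opposite directions is automatic for such arcs.
\<close>

definition move_II :: "diagram \<Rightarrow> diagram \<Rightarrow> bool" where
  "move_II D D' \<longleftrightarrow>
     (\<exists>l1 u1 l2 u2 p1 p2 q1 q2.
        l1 < u1 \<and> u1 < l2 \<and> l2 < u2 \<and>
        agree_off_disc ({l1..u1} \<union> {l2..u2}) D D' \<and>
        p1 \<in> {l1..u1} \<and> q1 \<in> {l1..u1} \<and> p2 \<in> {l2..u2} \<and> q2 \<in> {l2..u2} \<and>
        (p1, p2) \<noteq> (q1, q2) \<and>
        inside ({l1..u1} \<union> {l2..u2}) D = {(p1, p2), (q1, q2)} \<and>
        inside ({l1..u1} \<union> {l2..u2}) D' = {} \<and>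
        sgn (wedge (velocity D p1) (velocity D p2)) =
          - sgn (wedge (velocity D q1) (velocity D q2)) \<and>
        ((p1, p2) \<notin> real_cr D \<and> (q1, q2) \<notin> real_cr D \<or>
         (p1, p2) \<in> real_cr D \<and> (q1, q2) \<in> real_cr D \<and>
           ((p1, p2) \<in> first_over D \<longleftrightarrow> (q1, q2) \<in> first_over D)))"

text \<open>
  Move III and its virtual and mixed versions.  The disc contains three arcs \<open>1, 2, 3\<close>, any two of
  which cross once, at \<open>P\<close> (arcs 1 and 2), \<open>Q\<close> (arcs 1 and 3) and \<open>R\<close> (arcs 2 and 3).  Admissible
  are: three real crossings such that the three arcs lie on three levels (the relation ``is over''
  is not cyclic), and at least two virtual crossings, i.e. some arc has only virtual crossings.
\<close>

definition admissible_III :: "diagram \<Rightarrow> crossing \<Rightarrow> crossing \<Rightarrow> crossing \<Rightarrow> bool" where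
  "admissible_III D P Q R \<longleftrightarrow>
     {P, Q, R} \<subseteq> real_cr D \<and>
       ((P \<in> first_over D \<longleftrightarrow> R \<in> first_over D) \<longrightarrow> (Q \<in> first_over D \<longleftrightarrow> P \<in> first_over D)) \<or>
     P \<notin> real_cr D \<and> Q \<notin> real_cr D \<or> P \<notin> real_cr D \<and> R \<notin> real_cr D \<or>
     Q \<notin> real_cr D \<and> R \<notin> real_cr D"

text \<open>
  The corners \<open>P\<close>, \<open>R\<close>, \<open>Q\<close> of the triangle, visited in this order along the arcs 2, 3, 1: the
  boundary turns to the same side at each of them.  The signs of the parameter differences say
  whether a side is run through in the direction of its arc.
\<close>

definition triangle_turns :: "diagram \<Rightarrow> crossing \<Rightarrow> crossing \<Rightarrow> crossing \<Rightarrow> bool" where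
  "triangle_turns D P Q R \<longleftrightarrow>
     (let o1 = sgn (fst P - fst Q); o2 = sgn (fst R - snd P); o3 = sgn (snd Q - snd R);
          tP = sgn (o1 * o2 * wedge (velocity D (fst P)) (velocity D (snd P)));
          tR = sgn (o2 * o3 * wedge (velocity D (fst R)) (velocity D (snd R)));
          tQ = sgn (o3 * o1 * wedge (velocity D (snd Q)) (velocity D (fst Q)))
      in tP = tR \<and> tR = tQ)"

definition same_crossing :: "diagram \<Rightarrow> crossing \<Rightarrow> diagram \<Rightarrow> crossing \<Rightarrow> bool" where
  "same_crossing D c D' c' \<longleftrightarrow>
     (c \<in> real_cr D \<longleftrightarrow> c' \<in> real_cr D') \<and> (c \<in> first_over D \<longleftrightarrow> c' \<in> first_over D') \<and>
     sgn (wedge (velocity D (fst c)) (velocity D (snd c))) =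
       sgn (wedge (velocity D' (fst c')) (velocity D' (snd c')))"

text \<open>
  The move reverses the order of the two crossings on each of the three arcs.  For arcs in a disc,
  \<open>triangle_turns\<close> and the equality of local orientations in \<open>same_crossing\<close> are automatic.
\<close>

definition move_III :: "diagram \<Rightarrow> diagram \<Rightarrow> bool" where
  "move_III D D' \<longleftrightarrow>
     (\<exists>l1 u1 l2 u2 l3 u3 P Q R P' Q' R'.
        let J1 = {l1..u1}; J2 = {l2..u2}; J3 = {l3..u3}; J = J1 \<union> J2 \<union> J3 in
        l1 < u1 \<and> u1 < l2 \<and> l2 < u2 \<and> u2 < l3 \<and> l3 < u3 \<and>
        agree_off_disc J D D' \<and>
        {P, P'} \<subseteq> J1 \<times> J2 \<and> {Q, Q'} \<subseteq> J1 \<times> J3 \<and> {R, R'} \<subseteq> J2 \<times> J3 \<and>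
        inside J D = {P, Q, R} \<and> inside J D' = {P', Q', R'} \<and>
        (fst P < fst Q \<longleftrightarrow> fst Q' < fst P') \<and>
        (snd P < fst R \<longleftrightarrow> fst R' < snd P') \<and>
        (snd Q < snd R \<longleftrightarrow> snd R' < snd Q') \<and>
        same_crossing D P D' P' \<and> same_crossing D Q D' Q' \<and> same_crossing D R D' R' \<and>
        admissible_III D P Q R \<and> triangle_turns D P Q R)"

definition diagram_move :: "diagram \<Rightarrow> diagram \<Rightarrow> bool" where
  "diagram_move D D' \<longleftrightarrow> is_diagram D \<and> is_diagram D' \<and>
     (isotopic D D' \<or> move_I D D' \<or> move_II D D' \<or> move_III D D')"

text \<open>Two diagrams present the same long virtual knot.\<close>

definition same_long_virtual_knot :: "diagram \<Rightarrow> diagram \<Rightarrow> bool" where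
  "same_long_virtual_knot = equivclp diagram_move"


section \<open>Knot diagrams on closed oriented surfaces\<close>

text \<open>
  A closed connected oriented surface is given by a cell decomposition, encoded as a combinatorial
  map: \<open>darts\<close> are the oriented edges, \<open>opp\<close> reverses a dart, and \<open>rot\<close> takes a dart to the next
  one counterclockwise among the darts leaving the same vertex.  The 2-cells are glued in along the
  orbits of the composition of \<open>opp\<close> and \<open>rot\<close>.

  The knot diagram is the closed edge path \<open>walk\<close>, based at its initial vertex.  Its \<open>k\<close>-th
  passage through a crossing lies between \<open>walk ! k\<close> and \<open>walk ! Suc k\<close>; a crossing is the pair of
  its passages.  There may be further edges and vertices, so that the complement of the diagram can
  be any surface.
\<close>

record surface_diagram =
  darts :: "nat set"
  rot :: "nat \<Rightarrow> nat"
  opp :: "nat \<Rightarrow> nat"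
  walk :: "nat list"
  crossings :: "(nat \<times> nat) set"
  sfirst_over :: "(nat \<times> nat) set"

definition closed_surface :: "surface_diagram \<Rightarrow> bool" where
  "closed_surface S \<longleftrightarrow>
     finite (darts S) \<and> darts S \<noteq> {} \<and>
     bij_betw (rot S) (darts S) (darts S) \<and>
     (\<forall>d \<in> darts S. opp S d \<in> darts S \<and> opp S d \<noteq> d \<and> opp S (opp S d) = d) \<and>
     (\<forall>d \<in> darts S. \<forall>d' \<in> darts S. (\<lambda>x y. y = rot S x \<or> y = opp S x)\<^sup>*\<^sup>* d d')"

definition same_vertex :: "surface_diagram \<Rightarrow> nat \<Rightarrow> nat \<Rightarrow> bool" where
  "same_vertex S a b \<longleftrightarrow> (\<exists>m. (rot S ^^ m) a = b)"

text \<open>The darts met strictly between \<open>a\<close> and \<open>b\<close> when turning counterclockwise from \<open>a\<close> to \<open>b\<close>.\<close>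

definition between :: "surface_diagram \<Rightarrow> nat \<Rightarrow> nat \<Rightarrow> nat set" where
  "between S a b = {(rot S ^^ m) a | m. 0 < m \<and> (\<forall>l. 0 < l \<and> l \<le> m \<longrightarrow> (rot S ^^ l) a \<noteq> b)}"

definition out_dart :: "surface_diagram \<Rightarrow> nat \<Rightarrow> nat" where
  "out_dart S k = walk S ! Suc k"

definition in_dart :: "surface_diagram \<Rightarrow> nat \<Rightarrow> nat" where
  "in_dart S k = opp S (walk S ! k)"

text \<open>Passage \<open>j\<close> crosses passage \<open>i\<close> transversally, from its right to its left.\<close>

definition crosses_left :: "surface_diagram \<Rightarrow> nat \<Rightarrow> nat \<Rightarrow> bool" where
  "crosses_left S i j \<longleftrightarrow>
     out_dart S j \<in> between S (out_dart S i) (in_dart S i) \<and>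
     in_dart S j \<in> between S (in_dart S i) (out_dart S i)"

definition is_surface_diagram :: "surface_diagram \<Rightarrow> bool" where
  "is_surface_diagram S \<longleftrightarrow>
     closed_surface S \<and> walk S \<noteq> [] \<and> set (walk S) \<subseteq> darts S \<and>
     distinct (walk S @ map (opp S) (walk S)) \<and>
     same_vertex S (opp S (last (walk S))) (hd (walk S)) \<and>
     (let N = length (walk S) - 1 in
        (\<forall>k < N. same_vertex S (in_dart S k) (out_dart S k)) \<and>
        (\<forall>k < N. \<not> same_vertex S (hd (walk S)) (out_dart S k)) \<and>
        crossings S = {(i, j). i < j \<and> j < N \<and> same_vertex S (out_dart S i) (out_dart S j)} \<and>
        (\<forall>k < N. \<exists>!c \<in> crossings S. k = fst c \<or> k = snd c) \<and>
        (\<forall>(i, j) \<in> crossings S. crosses_left S i j \<or> crosses_left S j i)) \<and>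
     sfirst_over S \<subseteq> crossings S"

definition scr_sign :: "surface_diagram \<Rightarrow> nat \<times> nat \<Rightarrow> int" where
  "scr_sign S c =
     (let over = (if c \<in> sfirst_over S then fst c else snd c);
          under = (if c \<in> sfirst_over S then snd c else fst c)
      in if crosses_left S over under then 1 else - 1)"

text \<open>
  The two loops obtained by smoothing at a crossing: \<open>alpha_loop\<close> avoids the basepoint,
  \<open>beta_loop\<close> runs through it.
\<close>

definition alpha_loop :: "surface_diagram \<Rightarrow> nat \<times> nat \<Rightarrow> nat list" where
  "alpha_loop S c = take (snd c - fst c) (drop (Suc (fst c)) (walk S))"

definition beta_loop :: "surface_diagram \<Rightarrow> nat \<times> nat \<Rightarrow> nat list" where
  "beta_loop S c = drop (Suc (snd c)) (walk S) @ take (Suc (fst c)) (walk S)"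

text \<open>The cellular 1-cycle of a closed edge path, as an odd function of the darts.\<close>

definition cycle_of :: "surface_diagram \<Rightarrow> nat list \<Rightarrow> nat \<Rightarrow> int" where
  "cycle_of S w d = int (count_list w d) - int (count_list w (opp S d))"

text \<open>
  The intersection number of the cycles of two closed edge paths \<open>x\<close> and \<open>y\<close>, with the convention
  that it is \<open>1\<close> for a single point at which the directions of \<open>x\<close> and \<open>y\<close> form a positive basis.
  It is computed by pushing \<open>y\<close> slightly to its left.  The pushed path meets the edges only close to
  the vertices: where \<open>y\<close> arrives along \<open>y ! k\<close> and leaves along the next dart \<open>b\<close>, it crosses
  exactly the darts to the left of \<open>y\<close>, and each of these, directed away from the vertex, crosses it
  from its right to its left.
\<close>

definition intersection_number :: "surface_diagram \<Rightarrow> nat list \<Rightarrow> nat list \<Rightarrow> int" where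
  "intersection_number S x y =
     - (\<Sum>k < length y. \<Sum>d \<in> between S (y ! (Suc k mod length y)) (opp S (y ! k)). cycle_of S x d)"


section \<open>Surface realizations and intersection polynomials\<close>

text \<open>A real crossing as the pair of its passage numbers among all passages through real crossings.\<close>

definition passage_numbers :: "diagram \<Rightarrow> crossing \<Rightarrow> nat \<times> nat" where
  "passage_numbers D c =
     (let num = (\<lambda>s. card {u \<in> fst ` real_cr D \<union> snd ` real_cr D. u < s})
      in (num (fst c), num (snd c)))"

definition surface_realization :: "diagram \<Rightarrow> surface_diagram \<Rightarrow> bool" where
  "surface_realization D S \<longleftrightarrow>
     is_surface_diagram S \<and>
     crossings S = passage_numbers D ` real_cr D \<and>
     sfirst_over S = passage_numbers D ` first_over D \<and>
     (\<forall>c \<in> real_cr D. scr_sign S (passage_numbers D c) = cr_sign D c)"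

definition realization :: "diagram \<Rightarrow> surface_diagram" where
  "realization D = (SOME S. surface_realization D S)"

definition alpha :: "diagram \<Rightarrow> crossing \<Rightarrow> nat list" where
  "alpha D c = alpha_loop (realization D) (passage_numbers D c)"

definition beta :: "diagram \<Rightarrow> crossing \<Rightarrow> nat list" where
  "beta D c = beta_loop (realization D) (passage_numbers D c)"

definition inum :: "diagram \<Rightarrow> nat list \<Rightarrow> nat list \<Rightarrow> int" where
  "inum D x y = intersection_number (realization D) x y"

text \<open>Laurent polynomials over the integers form the group ring of the integers.\<close>

type_synonym laurent_poly = "int \<Rightarrow>\<^sub>0 int"

definition tpow :: "int \<Rightarrow> laurent_poly" where
  "tpow n = Poly_Mapping.single n 1"

definition subst_inverse :: "laurent_poly \<Rightarrow> laurent_poly" where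
  "subst_inverse p = Poly_Mapping.map_key uminus p"

definition crossings_of_type :: "nat \<Rightarrow> diagram \<Rightarrow> crossing set" where
  "crossings_of_type a D = {c \<in> real_cr D. cr_type D c = a}"

definition omega :: "nat \<Rightarrow> diagram \<Rightarrow> int" where
  "omega a D = (\<Sum>c \<in> crossings_of_type a D. cr_sign D c)"

definition poly_W :: "nat \<Rightarrow> diagram \<Rightarrow> laurent_poly" where
  "poly_W a D = (\<Sum>c \<in> crossings_of_type a D.
     of_int (cr_sign D c) * (tpow (inum D (alpha D c) (beta D c)) - 1))"

definition poly_F :: "nat \<Rightarrow> nat \<Rightarrow> diagram \<Rightarrow> laurent_poly" where
  "poly_F a b D = (\<Sum>c \<in> crossings_of_type a D. \<Sum>d \<in> crossings_of_type b D.
     of_int (cr_sign D c * cr_sign D d) * (tpow (inum D (alpha D c) (alpha D d)) - 1))"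

definition poly_G :: "nat \<Rightarrow> nat \<Rightarrow> diagram \<Rightarrow> laurent_poly" where
  "poly_G a b D = (\<Sum>c \<in> crossings_of_type a D. \<Sum>d \<in> crossings_of_type b D.
     of_int (cr_sign D c * cr_sign D d) * (tpow (inum D (alpha D c) (beta D d)) - 1))
     - of_int (omega b D) * poly_W a D"

definition poly_H :: "nat \<Rightarrow> nat \<Rightarrow> diagram \<Rightarrow> laurent_poly" where
  "poly_H a b D = (\<Sum>c \<in> crossings_of_type a D. \<Sum>d \<in> crossings_of_type b D.
     of_int (cr_sign D c * cr_sign D d) * (tpow (inum D (beta D c) (beta D d)) - 1))
     - of_int (omega a D) * poly_W b D
     - of_int (omega b D) * subst_inverse (poly_W a D)"


section \<open>Finite-type invariants under crossing changes\<close>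

definition crossing_change :: "crossing set \<Rightarrow> diagram \<Rightarrow> diagram" where
  "crossing_change A D = D\<lparr>first_over := (first_over D - A) \<union> (A - first_over D)\<rparr>"

definition marked_diagram :: "nat \<Rightarrow> diagram \<Rightarrow> crossing set \<Rightarrow> bool" where
  "marked_diagram k D C \<longleftrightarrow> is_diagram D \<and> C \<subseteq> real_cr D \<and> card C = k"

text \<open>The tuple of the \<open>\<delta>\<^sub>i\<close> is given by the set \<open>A\<close> of the marked crossings with \<open>\<delta>\<^sub>i = 1\<close>.\<close>

definition alternating_sum :: "(diagram \<Rightarrow> 'v::ab_group_add) \<Rightarrow> diagram \<Rightarrow> crossing set \<Rightarrow> 'v" where
  "alternating_sum v D C =
     (\<Sum>A \<in> Pow C. if even (card A) then v (crossing_change A D) else - v (crossing_change A D))"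

definition long_virtual_knot_invariant :: "(diagram \<Rightarrow> 'v) \<Rightarrow> bool" where
  "long_virtual_knot_invariant v \<longleftrightarrow>
     (\<forall>D D'. is_diagram D \<and> is_diagram D' \<and> same_long_virtual_knot D D' \<longrightarrow> v D = v D')"

definition finite_type_invariant :: "nat \<Rightarrow> (diagram \<Rightarrow> 'v::ab_group_add) \<Rightarrow> bool" where
  "finite_type_invariant k v \<longleftrightarrow>
     long_virtual_knot_invariant v \<and>
     (\<forall>D C. marked_diagram (k + 1) D C \<longrightarrow> alternating_sum v D C = 0) \<and>
     (\<exists>D C. marked_diagram k D C \<and> alternating_sum v D C \<noteq> 0)"

end

theory Submission
  imports Defs "HOL-Real_Asymp.Real_Asymp"
begin

text \<open>
  The polynomials are defined by intersection numbers on a surface, but they only see the Gauss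
  diagram.  Let \<open>f\<^sub>c\<close> be twice the multiplicity of the loop \<open>\<alpha>\<^sub>c\<close> as a function of the parameter of the
  line, taken as a mean at the two corners of the loop (\<open>height\<close>).  On every surface realization,
  for loops \<open>x\<close>, \<open>y\<close> with such functions \<open>f\<close>, \<open>g\<close>,

    \<open>4 (x \<cdot> y) = (\<Sum>e = (p, q). s\<^sub>e (f p * g q - f q * g p))\<close>,

  where \<open>e\<close> runs through the real crossings and \<open>s\<^sub>e\<close> is the sign of the pair of directions of
  the first and the second passage.  The intersection number is defined by pushing \<open>y\<close> to its left;
  pushing it to its right changes the result by the total change of \<open>f\<close> along the closed path
  \<open>y\<close>, which is \<open>0\<close>, and the formula is the mean of the two versions (\<open>left_turn_mean\<close>,
  \<open>intersection_number_form\<close>, \<open>inum_form\<close>).  As every Gauss diagram has a surface realization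
  (\<open>surface_realization_exists\<close>), the chosen one obeys this formula.  The right-hand side is
  bilinear and skew-symmetric and ignores the over/under information.

  The loops \<open>\<alpha>\<^sub>c\<close> and \<open>\<beta>\<^sub>c\<close> add up to the whole knot, so all intersection numbers are combinations of
  \<open>w\<^sub>c = \<alpha>\<^sub>c \<cdot> \<beta>\<^sub>c\<close> and \<open>\<alpha>\<^sub>c \<cdot> \<alpha>\<^sub>d\<close>.  Multiplying out the correction terms of \<open>G\<close> and \<open>H\<close> turns each of
  the three polynomials into one sum of \<open>\<epsilon>\<^sub>c \<epsilon>\<^sub>d \<kappa>(w\<^sub>c, w\<^sub>d, \<alpha>\<^sub>c \<cdot> \<alpha>\<^sub>d)\<close> over the pairs of crossings of
  types \<open>a\<close> and \<open>b\<close> (\<open>pair_sum\<close>), with a kernel \<open>\<kappa>\<close> that vanishes as soon as \<open>\<alpha>\<^sub>c\<close> or \<open>\<alpha>\<^sub>d\<close> has zero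
  intersection with everything (\<open>reduced\<close>); this vanishing is what the correction terms achieve.

  Invariance is now visible on the Gauss diagram.  A crossing created by move I has a loop \<open>\<alpha>\<close> that
  meets nothing.  Two crossings created by move II have the same type, opposite signs and
  homologous loops, so they cancel.  Move III and isotopies preserve signs, types and all
  intersection numbers.

  A crossing change does not affect the numbers \<open>w\<^sub>c\<close> and \<open>\<alpha>\<^sub>c \<cdot> \<alpha>\<^sub>d\<close>, and each summand of the pair sum
  depends on the state of at most two crossings.  Hence a third marked crossing makes the
  alternating sum vanish (\<open>alternating_sum_three\<close>).  For two marked crossings \<open>x\<close>, \<open>y\<close> that are the
  only real ones it equals, up to sign, \<open>\<kappa>(w\<^sub>x, w\<^sub>y, \<alpha>\<^sub>x \<cdot> \<alpha>\<^sub>y) + \<kappa>(w\<^sub>y, w\<^sub>x, \<alpha>\<^sub>y \<cdot> \<alpha>\<^sub>x)\<close> for all types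
  (\<open>alternating_sum_two\<close>).  This is nonzero for all three kernels on the standard trefoil shadow
  with its middle crossing made virtual (\<open>trefoil_line\<close>).
\<close>

section \<open>The cyclic order at a vertex\<close>

lemma finite_orbit_period:
  assumes fin: "finite A" and bij: "bij_betw f A A" and a: "a \<in> A"
  obtains n where "0 < n" "(f ^^ n) a = a" "inj_on (\<lambda>m. (f ^^ m) a) {..<n}"
proof -
  have b: "bij_betw (f ^^ m) A A" for m
    using bij by (rule bij_betw_funpow)
  have mem: "(f ^^ m) a \<in> A" for m
    using b[of m] a by (auto simp: bij_betw_def)
  have cancel: "(f ^^ (j - i)) a = a" if "i \<le> j" "(f ^^ i) a = (f ^^ j) a" for i j
  proof -
    have "(f ^^ i) ((f ^^ (j - i)) a) = (f ^^ i) a"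
      using that by (metis funpow_add le_add_diff_inverse comp_apply)
    then show ?thesis
      using b[of i] mem a by (auto simp: bij_betw_def inj_on_def)
  qed
  have "\<not> inj (\<lambda>m. (f ^^ m) a)"
    using finite_subset[of "range (\<lambda>m. (f ^^ m) a)" A] fin mem finite_imageD by blast
  then obtain i j where "i < j" "(f ^^ i) a = (f ^^ j) a"
    unfolding inj_on_def by (metis linorder_neqE_nat)
  then have ex: "\<exists>n. 0 < n \<and> (f ^^ n) a = a"
    using cancel[of i j] by (intro exI[of _ "j - i"]) auto
  define n where "n = (LEAST n. 0 < n \<and> (f ^^ n) a = a)"
  have n: "0 < n" "(f ^^ n) a = a"
    using LeastI_ex[OF ex] by (auto simp: n_def)
  have min: "n \<le> m" if "0 < m" "(f ^^ m) a = a" for m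
    unfolding n_def by (rule Least_le) (use that in auto)
  have False if "i < j" "j < n" "(f ^^ i) a = (f ^^ j) a" for i j
    using min[of "j - i"] cancel[of i j] that by auto
  then have "inj_on (\<lambda>m. (f ^^ m) a) {..<n}"
    unfolding inj_on_def by (metis lessThan_iff linorder_neqE_nat)
  with n that show thesis by blast
qed

lemma funpow_period_mod:
  assumes "(f ^^ n) a = a"
  shows "(f ^^ m) a = (f ^^ (m mod n)) a"
  using assms by (simp add: funpow_mod_eq)

text \<open>
  Numbering the darts of a vertex counterclockwise from \<open>a\<close> turns the cyclic order into arithmetic
  on positions.
\<close>

lemma between_positions:
  assumes per: "(rot S ^^ n) a = a" and inj: "inj_on (\<lambda>m. (rot S ^^ m) a) {..<n}"
    and p: "p < n" and q: "q < n" and t: "t < n" and "p \<noteq> q"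
  shows "(rot S ^^ t) a \<in> between S ((rot S ^^ p) a) ((rot S ^^ q) a) \<longleftrightarrow>
    (if p < q then p < t \<and> t < q else p < t \<or> t < q)"
proof -
  define steps where "steps x = (if p < x then x - p else n + x - p)" for x
  have pos: "(rot S ^^ m) ((rot S ^^ p) a) = (rot S ^^ ((p + m) mod n)) a" for m
    using funpow_period_mod[OF per, of "p + m"] funpow_add[of m p "rot S"] by (simp add: add.commute)
  have eq: "(rot S ^^ i) a = (rot S ^^ j) a \<longleftrightarrow> i = j" if "i < n" "j < n" for i j
    using inj that by (auto simp: inj_on_def)
  \<comment> \<open>\<open>steps x\<close> is the least positive number of turns from position \<open>p\<close> to position \<open>x\<close>.\<close>
  have hit: "(p + steps x) mod n = x" "0 < steps x" if "x < n" for x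
    using that p by (auto simp: steps_def)
  have early: "(p + l) mod n \<noteq> x" if "x < n" "0 < l" "l < steps x" for l x
  proof (cases "p + l < n")
    case True
    then show ?thesis using that p by (auto simp: steps_def split: if_splits)
  next
    case False
    then have "(p + l) mod n = p + l - n"
      using that p by (subst mod_if, subst mod_if) (auto simp: steps_def split: if_splits)
    then show ?thesis using that p False by (auto simp: steps_def split: if_splits)
  qed
  have "(rot S ^^ t) a \<in> between S ((rot S ^^ p) a) ((rot S ^^ q) a) \<longleftrightarrow>
    (\<exists>m>0. (p + m) mod n = t \<and> (\<forall>l. 0 < l \<and> l \<le> m \<longrightarrow> (p + l) mod n \<noteq> q))"
    unfolding between_def mem_Collect_eq pos using eq p q t by (metis mod_less_divisor gr_zeroI not_less0)
  also have "\<dots> \<longleftrightarrow> steps t < steps q"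
  proof
    assume "\<exists>m>0. (p + m) mod n = t \<and> (\<forall>l. 0 < l \<and> l \<le> m \<longrightarrow> (p + l) mod n \<noteq> q)"
    then obtain m where m: "0 < m" "(p + m) mod n = t" "\<And>l. 0 < l \<Longrightarrow> l \<le> m \<Longrightarrow> (p + l) mod n \<noteq> q"
      by blast
    have "steps t \<le> m" using early[OF t, of m] m by force
    moreover have "m < steps q" using m(3)[of "steps q"] hit[OF q] by force
    ultimately show "steps t < steps q" by simp
  next
    assume "steps t < steps q"
    then show "\<exists>m>0. (p + m) mod n = t \<and> (\<forall>l. 0 < l \<and> l \<le> m \<longrightarrow> (p + l) mod n \<noteq> q)"
      using hit[OF t] early[OF q] by (intro exI[of _ "steps t"]) auto
  qed
  also have "\<dots> \<longleftrightarrow> (if p < q then p < t \<and> t < q else p < t \<or> t < q)"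
    using p q t \<open>p \<noteq> q\<close> by (auto simp: steps_def)
  finally show ?thesis .
qed

locale surface_knot =
  fixes S :: surface_diagram
  assumes diag: "is_surface_diagram S"
begin

definition N :: nat where "N = length (walk S) - 1"

lemmas parts = diag[unfolded is_surface_diagram_def Let_def, folded N_def]

lemma closed: "closed_surface S"
  using parts by (elim conjE)

lemma len: "length (walk S) = Suc N"
proof -
  have "walk S \<noteq> []" using parts by (elim conjE)
  then show ?thesis by (simp add: N_def)
qed

lemma walk_darts: "set (walk S) \<subseteq> darts S"
  using parts by (elim conjE)

lemma dist: "distinct (walk S @ map (opp S) (walk S))"
  using parts by (elim conjE)

lemma base_vertex: "same_vertex S (opp S (walk S ! N)) (walk S ! 0)"
  and base_not_crossing: "k < N \<Longrightarrow> \<not> same_vertex S (walk S ! 0) (out_dart S k)"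
proof -
  have ne: "walk S \<noteq> []" using parts by (elim conjE)
  have "same_vertex S (opp S (last (walk S))) (hd (walk S))" using parts by (elim conjE)
  then show "same_vertex S (opp S (walk S ! N)) (walk S ! 0)"
    by (simp add: ne last_conv_nth hd_conv_nth N_def)
  have "\<forall>k<N. \<not> same_vertex S (hd (walk S)) (out_dart S k)" using parts by (elim conjE)
  then show "k < N \<Longrightarrow> \<not> same_vertex S (walk S ! 0) (out_dart S k)"
    by (simp add: ne hd_conv_nth)
qed

lemma in_out: "k < N \<Longrightarrow> same_vertex S (in_dart S k) (out_dart S k)"
  using parts by (elim conjE) simp

lemma crossings_eq:
  "crossings S = {(i, j). i < j \<and> j < N \<and> same_vertex S (out_dart S i) (out_dart S j)}"
  using parts by (elim conjE)

lemma ex1_crossing: "k < N \<Longrightarrow> \<exists>!c. c \<in> crossings S \<and> (k = fst c \<or> k = snd c)"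
  using parts by (elim conjE) simp

lemma transversal: "(i, j) \<in> crossings S \<Longrightarrow> crosses_left S i j \<or> crosses_left S j i"
  using parts by (elim conjE) fast

lemma rot_bij: "bij_betw (rot S) (darts S) (darts S)" and fin: "finite (darts S)"
  and opp_darts: "d \<in> darts S \<Longrightarrow> opp S d \<in> darts S"
  and opp_opp: "d \<in> darts S \<Longrightarrow> opp S (opp S d) = d"
  using closed by (auto simp: closed_surface_def)

lemma walk_dart: "k \<le> N \<Longrightarrow> walk S ! k \<in> darts S"
  using walk_darts len nth_mem[of k "walk S"] by auto

lemma walk_eq_iff: "k \<le> N \<Longrightarrow> l \<le> N \<Longrightarrow> walk S ! k = walk S ! l \<longleftrightarrow> k = l"
  using dist len nth_eq_iff_index_eq[of "walk S" k l] by auto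

lemma opp_walk_eq_iff: "k \<le> N \<Longrightarrow> l \<le> N \<Longrightarrow> opp S (walk S ! k) = opp S (walk S ! l) \<longleftrightarrow> k = l"
  using opp_opp walk_dart walk_eq_iff by metis

lemma walk_disjoint_opp: "d \<in> set (walk S) \<Longrightarrow> opp S d \<notin> set (walk S)"
  using dist by auto

lemma walk_neq_opp: "k \<le> N \<Longrightarrow> l \<le> N \<Longrightarrow> walk S ! k \<noteq> opp S (walk S ! l)"
  using walk_disjoint_opp[of "walk S ! l"] nth_mem[of k "walk S"] nth_mem[of l "walk S"] len by fastforce

lemma out_in_darts: "k < N \<Longrightarrow> out_dart S k \<in> darts S" "k < N \<Longrightarrow> in_dart S k \<in> darts S"
  by (auto simp: out_dart_def in_dart_def intro!: walk_dart opp_darts)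

lemma out_in_distinct:
  assumes "i < N" "j < N"
  shows "out_dart S i \<noteq> in_dart S j" "out_dart S i = out_dart S j \<longleftrightarrow> i = j"
    "in_dart S i = in_dart S j \<longleftrightarrow> i = j"
  using assms by (auto simp: out_dart_def in_dart_def walk_eq_iff opp_walk_eq_iff walk_neq_opp)

lemma same_vertex_trans: "same_vertex S a b \<Longrightarrow> same_vertex S b c \<Longrightarrow> same_vertex S a c"
  unfolding same_vertex_def by (metis funpow_add comp_apply)

lemma same_vertex_sym:
  assumes "same_vertex S a b" "a \<in> darts S"
  shows "same_vertex S b a"
proof -
  obtain n where n: "0 < n" "(rot S ^^ n) a = a"
    using finite_orbit_period[OF fin rot_bij assms(2)] by metis
  obtain m where m: "(rot S ^^ m) a = b" using assms by (auto simp: same_vertex_def)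
  have "(rot S ^^ (n * m - m)) b = (rot S ^^ (n * m)) a"
    using n m funpow_add[of "n * m - m" m "rot S"] by simp
  also have "\<dots> = a" using funpow_period_mod[OF n(2), of "n * m"] by simp
  finally show ?thesis by (auto simp: same_vertex_def)
qed

lemma position:
  assumes "same_vertex S a b" "(rot S ^^ n) a = a" "0 < n"
  obtains m where "m < n" "b = (rot S ^^ m) a"
  using assms funpow_period_mod[of n "rot S" a] mod_less_divisor unfolding same_vertex_def by metis

lemma between_same_vertex: "d \<in> between S a b \<Longrightarrow> same_vertex S a d"
  by (auto simp: between_def same_vertex_def)

lemma between_endpoints:
  assumes "a \<in> darts S" "same_vertex S a b" "a \<noteq> b"
  shows "a \<notin> between S a b" "b \<notin> between S a b"
proof -
  obtain n where n: "0 < n" "(rot S ^^ n) a = a" "inj_on (\<lambda>m. (rot S ^^ m) a) {..<n}"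
    using finite_orbit_period[OF fin rot_bij assms(1)] .
  obtain q where q: "q < n" "b = (rot S ^^ q) a" using position[OF assms(2) n(2,1)] .
  have "q \<noteq> 0" using q assms(3) by (intro notI) simp
  then show "a \<notin> between S a b" "b \<notin> between S a b"
    using between_positions[OF n(2,3) n(1) q(1) n(1)] between_positions[OF n(2,3) n(1) q(1) q(1)] q
    by auto
qed

text \<open>
  If passage \<open>j\<close> crosses passage \<open>i\<close> from right to left, the four darts occur counterclockwise in
  the order out \<open>i\<close>, out \<open>j\<close>, in \<open>i\<close>, in \<open>j\<close>.  This decides what lies to the left of each way to pass
  the crossing, straight or turning from one strand to the other.
\<close>

lemma crosses_left_cyclic_order:
  assumes i: "i < N" and j: "j < N" and "i \<noteq> j" and c: "crosses_left S i j"
  shows "between S (out_dart S i) (in_dart S i) \<inter> {out_dart S i, in_dart S i, out_dart S j, in_dart S j} = {out_dart S j}"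
    "between S (out_dart S j) (in_dart S j) \<inter> {out_dart S i, in_dart S i, out_dart S j, in_dart S j} = {in_dart S i}"
    "between S (out_dart S i) (in_dart S j) \<inter> {out_dart S i, in_dart S i, out_dart S j, in_dart S j} = {out_dart S j, in_dart S i}"
    "between S (out_dart S j) (in_dart S i) \<inter> {out_dart S i, in_dart S i, out_dart S j, in_dart S j} = {}"
    "\<not> crosses_left S j i"
proof -
  let ?a = "out_dart S i"
  obtain n where n: "0 < n" "(rot S ^^ n) ?a = ?a" "inj_on (\<lambda>m. (rot S ^^ m) ?a) {..<n}"
    using finite_orbit_period[OF fin rot_bij out_in_darts(1)[OF i]] .
  have io: "same_vertex S ?a (in_dart S i)"
    by (rule same_vertex_sym[OF in_out[OF i] out_in_darts(2)[OF i]])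
  have mem: "out_dart S j \<in> between S ?a (in_dart S i)" "in_dart S j \<in> between S (in_dart S i) ?a"
    using c by (auto simp: crosses_left_def)
  obtain q where q: "q < n" "in_dart S i = (rot S ^^ q) ?a" using position[OF io n(2,1)] .
  obtain t where t: "t < n" "out_dart S j = (rot S ^^ t) ?a"
    using position[OF between_same_vertex[OF mem(1)] n(2,1)] .
  obtain u where u: "u < n" "in_dart S j = (rot S ^^ u) ?a"
    using position[OF same_vertex_trans[OF io between_same_vertex[OF mem(2)]] n(2,1)] .
  have "q \<noteq> 0" using q out_in_distinct(1)[OF i i] by (intro notI) simp
  note B = between_positions[OF n(2,3)]
  have tq: "0 < t" "t < q"
    using mem(1) B[OF n(1) q(1) t(1)] \<open>q \<noteq> 0\<close> unfolding q(2) t(2) by auto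
  have qu: "q < u"
    using mem(2) B[OF q(1) n(1) u(1)] \<open>q \<noteq> 0\<close> unfolding q(2) u(2) by auto
  \<comment> \<open>The positions of out \<open>i\<close>, out \<open>j\<close>, in \<open>i\<close>, in \<open>j\<close> are \<open>0 < t < q < u\<close>.\<close>
  have a0: "?a = (rot S ^^ 0) ?a" by simp
  note R = a0 q(2) t(2) u(2)
  have M: "x \<in> between S y z \<longleftrightarrow> (if p < r then p < s \<and> s < r else p < s \<or> s < r)"
    if "x = (rot S ^^ s) ?a" "y = (rot S ^^ p) ?a" "z = (rot S ^^ r) ?a" "p < n" "r < n" "s < n" "p \<noteq> r"
    for x y z p r s
    using B[OF that(4-7)] that(1-3) by simp
  have A1: "?a \<notin> between S ?a (in_dart S i)" "in_dart S i \<notin> between S ?a (in_dart S i)"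
    "out_dart S j \<in> between S ?a (in_dart S i)" "in_dart S j \<notin> between S ?a (in_dart S i)"
    using M[OF R(1) R(1) R(2)] M[OF R(2) R(1) R(2)] M[OF R(3) R(1) R(2)] M[OF R(4) R(1) R(2)] n q t u tq qu
    by auto
  have A2: "?a \<notin> between S (out_dart S j) (in_dart S j)" "in_dart S i \<in> between S (out_dart S j) (in_dart S j)"
    "out_dart S j \<notin> between S (out_dart S j) (in_dart S j)" "in_dart S j \<notin> between S (out_dart S j) (in_dart S j)"
    using M[OF R(1) R(3) R(4)] M[OF R(2) R(3) R(4)] M[OF R(3) R(3) R(4)] M[OF R(4) R(3) R(4)] n q t u tq qu
    by auto
  have A3: "?a \<notin> between S ?a (in_dart S j)" "in_dart S i \<in> between S ?a (in_dart S j)"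
    "out_dart S j \<in> between S ?a (in_dart S j)" "in_dart S j \<notin> between S ?a (in_dart S j)"
    using M[OF R(1) R(1) R(4)] M[OF R(2) R(1) R(4)] M[OF R(3) R(1) R(4)] M[OF R(4) R(1) R(4)] n q t u tq qu
    by auto
  have A4: "?a \<notin> between S (out_dart S j) (in_dart S i)" "in_dart S i \<notin> between S (out_dart S j) (in_dart S i)"
    "out_dart S j \<notin> between S (out_dart S j) (in_dart S i)" "in_dart S j \<notin> between S (out_dart S j) (in_dart S i)"
    using M[OF R(1) R(3) R(2)] M[OF R(2) R(3) R(2)] M[OF R(3) R(3) R(2)] M[OF R(4) R(3) R(2)] n q t u tq qu
    by auto
  from A1 show "between S ?a (in_dart S i) \<inter> {?a, in_dart S i, out_dart S j, in_dart S j} = {out_dart S j}" by blast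
  from A2 show "between S (out_dart S j) (in_dart S j) \<inter> {?a, in_dart S i, out_dart S j, in_dart S j} = {in_dart S i}" by blast
  from A3 show "between S ?a (in_dart S j) \<inter> {?a, in_dart S i, out_dart S j, in_dart S j} = {out_dart S j, in_dart S i}" by blast
  from A4 show "between S (out_dart S j) (in_dart S i) \<inter> {?a, in_dart S i, out_dart S j, in_dart S j} = {}" by blast
  from A2 show "\<not> crosses_left S j i" by (auto simp: crosses_left_def)
qed


section \<open>Intersection numbers as a sum over the crossings\<close>

definition edge :: "nat list \<Rightarrow> nat \<Rightarrow> int" where
  "edge x k = int (count_list x (walk S ! k))"

lemma cycle_of_walk:
  assumes "set x \<subseteq> set (walk S)" "k \<le> N"
  shows "cycle_of S x (walk S ! k) = edge x k" "cycle_of S x (opp S (walk S ! k)) = - edge x k"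
proof -
  have "walk S ! k \<in> set (walk S)" using assms len by simp
  then have "opp S (walk S ! k) \<notin> set x" using walk_disjoint_opp assms by blast
  then show "cycle_of S x (walk S ! k) = edge x k" "cycle_of S x (opp S (walk S ! k)) = - edge x k"
    using opp_opp[OF walk_dart[OF assms(2)]]
    by (auto simp: cycle_of_def edge_def count_notin)
qed

lemma cycle_of_support:
  assumes "set x \<subseteq> set (walk S)" "d \<in> darts S" "cycle_of S x d \<noteq> 0"
  obtains k where "k \<le> N" "d = walk S ! k \<or> d = opp S (walk S ! k)"
proof -
  have "d \<in> set x \<or> opp S d \<in> set x"
    using assms(3) by (auto simp: cycle_of_def count_list_0_iff)
  then have "d \<in> set (walk S) \<or> opp S d \<in> set (walk S)" using assms(1) by blast
  then obtain k where k: "k \<le> N" "d = walk S ! k \<or> opp S d = walk S ! k"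
    using len by (metis in_set_conv_nth less_Suc_eq_le)
  have "d = opp S (walk S ! k)" if "opp S d = walk S ! k"
    using opp_opp[OF assms(2)] that by simp
  with k that show thesis by metis
qed

definition partners :: "nat \<Rightarrow> nat \<Rightarrow> bool" where
  "partners p q \<longleftrightarrow> (p, q) \<in> crossings S \<or> (q, p) \<in> crossings S"

lemma crossing_bounds: "(i, j) \<in> crossings S \<Longrightarrow> i < j \<and> j < N"
  by (simp add: crossings_eq)

lemma partners_sym: "partners p q \<Longrightarrow> partners q p"
  by (auto simp: partners_def)

lemma partners_bounds: "partners p q \<Longrightarrow> p < N \<and> q < N \<and> p \<noteq> q"
  using crossing_bounds by (fastforce simp: partners_def)

lemma partners_unique:
  assumes "partners p q" "partners p r"
  shows "q = r"
proof -
  have ex: "\<exists>!c. c \<in> crossings S \<and> (p = fst c \<or> p = snd c)"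
    using ex1_crossing partners_bounds assms by blast
  have *: "\<exists>c. c \<in> crossings S \<and> (p = fst c \<or> p = snd c) \<and> (c = (p, u) \<or> c = (u, p))" if "partners p u" for u
    using that by (auto simp: partners_def)
  from *[OF assms(1)] *[OF assms(2)] ex partners_bounds[OF assms(1)] partners_bounds[OF assms(2)]
  show ?thesis by (metis Pair_inject)
qed

lemma crosses_left_partners:
  assumes "partners p q"
  shows "crosses_left S q p \<longleftrightarrow> \<not> crosses_left S p q"
  using assms transversal crosses_left_cyclic_order(5) partners_bounds[OF assms]
  unfolding partners_def by metis

text \<open>
  The cell decomposition may have further edges at a crossing; a chain carried by the knot vanishes
  on them, so only the four darts of the two strands count.
\<close>

lemma vertex_support:
  assumes pq: "partners p q" and x: "set x \<subseteq> set (walk S)"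
    and d: "same_vertex S (out_dart S p) d" "d \<in> darts S" "cycle_of S x d \<noteq> 0"
  shows "d \<in> {out_dart S p, in_dart S p, out_dart S q, in_dart S q}"
proof -
  have p: "p < N" using partners_bounds[OF pq] by simp
  have sv: "r \<in> {p, q}" if "r < N" "same_vertex S (out_dart S p) (out_dart S r)" for r
  proof (cases "p = r")
    case False
    then have "partners p r"
      using that p same_vertex_sym[OF that(2) out_in_darts(1)[OF p]]
      by (cases "p < r") (auto simp: partners_def crossings_eq)
    then show ?thesis using partners_unique pq by blast
  qed auto
  have nb: "\<not> same_vertex S (out_dart S p) (walk S ! 0)"
    using base_not_crossing[OF p] same_vertex_sym out_in_darts(1)[OF p] by blast
  obtain k where k: "k \<le> N" "d = walk S ! k \<or> d = opp S (walk S ! k)"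
    using cycle_of_support[OF x d(2,3)] .
  from k(2) show ?thesis
  proof
    assume dk: "d = walk S ! k"
    then have "k \<noteq> 0" using nb d(1) by (intro notI) simp
    then obtain r where r: "k = Suc r" by (cases k) auto
    then have "r < N" "d = out_dart S r" using k dk by (auto simp: out_dart_def)
    then show ?thesis using sv d(1) by auto
  next
    assume dk: "d = opp S (walk S ! k)"
    show ?thesis
    proof (cases "k = N")
      case True
      then show ?thesis using nb dk d(1) base_vertex same_vertex_trans by blast
    next
      case False
      then have r: "k < N" "d = in_dart S k" using k dk by (auto simp: in_dart_def)
      then have "same_vertex S (out_dart S p) (out_dart S k)"
        using d(1) in_out same_vertex_trans by blast
      then show ?thesis using sv r by auto
    qed
  qed
qed

text \<open>
  The contribution of one corner of \<open>y\<close>, arriving along \<open>a\<close> and leaving along \<open>b\<close>, to the number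
  obtained by pushing \<open>y\<close> to its left.
\<close>

definition left_turn :: "nat list \<Rightarrow> nat \<Rightarrow> nat \<Rightarrow> int" where
  "left_turn x a b = - (\<Sum>d \<in> between S b (opp S a). cycle_of S x d)"

lemma intersection_number_left_turns:
  "intersection_number S x y = (\<Sum>k < length y. left_turn x (y ! k) (y ! (Suc k mod length y)))"
  by (simp add: intersection_number_def left_turn_def sum_negf)

lemma between_subset: 
  assumes "a \<in> darts S" 
  shows "between S a b \<subseteq> darts S"
proof -
  have "(rot S ^^ m) a \<in> darts S" for m
    using bij_betw_funpow[OF rot_bij, of m] assms by (auto simp: bij_betw_def)
  then show ?thesis by (auto simp: between_def)
qed

lemma sum_between_crossing:
  assumes pq: "partners p q" and x: "set x \<subseteq> set (walk S)"
  shows "(\<Sum>d \<in> between S (out_dart S p) b. cycle_of S x d) =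
    (\<Sum>d \<in> between S (out_dart S p) b \<inter> {out_dart S p, in_dart S p, out_dart S q, in_dart S q}. cycle_of S x d)"
proof (rule sum.mono_neutral_right)
  have sub: "between S (out_dart S p) b \<subseteq> darts S"
    using between_subset out_in_darts partners_bounds[OF pq] by blast
  then show "finite (between S (out_dart S p) b)" using fin finite_subset by blast
  show "\<forall>i\<in>between S (out_dart S p) b - between S (out_dart S p) b \<inter>
     {out_dart S p, in_dart S p, out_dart S q, in_dart S q}. cycle_of S x i = 0"
    using vertex_support[OF pq x] sub between_same_vertex by blast
qed auto

lemma left_turn_crossing:
  assumes pq: "partners p q" and x: "set x \<subseteq> set (walk S)"
  shows "left_turn x (walk S ! p) (walk S ! Suc p) =
      (if crosses_left S p q then - edge x (Suc q) else edge x q)"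
    "left_turn x (walk S ! q) (walk S ! Suc p) =
      (if crosses_left S p q then edge x p - edge x (Suc q) else 0)"
proof -
  have b: "p < N" "q < N" "p \<noteq> q" using partners_bounds[OF pq] by auto
  have out: "cycle_of S x (out_dart S r) = edge x (Suc r)" and inn: "cycle_of S x (in_dart S r) = - edge x r" if "r < N" for r
    using cycle_of_walk[OF x] that by (auto simp: out_dart_def in_dart_def)
  have neq: "out_dart S q \<noteq> in_dart S p" using out_in_distinct b by blast
  have comm: "{out_dart S q, in_dart S q, out_dart S p, in_dart S p} = {out_dart S p, in_dart S p, out_dart S q, in_dart S q}"
    by blast
  show "left_turn x (walk S ! p) (walk S ! Suc p) =
      (if crosses_left S p q then - edge x (Suc q) else edge x q)"
    using crosses_left_cyclic_order(1)[OF b] crosses_left_cyclic_order(2)[OF b(2,1) b(3)[symmetric]]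
      crosses_left_partners[OF pq] out inn b
    unfolding left_turn_def in_dart_def[symmetric] out_dart_def[symmetric] sum_between_crossing[OF pq x] comm
    by auto
  show "left_turn x (walk S ! q) (walk S ! Suc p) =
      (if crosses_left S p q then edge x p - edge x (Suc q) else 0)"
    using crosses_left_cyclic_order(3)[OF b] crosses_left_cyclic_order(4)[OF b(2,1) b(3)[symmetric]]
      crosses_left_partners[OF pq] out inn b neq
    unfolding left_turn_def in_dart_def[symmetric] out_dart_def[symmetric] sum_between_crossing[OF pq x] comm
    by auto
qed

text \<open>
  The only darts of the knot at the basepoint are its first dart and the reverse of its last one,
  and neither lies strictly to the left of the passage.
\<close>

lemma left_turn_base:
  assumes x: "set x \<subseteq> set (walk S)"
  shows "left_turn x (walk S ! N) (walk S ! 0) = 0"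
proof -
  let ?a = "walk S ! 0" and ?b = "opp S (walk S ! N)"
  have ab: "?a \<in> darts S" "?b \<in> darts S" "?a \<noteq> ?b" 
    using walk_dart opp_darts walk_neq_opp by auto
  have sv: "same_vertex S ?a ?b" using same_vertex_sym[OF base_vertex ab(2)] .
  have "cycle_of S x d = 0" if d: "d \<in> between S ?a ?b" for d
  proof (rule ccontr)
    assume nz: "cycle_of S x d \<noteq> 0"
    have svd: "same_vertex S ?a d" using d by (rule between_same_vertex)
    have "d \<in> darts S" using between_subset[OF ab(1)] d by blast
    then obtain k where k: "k \<le> N" "d = walk S ! k \<or> d = opp S (walk S ! k)"
      using cycle_of_support[OF x _ nz] by blast
    have "k \<noteq> 0" if "d = walk S ! k"
      using between_endpoints(1)[OF ab(1) sv ab(3)] d that by (intro notI) simp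
    moreover have "k \<noteq> N" if "d = opp S (walk S ! k)"
      using between_endpoints(2)[OF ab(1) sv ab(3)] d that by (intro notI) simp
    moreover have False if "d = walk S ! Suc r" "r < N" for r
      using base_not_crossing[OF that(2)] svd that(1) by (simp add: out_dart_def)
    moreover have False if "d = opp S (walk S ! k)" "k < N"
      using base_not_crossing[OF that(2)] same_vertex_trans[OF svd, of "out_dart S k"] in_out[OF that(2)] that(1)
      by (simp add: in_dart_def)
    ultimately show False
      using k by (metis Suc_le_lessD le_neq_implies_less not0_implies_Suc)
  qed
  then show ?thesis by (simp add: left_turn_def)
qed

end

lemma sum_closed_path:
  fixes g :: "nat \<Rightarrow> nat \<Rightarrow> 'a::comm_monoid_add"
  shows "(\<Sum>k < Suc n. g k (Suc k mod Suc n)) = (\<Sum>k<n. g k (Suc k)) + g n 0"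
proof -
  have "(\<Sum>k<n. g k (Suc k mod Suc n)) = (\<Sum>k<n. g k (Suc k))"
    by (rule sum.cong) auto
  then show ?thesis by simp
qed

lemma count_list_distinct: "distinct xs \<Longrightarrow> count_list xs x = of_bool (x \<in> set xs)"
  by (induction xs) auto

text \<open>
  Twice the multiplicity of the loop \<open>\<alpha>\<close> of a crossing at the parameter \<open>t\<close>, taken as the sum of
  the multiplicities just before and just after \<open>t\<close>, so that it is \<open>1\<close> at the corners of the loop.
\<close>

definition height :: "'a::linorder \<times> 'a \<Rightarrow> 'a \<Rightarrow> int" where
  "height c t = of_bool (fst c < t \<and> t \<le> snd c) + of_bool (fst c \<le> t \<and> t < snd c)"

lemma sum_height:
  fixes G :: "nat \<Rightarrow> int"
  assumes "i < j" "j < n"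
  shows "(\<Sum>p<n. G p * height (i, j) p) = G i + G j + 2 * (\<Sum>p \<in> {Suc i..<j}. G p)"
proof -
  have "(\<Sum>p<n. G p * height (i, j) p) = (\<Sum>p\<in>insert i (insert j {Suc i..<j}). G p * height (i, j) p)"
    by (rule sum.mono_neutral_right) (use assms in \<open>auto simp: height_def\<close>)
  also have "\<dots> = G i + G j + (\<Sum>p \<in> {Suc i..<j}. G p * height (i, j) p)"
    using assms by (simp add: height_def)
  also have "(\<Sum>p \<in> {Suc i..<j}. G p * height (i, j) p) = 2 * (\<Sum>p \<in> {Suc i..<j}. G p)"
    unfolding sum_distrib_left by (rule sum.cong) (auto simp: height_def)
  finally show ?thesis .
qed

lemma sum_coheight:
  fixes G :: "nat \<Rightarrow> int"
  assumes "i < j" "j < n"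
  shows "(\<Sum>p<n. G p * (2 - height (i, j) p)) =
    G i + G j + 2 * (\<Sum>p<i. G p) + 2 * (\<Sum>p \<in> {Suc j..<n}. G p)"
proof -
  have "(\<Sum>p<n. G p) = (\<Sum>p<i. G p) + (G i + G j + (\<Sum>p \<in> {Suc i..<j}. G p) + (\<Sum>p \<in> {Suc j..<n}. G p))"
    using assms sum.atLeastLessThan_concat[of 0 i n G] sum.atLeastLessThan_concat[of i j n G]
      sum.atLeast_Suc_lessThan[of i j G] sum.atLeast_Suc_lessThan[of j n G]
    by (simp add: atLeast0LessThan)
  then show ?thesis
    using sum_height[OF assms, of G]
    by (simp add: right_diff_distrib sum_subtractf sum_distrib_right[symmetric])
qed

context surface_knot
begin

definition direction :: "nat \<Rightarrow> nat \<Rightarrow> int" where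
  "direction p q = (if crosses_left S p q then 1 else - 1)"

lemma direction_swap: "partners p q \<Longrightarrow> direction q p = - direction p q"
  using crosses_left_partners by (simp add: direction_def)

definition partner :: "nat \<Rightarrow> nat" where
  "partner p = (THE q. partners p q)"

lemma partner_eq: "partners p q \<Longrightarrow> partner p = q"
  unfolding partner_def using partners_unique by blast

lemma partners_partner: "p < N \<Longrightarrow> partners p (partner p)"
  using ex1_crossing[of p] partner_eq unfolding partners_def
  by (metis partners_def prod.collapse)

text \<open>
  A closed walk \<open>x\<close> on the diagram, represented by twice its mean multiplicity \<open>F\<close> at each passage.
  The conditions on \<open>edge\<close> say that the boundary of the chain \<open>x\<close> vanishes at the basepoint and at
  each crossing.
\<close>

definition represents :: "nat list \<Rightarrow> (nat \<Rightarrow> int) \<Rightarrow> bool" where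
  "represents x F \<longleftrightarrow> set x \<subseteq> set (walk S) \<and> edge x N = edge x 0 \<and>
     (\<forall>p<N. F p = edge x p + edge x (Suc p)) \<and>
     (\<forall>p q. partners p q \<longrightarrow> edge x p + edge x q = edge x (Suc p) + edge x (Suc q))"

text \<open>
  Pushing to the left differs from the mean of pushing to either side by a coboundary: half the
  change of the multiplicity of \<open>x\<close> along the corner of \<open>y\<close>.  The factor \<open>4\<close> clears the halves
  that come from the mean over two sides and from the doubled multiplicities.
\<close>

lemma left_turn_mean:
  assumes x: "represents x F" and pq: "partners p q"
  shows "4 * left_turn x (walk S ! p) (walk S ! Suc p) =
      - 2 * direction p q * F q + 2 * (edge x (Suc p) - edge x p)"
    "4 * left_turn x (walk S ! q) (walk S ! Suc p) =
      direction p q * (F p - F q) + 2 * (edge x (Suc p) - edge x q)"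
proof -
  have sub: "set x \<subseteq> set (walk S)" and F: "F p = edge x p + edge x (Suc p)" "F q = edge x q + edge x (Suc q)"
    and cyc: "edge x p + edge x q = edge x (Suc p) + edge x (Suc q)"
    using x pq partners_bounds[OF pq] by (auto simp: represents_def)
  show "4 * left_turn x (walk S ! p) (walk S ! Suc p) =
      - 2 * direction p q * F q + 2 * (edge x (Suc p) - edge x p)"
    using cyc by (auto simp: left_turn_crossing[OF pq sub] F direction_def)
  show "4 * left_turn x (walk S ! q) (walk S ! Suc p) =
      direction p q * (F p - F q) + 2 * (edge x (Suc p) - edge x q)"
    using cyc by (auto simp: left_turn_crossing[OF pq sub] F direction_def)
qed

lemma alpha_loop_conv:
  assumes "i < j" "j < N"
  shows "alpha_loop S (i, j) = map ((!) (walk S)) [Suc i..<Suc j]"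
  using assms len by (intro nth_equalityI) (auto simp: alpha_loop_def simp del: upt_Suc)

lemma beta_loop_conv:
  assumes "i < j" "j < N"
  shows "beta_loop S (i, j) = map ((!) (walk S)) ([Suc j..<Suc N] @ [0..<Suc i])"
  unfolding beta_loop_def map_append
  by (rule arg_cong2[of _ _ _ _ "(@)"]; intro nth_equalityI)
     (use assms len in \<open>auto simp del: upt_Suc\<close>)

lemma edge_map_walk:
  assumes "distinct ks" "set ks \<subseteq> {..N}" "k \<le> N"
  shows "edge (map ((!) (walk S)) ks) k = of_bool (k \<in> set ks)"
proof -
  have inj: "inj_on ((!) (walk S)) (set ks)"
    using assms walk_eq_iff by (auto simp: inj_on_def subset_iff)
  have "count_list (map ((!) (walk S)) ks) (walk S ! k) = of_bool (walk S ! k \<in> (!) (walk S) ` set ks)"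
    using count_list_distinct[of "map ((!) (walk S)) ks" "walk S ! k"] inj assms(1)
    by (simp add: distinct_map)
  moreover have "walk S ! k \<in> (!) (walk S) ` set ks \<longleftrightarrow> k \<in> set ks"
    using assms walk_eq_iff by (auto simp: subset_iff)
  ultimately show ?thesis by (simp add: edge_def)
qed

lemma edge_alpha_loop:
  assumes "i < j" "j < N" "k \<le> N"
  shows "edge (alpha_loop S (i, j)) k = of_bool (i < k \<and> k \<le> j)"
proof -
  have "edge (alpha_loop S (i, j)) k = of_bool (k \<in> set [Suc i..<Suc j])"
    unfolding alpha_loop_conv[OF assms(1,2)] by (rule edge_map_walk) (use assms in auto)
  then show ?thesis by (auto simp del: upt_Suc)
qed

lemma edge_beta_loop:
  assumes "i < j" "j < N" "k \<le> N"
  shows "edge (beta_loop S (i, j)) k = 1 - of_bool (i < k \<and> k \<le> j)"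
proof -
  have "edge (beta_loop S (i, j)) k = of_bool (k \<in> set ([Suc j..<Suc N] @ [0..<Suc i]))"
    unfolding beta_loop_conv[OF assms(1,2)] by (rule edge_map_walk) (use assms in auto)
  then show ?thesis using assms by (auto simp del: upt_Suc)
qed

lemma represents_loops:
  assumes c: "(i, j) \<in> crossings S"
  shows "represents (alpha_loop S (i, j)) (height (i, j))"
    "represents (beta_loop S (i, j)) (\<lambda>p. 2 - height (i, j) p)"
proof -
  have b: "i < j" "j < N" using crossing_bounds[OF c] by auto
  have cyc: "of_bool (i < p \<and> p \<le> j) + of_bool (i < q \<and> q \<le> j) =
      (of_bool (i < Suc p \<and> Suc p \<le> j) + of_bool (i < Suc q \<and> Suc q \<le> j) :: int)"
    if pq: "partners p q" for p q
  proof (cases "p \<in> {i, j} \<or> q \<in> {i, j}")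
    case True
    have "partners i j" using c by (simp add: partners_def)
    then have "p = i \<and> q = j \<or> p = j \<and> q = i"
      using True pq partners_unique partners_sym by blast
    then show ?thesis using b by auto
  next
    case False
    then show ?thesis by (auto simp: of_bool_def)
  qed
  have pb: "p < N" "q < N" if "partners p q" for p q
    using partners_bounds[OF that] by auto
  have sub: "set (alpha_loop S (i, j)) \<subseteq> set (walk S)" "set (beta_loop S (i, j)) \<subseteq> set (walk S)"
    using set_take_subset set_drop_subset by (fastforce simp: alpha_loop_def beta_loop_def)+
  have edge_alpha: "edge (alpha_loop S (i, j)) k = of_bool (i < k \<and> k \<le> j)" if "k \<le> N" for k
    using edge_alpha_loop[OF b that] .
  have edge_beta: "edge (beta_loop S (i, j)) k = 1 - of_bool (i < k \<and> k \<le> j)" if "k \<le> N" for k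
    using edge_beta_loop[OF b that] .
  show "represents (alpha_loop S (i, j)) (height (i, j))"
    unfolding represents_def
  proof (intro conjI allI impI)
    show "height (i, j) p = edge (alpha_loop S (i, j)) p + edge (alpha_loop S (i, j)) (Suc p)" if "p < N" for p
      using that by (simp add: edge_alpha height_def less_Suc_eq_le Suc_le_eq)
    show "edge (alpha_loop S (i, j)) p + edge (alpha_loop S (i, j)) q =
        edge (alpha_loop S (i, j)) (Suc p) + edge (alpha_loop S (i, j)) (Suc q)" if "partners p q" for p q
      using cyc[OF that] pb[OF that] by (simp only: edge_alpha Suc_leI less_imp_le)
  qed (use sub b in \<open>auto simp: edge_alpha\<close>)
  show "represents (beta_loop S (i, j)) (\<lambda>p. 2 - height (i, j) p)"
    unfolding represents_def
  proof (intro conjI allI impI)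
    show "2 - height (i, j) p = edge (beta_loop S (i, j)) p + edge (beta_loop S (i, j)) (Suc p)" if "p < N" for p
      using that by (simp add: edge_beta height_def less_Suc_eq_le Suc_le_eq)
    show "edge (beta_loop S (i, j)) p + edge (beta_loop S (i, j)) q =
        edge (beta_loop S (i, j)) (Suc p) + edge (beta_loop S (i, j)) (Suc q)" if "partners p q" for p q
      using cyc[OF that] pb[OF that] by (simp only: edge_beta Suc_leI less_imp_le)
  qed (use sub b in \<open>auto simp: edge_beta\<close>)
qed

text \<open>
  Along a straight stretch of \<open>y\<close> the coboundary terms telescope.
\<close>

lemma sum_straight:
  assumes x: "represents x F" and m: "m \<le> n" "n \<le> N"
  shows "4 * (\<Sum>p \<in> {m..<n}. left_turn x (walk S ! p) (walk S ! Suc p)) =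
    2 * (\<Sum>p \<in> {m..<n}. - direction p (partner p) * F (partner p)) + 2 * (edge x n - edge x m)"
proof -
  have "4 * (\<Sum>p \<in> {m..<n}. left_turn x (walk S ! p) (walk S ! Suc p)) =
     (\<Sum>p \<in> {m..<n}. 2 * (- direction p (partner p) * F (partner p)) + 2 * (edge x (Suc p) - edge x p))"
    unfolding sum_distrib_left
    by (rule sum.cong[OF refl], subst left_turn_mean(1)[OF x partners_partner]) (use m in auto)
  also have "\<dots> = 2 * (\<Sum>p \<in> {m..<n}. - direction p (partner p) * F (partner p)) + 2 * (\<Sum>p \<in> {m..<n}. edge x (Suc p) - edge x p)"
    by (simp only: sum.distrib sum_distrib_left)
  finally show ?thesis using sum_Suc_diff'[OF m(1), of "edge x"] by simp
qed

text \<open>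
  Around the closed path the coboundary terms cancel.  At the crossing itself the loop turns from
  one strand to the other, and its two halves give the weight \<open>1\<close> of \<open>height\<close>, against the weight
  \<open>2\<close> of the straight passages.
\<close>

lemma intersection_number_alpha_loop:
  assumes x: "represents x F" and c: "(i, j) \<in> crossings S"
  shows "4 * intersection_number S x (alpha_loop S (i, j)) =
    (\<Sum>p<N. - direction p (partner p) * F (partner p) * height (i, j) p)"
proof -
  have b: "i < j" "j < N" using crossing_bounds[OF c] by auto
  have pij: "partners i j" using c by (simp add: partners_def)
  let ?y = "alpha_loop S (i, j)" and ?T = "\<lambda>p q. left_turn x (walk S ! p) (walk S ! q)"
  let ?G = "\<lambda>p. - direction p (partner p) * F (partner p)"
  have leny: "length ?y = Suc (j - Suc i)"
    using b by (simp add: alpha_loop_conv del: upt_Suc)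
  have nthy: "?y ! k = walk S ! (Suc i + k)" if "k < length ?y" for k
    using b that by (simp add: alpha_loop_conv leny del: upt_Suc)
  have "intersection_number S x ?y =
      (\<Sum>k < Suc (j - Suc i). left_turn x (walk S ! (Suc i + k)) (walk S ! (Suc i + Suc k mod Suc (j - Suc i))))"
    unfolding intersection_number_left_turns leny by (rule sum.cong) (auto simp: nthy leny)
  also have "\<dots> = (\<Sum>k < j - Suc i. ?T (Suc i + k) (Suc i + Suc k)) + ?T j (Suc i)"
    using b sum_closed_path[of "\<lambda>k l. ?T (Suc i + k) (Suc i + l)"] by simp
  also have "(\<Sum>k < j - Suc i. ?T (Suc i + k) (Suc i + Suc k)) = (\<Sum>p\<in>{Suc i..<j}. ?T p (Suc p))"
    using b sum.atLeastLessThan_shift_0[of "\<lambda>p. ?T p (Suc p)" "Suc i" j]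
    by (simp add: atLeast0LessThan add.commute)
  finally have "4 * intersection_number S x ?y = 4 * (\<Sum>p\<in>{Suc i..<j}. ?T p (Suc p)) + 4 * ?T j (Suc i)"
    by simp
  also have "\<dots> = 2 * (\<Sum>p \<in> {Suc i..<j}. ?G p) + direction i j * (F i - F j)"
    using sum_straight[OF x, of "Suc i" j] left_turn_mean(2)[OF x pij] b by simp
  also have "direction i j * (F i - F j) = ?G i + ?G j"
    using partner_eq[OF pij] partner_eq[OF partners_sym[OF pij]] direction_swap[OF pij]
    by (simp add: algebra_simps)
  also have "2 * (\<Sum>p \<in> {Suc i..<j}. ?G p) + (?G i + ?G j) = (\<Sum>p<N. ?G p * height (i, j) p)"
    using sum_height[OF b, of ?G] by simp
  finally show ?thesis .
qed

text \<open>
  The complementary stretch runs through the basepoint, which contributes nothing.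
\<close>

lemma intersection_number_beta_loop:
  assumes x: "represents x F" and c: "(i, j) \<in> crossings S"
  shows "4 * intersection_number S x (beta_loop S (i, j)) =
    (\<Sum>p<N. - direction p (partner p) * F (partner p) * (2 - height (i, j) p))"
proof -
  have b: "i < j" "j < N" using crossing_bounds[OF c] by auto
  have pij: "partners i j" using c by (simp add: partners_def)
  let ?y = "beta_loop S (i, j)" and ?T = "\<lambda>p q. left_turn x (walk S ! p) (walk S ! q)"
  let ?G = "\<lambda>p. - direction p (partner p) * F (partner p)"
  define m where "m = N - Suc j"
  \<comment> \<open>\<open>e k\<close> is the index in the knot of the \<open>k\<close>-th edge of the loop.\<close>
  define e where "e k = (if k \<le> m then Suc j + k else k - Suc m)" for k
  have leny: "length ?y = Suc (Suc m + i)"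
    using b by (simp add: beta_loop_conv m_def del: upt_Suc)
  have nthy: "?y ! k = walk S ! e k" if "k < length ?y" for k
    using b that by (auto simp add: beta_loop_conv leny nth_append m_def e_def simp del: upt_Suc)
  have "intersection_number S x ?y = (\<Sum>k < Suc (Suc m + i). ?T (e k) (e (Suc k mod Suc (Suc m + i))))"
    unfolding intersection_number_left_turns leny by (rule sum.cong) (auto simp: nthy leny)
  also have "\<dots> = (\<Sum>k < Suc m + i. ?T (e k) (e (Suc k))) + ?T i (Suc j)"
    by (subst sum_closed_path) (simp add: e_def)
  also have "(\<Sum>k < Suc m + i. ?T (e k) (e (Suc k))) =
      (\<Sum>k < Suc m. ?T (e k) (e (Suc k))) + (\<Sum>k < i. ?T (e (Suc m + k)) (e (Suc (Suc m + k))))"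
    by (induction i) (auto simp: add.assoc)
  also have "(\<Sum>k < i. ?T (e (Suc m + k)) (e (Suc (Suc m + k)))) = (\<Sum>p\<in>{0..<i}. ?T p (Suc p))"
    unfolding atLeast0LessThan by (rule sum.cong) (auto simp: e_def)
  also have "(\<Sum>k < Suc m. ?T (e k) (e (Suc k))) = (\<Sum>k < m. ?T (Suc j + k) (Suc (Suc j + k))) + ?T N 0"
    using b by (simp add: e_def m_def)
  also have "(\<Sum>k < m. ?T (Suc j + k) (Suc (Suc j + k))) = (\<Sum>p\<in>{Suc j..<N}. ?T p (Suc p))"
    using b sum.atLeastLessThan_shift_0[of "\<lambda>p. ?T p (Suc p)" "Suc j" N]
    by (simp add: atLeast0LessThan add.commute m_def)
  also have "?T N 0 = 0" using x left_turn_base by (simp add: represents_def)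
  finally have "4 * intersection_number S x ?y =
      4 * (\<Sum>p\<in>{Suc j..<N}. ?T p (Suc p)) + 4 * (\<Sum>p\<in>{0..<i}. ?T p (Suc p)) + 4 * ?T i (Suc j)"
    by simp
  also have "\<dots> = 2 * (\<Sum>p \<in> {Suc j..<N}. ?G p) + 2 * (\<Sum>p \<in> {0..<i}. ?G p) + direction j i * (F j - F i)"
    using sum_straight[OF x, of "Suc j" N] sum_straight[OF x, of 0 i] left_turn_mean(2)[OF x partners_sym[OF pij]] b x
    by (simp add: represents_def)
  also have "direction j i * (F j - F i) = ?G i + ?G j"
    using partner_eq[OF pij] partner_eq[OF partners_sym[OF pij]] direction_swap[OF pij]
    by (simp add: algebra_simps)
  also have "2 * (\<Sum>p \<in> {Suc j..<N}. ?G p) + 2 * (\<Sum>p \<in> {0..<i}. ?G p) + (?G i + ?G j) = (\<Sum>p<N. ?G p * (2 - height (i, j) p))"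
    using sum_coheight[OF b, of ?G] by (simp add: atLeast0LessThan)
  finally show ?thesis .
qed

definition surface_form :: "(nat \<Rightarrow> int) \<Rightarrow> (nat \<Rightarrow> int) \<Rightarrow> int" where
  "surface_form F H = (\<Sum>(i, j) \<in> crossings S. direction i j * (F i * H j - F j * H i))"

lemma finite_crossings: "finite (crossings S)"
  by (rule finite_subset[of _ "{..<N} \<times> {..<N}"]) (auto simp: crossings_eq)

text \<open>
  Collecting the two passages of each crossing makes the skew symmetry visible.
\<close>

lemma sum_passages:
  "(\<Sum>p<N. - direction p (partner p) * F (partner p) * H p) = surface_form F H"
proof -
  let ?G = "\<lambda>p. - direction p (partner p) * F (partner p) * H p"
  have un: "{..<N} = (\<Union>c \<in> crossings S. {fst c, snd c})"
  proof (intro equalityI subsetI)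
    fix p assume "p \<in> {..<N}"
    then show "p \<in> (\<Union>c \<in> crossings S. {fst c, snd c})"
      using ex1_crossing[of p] by auto
  next
    fix p assume "p \<in> (\<Union>c \<in> crossings S. {fst c, snd c})"
    then show "p \<in> {..<N}" using crossing_bounds by fastforce
  qed
  have dis: "{fst c, snd c} \<inter> {fst d, snd d} = {}" if "c \<in> crossings S" "d \<in> crossings S" "c \<noteq> d" for c d
  proof (rule ccontr)
    assume "{fst c, snd c} \<inter> {fst d, snd d} \<noteq> {}"
    then obtain p where p: "p = fst c \<or> p = snd c" "p = fst d \<or> p = snd d" by blast
    then have "p < N" using that crossing_bounds[of "fst c" "snd c"] by auto
    then show False using ex1_crossing[of p] p that by blast
  qed
  have "(\<Sum>p<N. ?G p) = (\<Sum>c\<in>crossings S. \<Sum>p\<in>{fst c, snd c}. ?G p)"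
    unfolding un by (rule sum.UNION_disjoint) (use dis finite_crossings in auto)
  also have "\<dots> = surface_form F H"
    unfolding surface_form_def
  proof (rule sum.cong[OF refl], clarify)
    fix i j assume c: "(i, j) \<in> crossings S"
    then have pij: "partners i j" by (simp add: partners_def)
    have "i \<noteq> j" using crossing_bounds[OF c] by simp
    then show "(\<Sum>p\<in>{fst (i, j), snd (i, j)}. ?G p) = direction i j * (F i * H j - F j * H i)"
      using partner_eq[OF pij] partner_eq[OF partners_sym[OF pij]] direction_swap[OF pij]
      by (simp add: algebra_simps)
  qed
  finally show ?thesis .
qed

lemma intersection_number_form:
  assumes "represents x F" "c \<in> crossings S"
  shows "4 * intersection_number S x (alpha_loop S c) = surface_form F (height c)"
    "4 * intersection_number S x (beta_loop S c) = surface_form F (\<lambda>p. 2 - height c p)"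
  using assms intersection_number_alpha_loop[of x F "fst c" "snd c"]
    intersection_number_beta_loop[of x F "fst c" "snd c"] sum_passages
  by simp_all

end

section \<open>Every Gauss diagram lives on a surface\<close>

text \<open>
  A Gauss code with \<open>n\<close> passages: \<open>\<pi>\<close> pairs the two passages of each crossing, and \<open>lft k\<close> says that
  the partner of passage \<open>k\<close> crosses it from right to left.  The surface has only the \<open>n + 1\<close> edges
  of the knot: edge \<open>k\<close> is the dart \<open>k\<close> in the direction of the knot and the dart \<open>n + 1 + k\<close>
  against it, so that passage \<open>k\<close> leaves along \<open>Suc k\<close> and its reversed incoming dart is
  \<open>Suc (n + k)\<close>.
\<close>

locale gauss_code =
  fixes n :: nat and \<pi> :: "nat \<Rightarrow> nat" and lft :: "nat \<Rightarrow> bool"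
  assumes pi_less: "k < n \<Longrightarrow> \<pi> k < n" and pi_neq: "k < n \<Longrightarrow> \<pi> k \<noteq> k"
    and pi_pi: "k < n \<Longrightarrow> \<pi> (\<pi> k) = k" and lft_pi: "k < n \<Longrightarrow> lft (\<pi> k) \<longleftrightarrow> \<not> lft k"
begin

abbreviation "outd k \<equiv> Suc k"
abbreviation "ind k \<equiv> Suc (n + k)"

text \<open>
  Counterclockwise at a crossing with \<open>lft k\<close>: out \<open>k\<close>, out \<open>\<pi> k\<close>, in \<open>k\<close>, in \<open>\<pi> k\<close>.  The darts \<open>0\<close> and
  \<open>ind n\<close> form the basepoint vertex.
\<close>

definition code_rot :: "nat \<Rightarrow> nat" where
  "code_rot d =
    (if d = 0 then ind n else if d = ind n then 0
     else if d \<le> n then (if lft (d - 1) then outd (\<pi> (d - 1)) else ind (\<pi> (d - 1)))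
     else (if lft (d - Suc n) then ind (\<pi> (d - Suc n)) else outd (\<pi> (d - Suc n))))"

definition code_opp :: "nat \<Rightarrow> nat" where
  "code_opp d = (if d \<le> n then ind d else d - Suc n)"

definition code_surface :: "(nat \<times> nat) set \<Rightarrow> surface_diagram" where
  "code_surface Ov = \<lparr>darts = {..<2 * n + 2}, rot = code_rot, opp = code_opp, walk = [0..<Suc n],
     crossings = {(i, j). i < j \<and> j < n \<and> \<pi> i = j}, sfirst_over = Ov\<rparr>"

lemma rot_out: "k < n \<Longrightarrow> code_rot (outd k) = (if lft k then outd (\<pi> k) else ind (\<pi> k))"
  by (auto simp: code_rot_def)

lemma rot_in: "k < n \<Longrightarrow> code_rot (ind k) = (if lft k then ind (\<pi> k) else outd (\<pi> k))"
  by (auto simp: code_rot_def)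

lemma rot_rot_out: "k < n \<Longrightarrow> code_rot (code_rot (outd k)) = ind k"
  using pi_less pi_pi lft_pi by (cases "lft k") (auto simp: rot_out rot_in)

lemma rot_rot_in: "k < n \<Longrightarrow> code_rot (code_rot (ind k)) = outd k"
  using pi_less pi_pi lft_pi by (cases "lft k") (auto simp: rot_out rot_in)

lemma rot_base: "code_rot 0 = ind n" "code_rot (ind n) = 0"
  by (auto simp: code_rot_def)

lemma dart_cases:
  assumes "d < 2 * n + 2"
  obtains "d = 0" | "d = ind n" | k where "k < n" "d = outd k" | k where "k < n" "d = ind k"
proof -
  consider "d = 0" | "0 < d" "d \<le> n" | "n < d" "d < ind n" | "d = ind n" using assms by linarith
  then show thesis
  proof cases
    case 2
    then show thesis using that(3)[of "d - 1"] by auto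
  next
    case 3
    then show thesis using that(4)[of "d - Suc n"] by auto
  qed (use that in auto)
qed

lemma rot_dart: "d < 2 * n + 2 \<Longrightarrow> code_rot d < 2 * n + 2"
proof (erule dart_cases)
  fix k assume "k < n"
  note pi_less[OF this]
  then show "d = outd k \<Longrightarrow> code_rot d < 2 * n + 2" "d = ind k \<Longrightarrow> code_rot d < 2 * n + 2"
    using rot_out[OF \<open>k < n\<close>] rot_in[OF \<open>k < n\<close>] by auto
qed (simp_all add: rot_base)

lemma rot_four: "d < 2 * n + 2 \<Longrightarrow> code_rot (code_rot (code_rot (code_rot d))) = d"
  by (erule dart_cases) (simp_all only: rot_base rot_rot_out rot_rot_in)

lemma code_rot_bij: "bij_betw code_rot {..<2 * n + 2} {..<2 * n + 2}"
  by (rule bij_betw_byWitness[where f' = "\<lambda>d. code_rot (code_rot (code_rot d))"])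
     (use rot_dart rot_four in auto)

lemma funpow_closed: "a \<in> A \<Longrightarrow> (\<And>x. x \<in> A \<Longrightarrow> f x \<in> A) \<Longrightarrow> (f ^^ m) a \<in> A"
  by (induction m) auto

context
  fixes Ov :: "(nat \<times> nat) set"
begin

abbreviation "CS \<equiv> code_surface Ov"

lemma CS_simps: "darts CS = {..<2 * n + 2}" "rot CS = code_rot" "opp CS = code_opp"
  "walk CS = [0..<Suc n]" "crossings CS = {(i, j). i < j \<and> j < n \<and> \<pi> i = j}" "sfirst_over CS = Ov"
  by (simp_all add: code_surface_def)

lemma CS_out: "k < n \<Longrightarrow> out_dart CS k = outd k"
  unfolding out_dart_def CS_simps by (simp del: upt_Suc)

lemma CS_in: "k < n \<Longrightarrow> in_dart CS k = ind k"
  unfolding in_dart_def CS_simps by (simp add: code_opp_def del: upt_Suc)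

lemma CS_same_vertex_out:
  assumes k: "k < n" and sv: "same_vertex CS (outd k) d"
  shows "d \<in> {outd k, ind k, outd (\<pi> k), ind (\<pi> k)}"
proof -
  have "code_rot x \<in> {outd k, ind k, outd (\<pi> k), ind (\<pi> k)}"
    if "x \<in> {outd k, ind k, outd (\<pi> k), ind (\<pi> k)}" for x
    using that rot_out[OF k] rot_in[OF k] rot_out[OF pi_less[OF k]] rot_in[OF pi_less[OF k]] pi_pi[OF k]
    by (auto)
  then show ?thesis
    using sv funpow_closed[of "outd k" "{outd k, ind k, outd (\<pi> k), ind (\<pi> k)}" code_rot]
    by (auto simp: same_vertex_def CS_simps)
qed

lemma CS_same_vertex_base:
  assumes "same_vertex CS 0 d"
  shows "d \<in> {0, ind n}"
  using assms funpow_closed[of 0 "{0, ind n}" code_rot] rot_base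
  by (auto simp: same_vertex_def CS_simps)

lemma CS_same_vertex_iff:
  assumes "i < j" "j < n"
  shows "same_vertex CS (outd i) (outd j) \<longleftrightarrow> \<pi> i = j"
proof
  assume "same_vertex CS (outd i) (outd j)"
  then have "outd j \<in> {outd i, ind i, outd (\<pi> i), ind (\<pi> i)}"
    using CS_same_vertex_out[of i "outd j"] assms by simp
  then show "\<pi> i = j" using assms by auto
next
  assume j: "\<pi> i = j"
  have i: "i < n" using assms by simp
  show "same_vertex CS (outd i) (outd j)"
  proof (cases "lft i")
    case True
    then have "(code_rot ^^ 1) (outd i) = outd j" using rot_out[OF i] j by simp
    then show ?thesis unfolding same_vertex_def CS_simps by blast
  next
    case False
    then have "(code_rot ^^ 3) (outd i) = outd j"
      using rot_rot_out[OF i] rot_in[OF i] j by (simp add: numeral_3_eq_3)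
    then show ?thesis unfolding same_vertex_def CS_simps by blast
  qed
qed

lemma CS_crosses_left:
  assumes k: "k < n" and l: "lft k"
  shows "crosses_left CS k (\<pi> k)"
proof -
  have *: "x \<in> between CS a b" if "code_rot a = x" "x \<noteq> b" for a b x
    unfolding between_def CS_simps mem_Collect_eq
    by (rule exI[of _ 1]) (use that in \<open>auto simp: le_Suc_eq\<close>)
  show ?thesis
    unfolding crosses_left_def CS_out[OF k] CS_in[OF k] CS_out[OF pi_less[OF k]] CS_in[OF pi_less[OF k]]
    using *[OF rot_out[OF k], of "ind k"] *[OF rot_in[OF k], of "outd k"] l k pi_less[OF k] by auto
qed

lemma CS_connected:
  assumes "d < 2 * n + 2" "d' < 2 * n + 2"
  shows "(\<lambda>x y. y = code_rot x \<or> y = code_opp x)\<^sup>*\<^sup>* d d'"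
proof -
  let ?R = "\<lambda>x y. y = code_rot x \<or> y = code_opp x"
  have opp1: "?R\<^sup>*\<^sup>* x (code_opp x)" and rot1: "?R\<^sup>*\<^sup>* x (code_rot x)" for x
    by (rule r_into_rtranclp, simp)+
  have rot2: "?R\<^sup>*\<^sup>* x (code_rot (code_rot x))" for x
    using rot1 by (rule rtranclp_trans) (rule rot1)
  \<comment> \<open>Reversing edge \<open>k\<close> and turning twice at its end leads on to the next edge.\<close>
  have fwd: "?R\<^sup>*\<^sup>* k (outd k)" if "k < n" for k
    using rtranclp_trans[OF opp1[of k] rot2[of "code_opp k"]] rot_rot_in[OF that] that
    by (simp add: code_opp_def)
  have bwd: "?R\<^sup>*\<^sup>* (outd k) k" if "k < n" for k
    using rtranclp_trans[OF rot2[of "outd k"] opp1] rot_rot_out[OF that] that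
    by (simp add: code_opp_def)
  have from0: "?R\<^sup>*\<^sup>* 0 k" and to0: "?R\<^sup>*\<^sup>* k 0" if "k \<le> n" for k
    using that
  proof (induction k)
    case (Suc k)
    { case 1 then show ?case using rtranclp_trans[OF Suc.IH(1) fwd[of k]] by simp }
    { case 2 then show ?case using rtranclp_trans[OF bwd[of k] Suc.IH(2)] by simp }
  qed auto
  have "?R\<^sup>*\<^sup>* 0 x \<and> ?R\<^sup>*\<^sup>* x 0" if "x < 2 * n + 2" for x
  proof (cases "x \<le> n")
    case False
    then have o: "code_opp x \<le> n" "code_opp (code_opp x) = x" using that by (auto simp: code_opp_def)
    have "?R\<^sup>*\<^sup>* 0 (code_opp (code_opp x))" by (rule rtranclp_trans[OF from0[OF o(1)] opp1])
    moreover have "?R\<^sup>*\<^sup>* x 0" by (rule rtranclp_trans[OF opp1 to0[OF o(1)]])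
    ultimately show ?thesis unfolding o(2) by (rule conjI)
  qed (use from0 to0 in auto)
  then show ?thesis using assms rtranclp_trans[of ?R d 0 d'] by blast
qed

lemma is_surface_diagram_CS:
  assumes ov: "Ov \<subseteq> {(i, j). i < j \<and> j < n \<and> \<pi> i = j}"
  shows "is_surface_diagram CS"
proof -
  have len: "length (walk CS) - 1 = n" by (simp add: CS_simps del: upt_Suc)
  have hd: "hd (walk CS) = 0" and last: "last (walk CS) = n"
    by (simp_all add: CS_simps hd_conv_nth last_conv_nth del: upt_Suc)
  have dist: "distinct (walk CS @ map (opp CS) (walk CS))"
    unfolding CS_simps by (auto simp: code_opp_def distinct_map inj_on_def simp del: upt_Suc)
  have cs: "closed_surface CS"
    unfolding closed_surface_def CS_simps
    using code_rot_bij CS_connected by (auto simp: code_opp_def lessThan_empty_iff)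
  have c1: "same_vertex CS (in_dart CS k) (out_dart CS k)" if "k < n" for k
    unfolding CS_in[OF that] CS_out[OF that] same_vertex_def CS_simps
    by (rule exI[of _ 2]) (use rot_rot_in[OF that] in \<open>simp add: numeral_2_eq_2\<close>)
  have c2: "\<not> same_vertex CS 0 (out_dart CS k)" if "k < n" for k
    using CS_same_vertex_base[of "outd k"] that by (auto simp: CS_out)
  have c3: "crossings CS = {(i, j). i < j \<and> j < n \<and> same_vertex CS (out_dart CS i) (out_dart CS j)}"
    unfolding CS_simps using CS_same_vertex_iff by (auto simp: CS_out)
  have c4: "\<exists>!c. c \<in> crossings CS \<and> (k = fst c \<or> k = snd c)" if "k < n" for k
  proof -
    have inv: "\<pi> (snd c) = fst c" if "fst c < snd c" "snd c < n" "\<pi> (fst c) = snd c" for c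
      using pi_pi[of "fst c"] that by simp
    have "\<exists>!c. (fst c < snd c \<and> snd c < n \<and> \<pi> (fst c) = snd c) \<and> (k = fst c \<or> k = snd c)"
    proof (rule ex1I[of _ "if k < \<pi> k then (k, \<pi> k) else (\<pi> k, k)"])
      fix c assume "(fst c < snd c \<and> snd c < n \<and> \<pi> (fst c) = snd c) \<and> (k = fst c \<or> k = snd c)"
      then show "c = (if k < \<pi> k then (k, \<pi> k) else (\<pi> k, k))"
        using inv[of c] by (auto simp: prod_eq_iff)
    qed (use that pi_less[OF that] pi_neq[OF that] pi_pi[OF that] in auto)
    then show ?thesis unfolding CS_simps by (simp add: case_prod_beta)
  qed
  have c5: "crosses_left CS i j \<or> crosses_left CS j i" if "(i, j) \<in> crossings CS" for i j
  proof -
    have "i < n" "j < n" "\<pi> i = j" "\<pi> j = i" using that pi_pi by (auto simp: CS_simps)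
    then show ?thesis using CS_crosses_left[of i] CS_crosses_left[of j] lft_pi[of i] by auto
  qed
  have sv: "same_vertex CS (opp CS n) 0"
    unfolding same_vertex_def CS_simps
    by (rule exI[of _ 1]) (use rot_base in \<open>simp add: code_opp_def\<close>)
  show ?thesis
    unfolding is_surface_diagram_def Let_def len hd last
  proof (intro conjI)
    show "set (walk CS) \<subseteq> darts CS" unfolding CS_simps by (auto simp del: upt_Suc)
    show "walk CS \<noteq> []" unfolding CS_simps by simp
    show "sfirst_over CS \<subseteq> crossings CS" using ov by (simp add: CS_simps)
    show "\<forall>(i, j)\<in>crossings CS. crosses_left CS i j \<or> crosses_left CS j i" using c5 by blast
  qed (use cs dist sv c1 c2 c3 c4 in simp_all)
qed

end
end

text \<open>
  The signs of the crossings are prescribed by an arbitrary set \<open>P\<close>: the crossings at which the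
  second passage goes from right to left.
\<close>

lemma gauss_code_surface_exists:
  fixes M P Ov :: "(nat \<times> nat) set"
  assumes M: "\<And>i j. (i, j) \<in> M \<Longrightarrow> i < j \<and> j < n"
    and ex1: "\<And>k. k < n \<Longrightarrow> \<exists>!c. c \<in> M \<and> (k = fst c \<or> k = snd c)"
    and ov: "Ov \<subseteq> M"
  obtains S where "is_surface_diagram S" "crossings S = M" "sfirst_over S = Ov"
    "\<And>i j. (i, j) \<in> M \<Longrightarrow> crosses_left S i j \<longleftrightarrow> (i, j) \<in> P"
proof -
  define \<pi> where "\<pi> k = (SOME q. (k, q) \<in> M \<or> (q, k) \<in> M)" for k
  have partner: "(k, \<pi> k) \<in> M \<or> (\<pi> k, k) \<in> M" if "k < n" for k
    unfolding \<pi>_def by (rule someI_ex) (use ex1[OF that] in \<open>metis prod.collapse\<close>)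
  have unique: "q = r" if "(k, q) \<in> M \<or> (q, k) \<in> M" "(k, r) \<in> M \<or> (r, k) \<in> M" for k q r
  proof -
    have "k < n" using that(1) M by fastforce
    then show ?thesis
      using ex1[of k] that M by (metis fst_conv snd_conv less_irrefl order_less_trans)
  qed
  have pi: "\<pi> k < n" "\<pi> k \<noteq> k" "\<pi> (\<pi> k) = k" if "k < n" for k
  proof -
    show l: "\<pi> k < n" "\<pi> k \<noteq> k" using partner[OF that] M by fastforce+
    show "\<pi> (\<pi> k) = k" using partner[OF that] partner[OF l(1)] unique by blast
  qed
  have M_eq: "M = {(i, j). i < j \<and> j < n \<and> \<pi> i = j}"
  proof safe
    fix i j assume ij: "(i, j) \<in> M"
    then show "i < j" "j < n" using M by auto
    then show "\<pi> i = j" using partner[of i] unique ij by auto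
  next
    fix i assume "i < \<pi> i" "\<pi> i < n"
    then show "(i, \<pi> i) \<in> M" using partner[of i] M[of "\<pi> i" i] by auto
  qed
  define lft where "lft k = (if k < \<pi> k then (k, \<pi> k) \<in> P else (\<pi> k, k) \<notin> P)" for k
  interpret gauss_code n \<pi> lft
  proof
    show "lft (\<pi> k) \<longleftrightarrow> \<not> lft k" if "k < n" for k
      using pi[OF that] by (auto simp: lft_def)
  qed (use pi in auto)
  let ?S = "code_surface Ov"
  have S: "is_surface_diagram ?S" using is_surface_diagram_CS ov M_eq by simp
  interpret surface_knot ?S by unfold_locales (rule S)
  have "crosses_left ?S i j \<longleftrightarrow> (i, j) \<in> P" if ij: "(i, j) \<in> M" for i j
  proof -
    have b: "i < j" "j < n" "\<pi> i = j" "\<pi> j = i" using ij pi(3) M_eq by auto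
    have p: "partners i j" using ij M_eq by (simp add: partners_def CS_simps)
    have "crosses_left ?S i j" if "lft i" using CS_crosses_left[of i Ov] that b by simp
    moreover have "crosses_left ?S j i" if "lft j" using CS_crosses_left[of j Ov] that b by simp
    moreover have "lft j \<longleftrightarrow> \<not> lft i" "lft i \<longleftrightarrow> (i, j) \<in> P" using lft_pi[of i] b by (auto simp: lft_def)
    ultimately show ?thesis using crosses_left_partners[OF p] by blast
  qed
  then show thesis using that S M_eq by (simp add: CS_simps)
qed

section \<open>Intersection numbers of a long virtual knot diagram\<close>

definition passages :: "diagram \<Rightarrow> real set" where
  "passages D = fst ` real_cr D \<union> snd ` real_cr D"

definition flat_sign :: "diagram \<Rightarrow> crossing \<Rightarrow> int" where
  "flat_sign D c = (if wedge (velocity D (fst c)) (velocity D (snd c)) > 0 then 1 else - 1)"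

text \<open>
  The intersection form of the chains carried by the diagram, evaluated on doubled multiplicities:
  at each crossing the two passages meet in their flat sign.
\<close>

definition form :: "diagram \<Rightarrow> (real \<Rightarrow> int) \<Rightarrow> (real \<Rightarrow> int) \<Rightarrow> int" where
  "form D f g = (\<Sum>c \<in> real_cr D. flat_sign D c * (f (fst c) * g (snd c) - f (snd c) * g (fst c)))"

lemma form_skew: "form D g f = - form D f g"
  unfolding form_def sum_negf[symmetric] by (rule sum.cong) (auto simp: algebra_simps)

lemma form_diff_left: "form D (\<lambda>t. f t - f' t) g = form D f g - form D f' g"
  unfolding form_def sum_subtractf[symmetric] by (rule sum.cong) (auto simp: algebra_simps)

lemma form_diff_right: "form D f (\<lambda>t. g t - g' t) = form D f g - form D f g'"
  unfolding form_def sum_subtractf[symmetric] by (rule sum.cong) (auto simp: algebra_simps)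

lemma form_self: "form D f f = 0"
  by (simp add: form_def)

lemma wedge_swap: "wedge w z = - wedge z w"
  by (simp add: wedge_def)

context
  fixes D :: diagram
  assumes D: "is_diagram D"
begin

lemma real_cr_double_points: "real_cr D \<subseteq> double_points (curve D)"
  and finite_double_points: "finite (double_points (curve D))"
  and first_over_subset: "first_over D \<subseteq> real_cr D"
  using D by (simp_all add: is_diagram_def)

lemma finite_real_cr: "finite (real_cr D)"
  using real_cr_double_points finite_double_points finite_subset by blast

lemma double_point_wedge:
  "c \<in> double_points (curve D) \<Longrightarrow> wedge (velocity D (fst c)) (velocity D (snd c)) \<noteq> 0"
  using D by (auto simp: is_diagram_def)

lemma no_triple_point:
  assumes "curve D s = curve D t" "curve D t = curve D u"
  shows "s = t \<or> t = u \<or> s = u"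
proof -
  have *: "\<not> (curve D s = curve D t \<and> curve D t = curve D u)" if "s < t" "t < u" for s t u
    using D that unfolding is_diagram_def by blast
  show ?thesis
  proof (rule ccontr)
    assume "\<not> ?thesis"
    then consider "s < t" "t < u" | "s < u" "u < t" | "t < s" "s < u" | "t < u" "u < s"
        | "u < s" "s < t" | "u < t" "t < s" by force
    then show False by cases (use * assms in metis)+
  qed
qed

lemma double_points_disjoint:
  assumes "c \<in> double_points (curve D)" "d \<in> double_points (curve D)"
    "p \<in> {fst c, snd c}" "p \<in> {fst d, snd d}"
  shows "c = d"
proof -
  have c: "fst c < snd c" "curve D (fst c) = curve D (snd c)"
    and d: "fst d < snd d" "curve D (fst d) = curve D (snd d)"
    using assms(1,2) by (auto simp: double_points_def)
  have e: "curve D x = curve D p" if "x \<in> {fst c, snd c, fst d, snd d}" for x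
    using that assms(3,4) c d by auto
  have t: "x = y \<or> y = z \<or> x = z"
    if "x \<in> {fst c, snd c, fst d, snd d}" "y \<in> {fst c, snd c, fst d, snd d}" "z \<in> {fst c, snd c, fst d, snd d}"
    for x y z
    using no_triple_point[of x y z] e[OF that(1)] e[OF that(2)] e[OF that(3)] by simp
  have "fst d = fst c \<or> fst d = snd c" "snd d = fst c \<or> snd d = snd c"
    using t[of "fst c" "snd c" "fst d"] t[of "fst c" "snd c" "snd d"] c by auto
  then show ?thesis using c d by (auto simp: prod_eq_iff)
qed

lemma real_cr_less: "c \<in> real_cr D \<Longrightarrow> fst c < snd c"
  using real_cr_double_points by (auto simp: double_points_def)

lemma cr_sign_flat:
  assumes "c \<in> real_cr D"
  shows "cr_sign D c = (if c \<in> first_over D then flat_sign D c else - flat_sign D c)"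
  using double_point_wedge[of c] assms real_cr_double_points
  by (auto simp: cr_sign_def flat_sign_def Let_def wedge_swap[of "velocity D (snd c)"])

text \<open>
  An order isomorphism from the passages through real crossings onto an initial segment of the
  natural numbers.
\<close>

definition rank :: "real \<Rightarrow> nat" where
  "rank t = card {u \<in> passages D. u < t}"

lemma passage_numbers_rank: "passage_numbers D c = (rank (fst c), rank (snd c))"
  by (simp add: passage_numbers_def rank_def passages_def Let_def)

lemma finite_passages: "finite (passages D)"
  using finite_real_cr by (simp add: passages_def)

lemma passages_mem: "c \<in> real_cr D \<Longrightarrow> fst c \<in> passages D \<and> snd c \<in> passages D"
  by (auto simp: passages_def)

lemma rank_less:
  assumes "s \<in> passages D" "s < t"
  shows "rank s < rank t"
  unfolding rank_def by (rule psubset_card_mono) (use finite_passages assms in auto)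

lemma rank_less_iff: "s \<in> passages D \<Longrightarrow> t \<in> passages D \<Longrightarrow> rank s < rank t \<longleftrightarrow> s < t"
  using rank_less by (metis linorder_neqE_linordered_idom order_less_asym)

lemma rank_eq_iff: "s \<in> passages D \<Longrightarrow> t \<in> passages D \<Longrightarrow> rank s = rank t \<longleftrightarrow> s = t"
  using rank_less by (metis linorder_neqE_linordered_idom less_irrefl)

lemma rank_le_iff: "s \<in> passages D \<Longrightarrow> t \<in> passages D \<Longrightarrow> rank s \<le> rank t \<longleftrightarrow> s \<le> t"
  using rank_less_iff by (meson not_le)

lemma rank_image: "rank ` passages D = {..<card (passages D)}"
proof (rule card_subset_eq)
  have "rank s < card (passages D)" if "s \<in> passages D" for s
    unfolding rank_def by (rule psubset_card_mono) (use finite_passages that in auto)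
  then show "rank ` passages D \<subseteq> {..<card (passages D)}" by auto
  show "card (rank ` passages D) = card {..<card (passages D)}"
    by (simp add: card_image inj_on_def rank_eq_iff)
qed simp

lemma inj_passage_numbers: "inj_on (passage_numbers D) (real_cr D)"
  using rank_eq_iff passages_mem by (auto simp: inj_on_def passage_numbers_rank prod_eq_iff)

lemma height_rank:
  assumes "c \<in> real_cr D" "t \<in> passages D"
  shows "height (passage_numbers D c) (rank t) = height c t"
  using assms passages_mem[OF assms(1)]
  by (simp add: height_def passage_numbers_rank rank_less_iff rank_le_iff)

text \<open>
  Hence the choice made in \<open>realization\<close> does pick a surface realization.
\<close>

lemma surface_realization_exists: "\<exists>S. surface_realization D S"
proof -
  let ?M = "passage_numbers D ` real_cr D"
  let ?P = "passage_numbers D ` {c \<in> real_cr D. flat_sign D c = 1}"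
  have M: "i < j \<and> j < card (passages D)" if "(i, j) \<in> ?M" for i j
  proof -
    obtain c where c: "c \<in> real_cr D" "i = rank (fst c)" "j = rank (snd c)"
      using \<open>(i, j) \<in> ?M\<close> by (auto simp: passage_numbers_rank)
    then show ?thesis using rank_image passages_mem[OF c(1)] rank_less_iff real_cr_less[OF c(1)] by auto
  qed
  have ex1: "\<exists>!c. c \<in> ?M \<and> (k = fst c \<or> k = snd c)" if "k < card (passages D)" for k
  proof -
    obtain t where t: "t \<in> passages D" "k = rank t" using rank_image \<open>k < card (passages D)\<close> by blast
    then obtain c where c: "c \<in> real_cr D" "t \<in> {fst c, snd c}" by (auto simp: passages_def)
    show ?thesis
    proof (rule ex1I[of _ "passage_numbers D c"])
      fix x assume x: "x \<in> ?M \<and> (k = fst x \<or> k = snd x)"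
      then obtain d where d: "d \<in> real_cr D" "x = passage_numbers D d" by blast
      then have "t \<in> {fst d, snd d}"
        using x t rank_eq_iff passages_mem[OF d(1)] by (auto simp: passage_numbers_rank)
      then show "x = passage_numbers D c"
        using double_points_disjoint[of c d t] c d real_cr_double_points by blast
    qed (use c t in \<open>auto simp: passage_numbers_rank\<close>)
  qed
  have ov: "passage_numbers D ` first_over D \<subseteq> ?M" using first_over_subset by blast
  obtain S where S: "is_surface_diagram S" "crossings S = ?M" "sfirst_over S = passage_numbers D ` first_over D"
    and cl: "\<And>i j. (i, j) \<in> ?M \<Longrightarrow> crosses_left S i j \<longleftrightarrow> (i, j) \<in> ?P"
    using gauss_code_surface_exists[OF M ex1 ov, of ?P] by blast
  interpret surface_knot S by unfold_locales (rule S(1))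
  have "scr_sign S (passage_numbers D c) = cr_sign D c" if c: "c \<in> real_cr D" for c
  proof -
    have p: "partners (rank (fst c)) (rank (snd c))"
      using c S(2) by (auto simp: partners_def passage_numbers_rank)
    have mem: "passage_numbers D c \<in> passage_numbers D ` A \<longleftrightarrow> c \<in> A" if "A \<subseteq> real_cr D" for A
      using inj_on_image_mem_iff[OF inj_passage_numbers c that] .
    have "crosses_left S (rank (fst c)) (rank (snd c)) \<longleftrightarrow> flat_sign D c = 1"
      using cl[of "rank (fst c)" "rank (snd c)"] c mem[of "{c \<in> real_cr D. flat_sign D c = 1}"]
      by (simp add: passage_numbers_rank[symmetric])
    then show ?thesis
      using crosses_left_partners[OF p] mem[OF first_over_subset] c
      unfolding scr_sign_def cr_sign_flat[OF c] S(3) Let_def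
      by (auto simp: passage_numbers_rank flat_sign_def)
  qed
  then show ?thesis using S by (auto simp: surface_realization_def)
qed

text \<open>
  Signs and heights only depend on the order of the passages and on the local orientations, so any
  realization computes the form of the diagram.
\<close>

lemma surface_form_form:
  assumes sr: "surface_realization D S"
    and f: "\<And>t. t \<in> passages D \<Longrightarrow> f' (rank t) = f t" and g: "\<And>t. t \<in> passages D \<Longrightarrow> g' (rank t) = g t"
  shows "surface_knot.surface_form S f' g' = form D f g"
proof -
  interpret surface_knot S by unfold_locales (use sr in \<open>simp add: surface_realization_def\<close>)
  have cr: "crossings S = passage_numbers D ` real_cr D"
    and ov: "sfirst_over S = passage_numbers D ` first_over D"
    and sg: "\<And>c. c \<in> real_cr D \<Longrightarrow> scr_sign S (passage_numbers D c) = cr_sign D c"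
    using sr by (auto simp: surface_realization_def)
  have dir: "direction (rank (fst c)) (rank (snd c)) = flat_sign D c" if c: "c \<in> real_cr D" for c
  proof -
    have p: "partners (rank (fst c)) (rank (snd c))"
      using c cr by (auto simp: partners_def passage_numbers_rank)
    have mem: "passage_numbers D c \<in> passage_numbers D ` first_over D \<longleftrightarrow> c \<in> first_over D"
      using inj_on_image_mem_iff[OF inj_passage_numbers c first_over_subset] .
    show ?thesis
      using sg[OF c] crosses_left_partners[OF p] mem
      unfolding scr_sign_def cr_sign_flat[OF c] ov Let_def
      by (auto simp: passage_numbers_rank direction_def flat_sign_def split: if_splits)
  qed
  have "surface_form f' g' = (\<Sum>c\<in>real_cr D. direction (rank (fst c)) (rank (snd c)) *
      (f' (rank (fst c)) * g' (rank (snd c)) - f' (rank (snd c)) * g' (rank (fst c))))"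
    unfolding surface_form_def cr
    by (subst sum.reindex[OF inj_passage_numbers]) (simp add: passage_numbers_rank case_prod_beta)
  also have "\<dots> = form D f g"
    unfolding form_def by (rule sum.cong) (simp_all add: dir f g passages_mem)
  finally show ?thesis .
qed

lemma inum_form:
  assumes "c \<in> real_cr D" "d \<in> real_cr D"
  shows "4 * inum D (alpha D c) (alpha D d) = form D (height c) (height d)"
    "4 * inum D (alpha D c) (beta D d) = form D (height c) (\<lambda>t. 2 - height d t)"
    "4 * inum D (beta D c) (beta D d) = form D (\<lambda>t. 2 - height c t) (\<lambda>t. 2 - height d t)"
proof -
  have sr: "surface_realization D (realization D)"
    unfolding realization_def using surface_realization_exists by (rule someI_ex)
  interpret surface_knot "realization D"
    by unfold_locales (use sr in \<open>simp add: surface_realization_def\<close>)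
  have cr: "passage_numbers D c \<in> crossings (realization D)" "passage_numbers D d \<in> crossings (realization D)"
    using sr assms by (auto simp: surface_realization_def)
  have ra: "represents (alpha D c) (height (passage_numbers D c))"
    and rb: "represents (beta D c) (\<lambda>p. 2 - height (passage_numbers D c) p)"
    using represents_loops[of "rank (fst c)" "rank (snd c)"] cr
    by (simp_all add: alpha_def beta_def passage_numbers_rank)
  note F = surface_form_form[OF sr]
  show "4 * inum D (alpha D c) (alpha D d) = form D (height c) (height d)"
    using intersection_number_form(1)[OF ra cr(2)] F height_rank assms
    by (simp add: inum_def alpha_def)
  show "4 * inum D (alpha D c) (beta D d) = form D (height c) (\<lambda>t. 2 - height d t)"
    using intersection_number_form(2)[OF ra cr(2)] height_rank assms
      F[of "height (passage_numbers D c)" "height c" "\<lambda>p. 2 - height (passage_numbers D d) p" "\<lambda>t. 2 - height d t"]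
    by (simp add: inum_def beta_def)
  show "4 * inum D (beta D c) (beta D d) = form D (\<lambda>t. 2 - height c t) (\<lambda>t. 2 - height d t)"
    using intersection_number_form(2)[OF rb cr(2)] height_rank assms
      F[of "\<lambda>p. 2 - height (passage_numbers D c) p" "\<lambda>t. 2 - height c t" "\<lambda>p. 2 - height (passage_numbers D d) p" "\<lambda>t. 2 - height d t"]
    by (simp add: inum_def beta_def)
qed

end

section \<open>The three polynomials as sums over pairs of crossings\<close>

text \<open>
  Four times \<open>\<alpha>\<^sub>c \<cdot> \<beta>\<^sub>c\<close> and four times \<open>\<alpha>\<^sub>c \<cdot> \<alpha>\<^sub>d\<close>.  The constant \<open>2\<close> represents the whole knot, which
  meets \<open>\<alpha>\<^sub>c\<close> in the same number as \<open>\<beta>\<^sub>c\<close> does, because \<open>\<alpha>\<^sub>c \<cdot> \<alpha>\<^sub>c = 0\<close>.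
\<close>

definition index1 :: "diagram \<Rightarrow> crossing \<Rightarrow> int" where
  "index1 D c = form D (height c) (\<lambda>_. 2)"

definition index2 :: "diagram \<Rightarrow> crossing \<Rightarrow> crossing \<Rightarrow> int" where
  "index2 D c d = form D (height c) (height d)"

text \<open>
  The summand of each polynomial at a pair of crossings \<open>c\<close>, \<open>d\<close> after multiplying out the
  correction terms; the arguments stand for \<open>index1\<close> of \<open>c\<close>, \<open>index1\<close> of \<open>d\<close> and \<open>index2\<close> of \<open>c\<close>, \<open>d\<close>, so
  they are multiples of \<open>4\<close>.
\<close>

definition kernel_F :: "int \<Rightarrow> int \<Rightarrow> int \<Rightarrow> laurent_poly" where
  "kernel_F u v z = tpow (z div 4) - 1"

definition kernel_G :: "int \<Rightarrow> int \<Rightarrow> int \<Rightarrow> laurent_poly" where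
  "kernel_G u v z = tpow ((u - z) div 4) - tpow (u div 4)"

definition kernel_H :: "int \<Rightarrow> int \<Rightarrow> int \<Rightarrow> laurent_poly" where
  "kernel_H u v z = tpow ((v - u + z) div 4) - tpow (v div 4) - tpow (- u div 4) + 1"

definition pair_sum :: "(int \<Rightarrow> int \<Rightarrow> int \<Rightarrow> laurent_poly) \<Rightarrow> nat \<Rightarrow> nat \<Rightarrow> diagram \<Rightarrow> laurent_poly" where
  "pair_sum \<kappa> a b D = (\<Sum>c \<in> crossings_of_type a D. \<Sum>d \<in> crossings_of_type b D.
     of_int (cr_sign D c * cr_sign D d) * \<kappa> (index1 D c) (index1 D d) (index2 D c d))"

lemma subst_inverse_tpow: "subst_inverse (tpow n) = tpow (- n)"
  unfolding subst_inverse_def tpow_def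
  by (rule poly_mapping_eqI) (auto simp: map_key.rep_eq inj_def lookup_single when_def)

lemma subst_inverse_1: "subst_inverse 1 = 1"
  using subst_inverse_tpow[of 0] by (simp add: tpow_def)

lemma subst_inverse_add: "subst_inverse (p + q) = subst_inverse p + subst_inverse q"
  unfolding subst_inverse_def
  by (rule poly_mapping_eqI) (simp add: map_key.rep_eq inj_def lookup_add)

lemma subst_inverse_minus: "subst_inverse (- p) = - subst_inverse p"
  unfolding subst_inverse_def
  by (rule poly_mapping_eqI) (simp add: map_key.rep_eq inj_def)

lemma subst_inverse_diff: "subst_inverse (p - q) = subst_inverse p - subst_inverse q"
  using subst_inverse_add[of p "- q"] by (simp add: subst_inverse_minus)

lemma subst_inverse_0: "subst_inverse 0 = 0"
  using subst_inverse_diff[of 0 0] by simp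

lemma subst_inverse_sum: "subst_inverse (sum f A) = (\<Sum>x\<in>A. subst_inverse (f x))"
  by (induction A rule: infinite_finite_induct) (simp_all add: subst_inverse_0 subst_inverse_add)

lemma subst_inverse_of_int: "subst_inverse (of_int k * p) = of_int k * subst_inverse p"
proof (induction k)
  case (nonneg n)
  then show ?case by (induction n) (simp_all add: subst_inverse_0 subst_inverse_add distrib_right)
next
  case (neg n)
  have nat: "subst_inverse (of_nat m * p) = of_nat m * subst_inverse p" for m
    by (induction m) (simp_all add: subst_inverse_0 subst_inverse_add distrib_right)
  have neg: "of_int (- int (Suc n)) * q = - (of_nat (Suc n) * q)" for q :: laurent_poly
    by (simp del: of_nat_Suc)
  show ?case by (simp only: neg nat subst_inverse_minus)
qed

lemma
  assumes D: "is_diagram D"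
  shows poly_F_pair_sum: "poly_F a b D = pair_sum kernel_F a b D"
    and poly_G_pair_sum: "poly_G a b D = pair_sum kernel_G a b D"
    and poly_H_pair_sum: "poly_H a b D = pair_sum kernel_H a b D"
proof -
  have R: "c \<in> real_cr D" if "c \<in> crossings_of_type t D" for c t
    using that by (simp add: crossings_of_type_def)
  have const: "form D (\<lambda>_. 2) (\<lambda>_. 2) = 0" by (rule form_self)
  have sw: "form D (\<lambda>_. 2) (height d) = - index1 D d" for d
    unfolding index1_def by (rule form_skew)
  \<comment> \<open>Bilinearity, with \<open>\<beta>\<close> the difference of the whole knot and \<open>\<alpha>\<close>.\<close>
  have aa: "4 * inum D (alpha D c) (alpha D d) = index2 D c d" 
    and ab: "4 * inum D (alpha D c) (beta D d) = index1 D c - index2 D c d"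
    and bb: "4 * inum D (beta D c) (beta D d) = index1 D d - index1 D c + index2 D c d"
    if "c \<in> real_cr D" "d \<in> real_cr D" for c d
    using inum_form[OF D that]
    by (simp_all add: index1_def index2_def form_diff_left form_diff_right const sw[unfolded index1_def])
  have bb': "(index1 D d - index1 D c + index2 D c d) div 4 = inum D (beta D c) (beta D d)"
    if "c \<in> real_cr D" "d \<in> real_cr D" for c d
    by (simp flip: bb[OF that])
  have self: "4 * inum D (alpha D c) (beta D c) = index1 D c" if "c \<in> real_cr D" for c
    using ab[OF that that] by (simp add: index2_def form_self)
  have W: "poly_W t D = (\<Sum>c\<in>crossings_of_type t D. of_int (cr_sign D c) * (tpow (index1 D c div 4) - 1))" for t
    unfolding poly_W_def by (rule sum.cong) (simp_all flip: self[OF R])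
  have W': "subst_inverse (poly_W t D) =
      (\<Sum>c\<in>crossings_of_type t D. of_int (cr_sign D c) * (tpow (- index1 D c div 4) - 1))" for t
    unfolding poly_W_def subst_inverse_sum
    by (rule sum.cong)
       (simp_all add: subst_inverse_of_int subst_inverse_diff subst_inverse_tpow subst_inverse_1 flip: self[OF R] mult_minus_right)
  show "poly_F a b D = pair_sum kernel_F a b D"
    unfolding poly_F_def pair_sum_def kernel_F_def
    by (intro sum.cong refl) (simp flip: aa[OF R R])
  have om: "of_int (omega s D) * poly_W t D = (\<Sum>c\<in>crossings_of_type s D. \<Sum>d\<in>crossings_of_type t D.
      of_int (cr_sign D c * cr_sign D d) * (tpow (index1 D d div 4) - 1))" for s t
    unfolding omega_def W of_int_sum sum_product by (simp add: mult.assoc)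
  have om': "of_int (omega t D) * subst_inverse (poly_W s D) = (\<Sum>c\<in>crossings_of_type s D. \<Sum>d\<in>crossings_of_type t D.
      of_int (cr_sign D c * cr_sign D d) * (tpow (- index1 D c div 4) - 1))" for s t
    unfolding omega_def W' of_int_sum sum_product
    by (subst sum.swap) (simp add: ac_simps)
  have om'': "of_int (omega t D) * poly_W s D = (\<Sum>c\<in>crossings_of_type s D. \<Sum>d\<in>crossings_of_type t D.
      of_int (cr_sign D c * cr_sign D d) * (tpow (index1 D c div 4) - 1))" for s t
    unfolding om by (subst sum.swap) (simp add: mult.commute)
  show "poly_G a b D = pair_sum kernel_G a b D"
    unfolding poly_G_def pair_sum_def kernel_G_def om'' sum_subtractf[symmetric]
    by (intro sum.cong refl) (simp add: algebra_simps flip: ab[OF R R])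
  show "poly_H a b D = pair_sum kernel_H a b D"
    unfolding poly_H_def pair_sum_def kernel_H_def om om' sum_subtractf[symmetric]
    by (intro sum.cong refl) (simp add: bb' R, simp add: algebra_simps)
qed

section \<open>Changes of the Gauss diagram\<close>

text \<open>
  The sign of a crossing, counted only for the type \<open>a\<close>.  It lets both sums run over all real
  crossings.
\<close>

definition weight :: "nat \<Rightarrow> diagram \<Rightarrow> crossing \<Rightarrow> int" where
  "weight a D c = (if cr_type D c = a then cr_sign D c else 0)"

lemma weight_flat:
  assumes "is_diagram D" "c \<in> real_cr D"
  shows "weight a D c =
    (if c \<in> first_over D then (if a = 0 then flat_sign D c else 0) else if a = 1 then - flat_sign D c else 0)"
  using assms by (auto simp: weight_def cr_type_def cr_sign_flat)

definition pair_term :: "(int \<Rightarrow> int \<Rightarrow> int \<Rightarrow> laurent_poly) \<Rightarrow> nat \<Rightarrow> nat \<Rightarrow> diagram \<Rightarrow> crossing \<Rightarrow> crossing \<Rightarrow> laurent_poly" where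
  "pair_term \<kappa> a b D c d =
     of_int (weight a D c * weight b D d) * \<kappa> (index1 D c) (index1 D d) (index2 D c d)"

lemma pair_sum_terms:
  assumes "is_diagram D"
  shows "pair_sum \<kappa> a b D = (\<Sum>c \<in> real_cr D. \<Sum>d \<in> real_cr D. pair_term \<kappa> a b D c d)"
proof -
  note fin = finite_real_cr[OF assms]
  have *: "(\<Sum>c \<in> crossings_of_type t D. g c) = (\<Sum>c \<in> real_cr D. if cr_type D c = t then g c else 0)" for g :: "crossing \<Rightarrow> laurent_poly" and t
    unfolding crossings_of_type_def by (rule sum.inter_filter[OF fin])
  show ?thesis
    unfolding pair_sum_def * pair_term_def by (intro sum.cong refl) (auto simp: weight_def intro!: sum.cong)
qed

lemma index2_skew: "index2 D d c = - index2 D c d"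
  unfolding index2_def by (rule form_skew)

lemma index2_self: "index2 D c c = 0"
  by (simp add: index2_def form_self)

lemma pair_sum_bij:
  assumes D: "is_diagram D" "is_diagram D'" and bij: "bij_betw \<theta> (real_cr D) (real_cr D')"
    and w: "\<And>c t. c \<in> real_cr D \<Longrightarrow> weight t D' (\<theta> c) = weight t D c"
    and i1: "\<And>c. c \<in> real_cr D \<Longrightarrow> index1 D' (\<theta> c) = index1 D c"
    and i2: "\<And>c d. c \<in> real_cr D \<Longrightarrow> d \<in> real_cr D \<Longrightarrow> index2 D' (\<theta> c) (\<theta> d) = index2 D c d"
  shows "pair_sum \<kappa> a b D = pair_sum \<kappa> a b D'"
proof -
  have "pair_sum \<kappa> a b D' = (\<Sum>c \<in> real_cr D. \<Sum>d \<in> real_cr D. pair_term \<kappa> a b D' (\<theta> c) (\<theta> d))"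
    unfolding pair_sum_terms[OF D(2)] sum.reindex_bij_betw[OF bij, symmetric] ..
  also have "\<dots> = pair_sum \<kappa> a b D"
    unfolding pair_sum_terms[OF D(1)] by (intro sum.cong refl) (simp add: pair_term_def w i1 i2)
  finally show ?thesis by simp
qed

text \<open>
  Vanishing on the pairs in which one of the two crossings has a loop \<open>\<alpha>\<close> that meets nothing.
\<close>

definition reduced :: "(int \<Rightarrow> int \<Rightarrow> int \<Rightarrow> laurent_poly) \<Rightarrow> bool" where
  "reduced \<kappa> \<longleftrightarrow> (\<forall>v. \<kappa> 0 v 0 = 0) \<and> (\<forall>u. \<kappa> u 0 0 = 0)"

lemma reduced_kernels: "reduced kernel_F" "reduced kernel_G" "reduced kernel_H"
  by (auto simp: reduced_def kernel_F_def kernel_G_def kernel_H_def tpow_def)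

text \<open>
  The effect of move I on the Gauss diagram.
\<close>

lemma pair_sum_isolated:
  assumes D: "is_diagram D" "is_diagram D'" and \<kappa>: "reduced \<kappa>"
    and R: "real_cr D = insert c (real_cr D')" "c \<notin> real_cr D'"
    and w: "\<And>x t. x \<in> real_cr D' \<Longrightarrow> weight t D' x = weight t D x"
    and i1: "\<And>x. x \<in> real_cr D' \<Longrightarrow> index1 D' x = index1 D x"
    and i2: "\<And>x y. x \<in> real_cr D' \<Longrightarrow> y \<in> real_cr D' \<Longrightarrow> index2 D' x y = index2 D x y"
    and c1: "index1 D c = 0" and c2: "\<And>x. x \<in> real_cr D' \<Longrightarrow> index2 D c x = 0"
  shows "pair_sum \<kappa> a b D = pair_sum \<kappa> a b D'"
proof -
  have z: "pair_term \<kappa> a b D c x = 0" "pair_term \<kappa> a b D x c = 0" if "x = c \<or> x \<in> real_cr D'" for x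
    using that \<kappa> c1 c2[of x] index2_self[of D c] index2_skew[of D x c] by (auto simp: pair_term_def reduced_def)
  have eq: "pair_term \<kappa> a b D x y = pair_term \<kappa> a b D' x y" if "x \<in> real_cr D'" "y \<in> real_cr D'" for x y
    using that by (simp add: pair_term_def w i1 i2)
  show ?thesis
    unfolding pair_sum_terms[OF D(1)] pair_sum_terms[OF D(2)] R(1)
    using R(2) finite_real_cr[OF D(2)] by (simp add: z eq)
qed

text \<open>
  The effect of move II on the Gauss diagram: the summands of the two new crossings cancel, also
  those of the pairs formed by these two crossings.
\<close>

lemma pair_sum_cancelling:
  assumes D: "is_diagram D" "is_diagram D'"
    and R: "real_cr D = insert c (insert d (real_cr D'))" "c \<notin> real_cr D'" "d \<notin> real_cr D'" "c \<noteq> d"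
    and w: "\<And>x t. x \<in> real_cr D' \<Longrightarrow> weight t D' x = weight t D x"
    and i1: "\<And>x. x \<in> real_cr D' \<Longrightarrow> index1 D' x = index1 D x"
    and i2: "\<And>x y. x \<in> real_cr D' \<Longrightarrow> y \<in> real_cr D' \<Longrightarrow> index2 D' x y = index2 D x y"
    and wcd: "\<And>t. weight t D d = - weight t D c"
    and cd1: "index1 D d = index1 D c" and cd2: "\<And>x. x \<in> real_cr D' \<Longrightarrow> index2 D d x = index2 D c x"
    and cd: "index2 D c d = 0"
  shows "pair_sum \<kappa> a b D = pair_sum \<kappa> a b D'"
proof -
  have z: "pair_term \<kappa> a b D d x = - pair_term \<kappa> a b D c x" "pair_term \<kappa> a b D x d = - pair_term \<kappa> a b D x c"
    if "x \<in> real_cr D" for x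
    using that cd cd1 cd2[of x] index2_self[of D c] index2_self[of D d] index2_skew[of D x c] index2_skew[of D x d]
      index2_skew[of D d c]
    unfolding R(1) by (auto simp: pair_term_def wcd)
  have eq: "pair_term \<kappa> a b D x y = pair_term \<kappa> a b D' x y" if "x \<in> real_cr D'" "y \<in> real_cr D'" for x y
    using that by (simp add: pair_term_def w i1 i2)
  have "pair_sum \<kappa> a b D = (\<Sum>x\<in>real_cr D. \<Sum>y\<in>real_cr D'. pair_term \<kappa> a b D x y)"
    unfolding pair_sum_terms[OF D(1)]
  proof (rule sum.cong[OF refl])
    fix x assume x: "x \<in> real_cr D"
    show "(\<Sum>y\<in>real_cr D. pair_term \<kappa> a b D x y) = (\<Sum>y\<in>real_cr D'. pair_term \<kappa> a b D x y)"
      unfolding R(1) using R(2-4) finite_real_cr[OF D(2)] z(2)[OF x] by simp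
  qed
  also have "\<dots> = (\<Sum>x\<in>real_cr D'. \<Sum>y\<in>real_cr D'. pair_term \<kappa> a b D x y)"
  proof -
    have "(\<Sum>y\<in>real_cr D'. pair_term \<kappa> a b D d y) = - (\<Sum>y\<in>real_cr D'. pair_term \<kappa> a b D c y)"
      unfolding sum_negf[symmetric] by (rule sum.cong[OF refl], rule z(1)) (simp add: R(1))
    then show ?thesis
      unfolding R(1) using R(2-4) finite_real_cr[OF D(2)] by simp
  qed
  also have "\<dots> = pair_sum \<kappa> a b D'"
    unfolding pair_sum_terms[OF D(2)] by (intro sum.cong refl) (rule eq)
  finally show ?thesis .
qed


section \<open>Invariance under the generalized Reidemeister moves\<close>

definition form_on :: "diagram \<Rightarrow> crossing set \<Rightarrow> (real \<Rightarrow> int) \<Rightarrow> (real \<Rightarrow> int) \<Rightarrow> int" where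
  "form_on D A f g = (\<Sum>c \<in> A. flat_sign D c * (f (fst c) * g (snd c) - f (snd c) * g (fst c)))"

lemma form_form_on: "form D = form_on D (real_cr D)"
  by (intro ext) (simp add: form_def form_on_def)

lemma flat_sign_eqI:
  assumes "c \<in> double_points (curve D)" "c' \<in> double_points (curve D')" "is_diagram D" "is_diagram D'"
    "sgn (wedge (velocity D (fst c)) (velocity D (snd c))) = sgn (wedge (velocity D' (fst c')) (velocity D' (snd c')))"
  shows "flat_sign D c = flat_sign D' c'"
  using assms(5) double_point_wedge[OF assms(3,1)] double_point_wedge[OF assms(4,2)]
  by (auto simp: flat_sign_def sgn_if split: if_splits)

lemma height_corner: "fst c < snd c \<Longrightarrow> height c (fst c) = 1" "fst c < snd c \<Longrightarrow> height c (snd c) = 1"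
  by (auto simp: height_def)

lemma height_constant:
  fixes c :: "'a::linorder \<times> 'a"
  assumes "fst c \<notin> {l..u}" "snd c \<notin> {l..u}" "s \<in> {l..u}" "t \<in> {l..u}"
  shows "height c s = height c t"
proof -
  have *: "(x < s \<longleftrightarrow> x < t) \<and> (x \<le> s \<longleftrightarrow> x \<le> t) \<and> (s < x \<longleftrightarrow> t < x) \<and> (s \<le> x \<longleftrightarrow> t \<le> x)"
    if "x \<notin> {l..u}" for x
    using that assms(3,4) by auto
  show ?thesis using *[OF assms(1)] *[OF assms(2)] by (simp add: height_def)
qed

text \<open>
  Moving the ends of a chord within two arcs does not change its height off these arcs.
\<close>

lemma height_cong:
  fixes c d :: "'a::linorder \<times> 'a"
  assumes "fst c \<in> {l..u}" "fst d \<in> {l..u}" "t \<notin> {l..u}"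
    and "snd c \<in> {l'..u'}" "snd d \<in> {l'..u'}" "t \<notin> {l'..u'}"
  shows "height c t = height d t"
proof -
  have *: "(x < t \<longleftrightarrow> y < t) \<and> (x \<le> t \<longleftrightarrow> y \<le> t) \<and> (t < x \<longleftrightarrow> t < y) \<and> (t \<le> x \<longleftrightarrow> t \<le> y)"
    if "x \<in> {l..u}" "y \<in> {l..u}" "t \<notin> {l..u}" for x y l u
    using that by auto
  show ?thesis using *[OF assms(1-3)] *[OF assms(4-6)] by (simp add: height_def)
qed

text \<open>
  Both diagrams agree off the disc, so all changes of the form come from the crossings inside it.
\<close>

locale local_move =
  fixes J :: "real set" and D D' :: diagram
  assumes D: "is_diagram D" and D': "is_diagram D'" and closed_J: "closed J"
    and agree: "agree_off_disc J D D'"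
begin

definition off :: "crossing set" where
  "off = {c \<in> real_cr D. fst c \<notin> J}"

lemma off': "off = {c \<in> real_cr D'. fst c \<notin> J}"
  using agree by (simp add: agree_off_disc_def off_def)

lemma first_over_off: "c \<in> off \<Longrightarrow> c \<in> first_over D \<longleftrightarrow> c \<in> first_over D'"
  using agree by (auto simp: agree_off_disc_def off_def)

lemma velocity_off: "t \<notin> J \<Longrightarrow> velocity D t = velocity D' t"
proof -
  assume t: "t \<notin> J"
  have "\<forall>\<^sub>F s in nhds t. s \<in> - J"
    using closed_J t by (intro eventually_nhds_in_open) auto
  then have "\<forall>\<^sub>F s in nhds t. s \<in> UNIV \<longrightarrow> curve D s = curve D' s"
    by (rule eventually_mono) (use agree in \<open>auto simp: agree_off_disc_def\<close>)
  then show ?thesis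
    unfolding velocity_def by (rule vector_derivative_cong_eq) auto
qed

lemma J_both:
  assumes "curve D s = curve D t \<or> curve D' s = curve D' t"
  shows "s \<in> J \<longleftrightarrow> t \<in> J"
proof -
  obtain B where "curve D -` B = J" "curve D' -` B = J"
    using agree by (auto simp: agree_off_disc_def)
  then have "s \<in> J \<longleftrightarrow> curve D s \<in> B" "t \<in> J \<longleftrightarrow> curve D t \<in> B"
    "s \<in> J \<longleftrightarrow> curve D' s \<in> B" "t \<in> J \<longleftrightarrow> curve D' t \<in> B" by blast+
  then show ?thesis using assms by metis
qed

lemma real_cr_J:
  assumes "c \<in> real_cr D \<or> c \<in> real_cr D'"
  shows "snd c \<in> J \<longleftrightarrow> fst c \<in> J"
proof -
  have "curve D (fst c) = curve D (snd c) \<or> curve D' (fst c) = curve D' (snd c)"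
    using assms real_cr_double_points[OF D] real_cr_double_points[OF D'] by (auto simp: double_points_def)
  then show ?thesis using J_both by blast
qed

lemma off_J: "c \<in> off \<Longrightarrow> fst c \<notin> J \<and> snd c \<notin> J"
  using real_cr_J by (auto simp: off_def)

lemma flat_sign_off: "c \<in> off \<Longrightarrow> flat_sign D' c = flat_sign D c"
  using off_J velocity_off by (simp add: flat_sign_def)

lemma weight_off:
  assumes "c \<in> off"
  shows "weight t D' c = weight t D c"
proof -
  have "c \<in> real_cr D" "c \<in> real_cr D'"
    using assms by (simp add: off_def, simp add: off')
  then show ?thesis
    using flat_sign_off[OF assms] first_over_off[OF assms] by (simp add: weight_flat[OF D] weight_flat[OF D'])
qed

lemma form_on_off:
  assumes "\<And>t. t \<notin> J \<Longrightarrow> f' t = f t" "\<And>t. t \<notin> J \<Longrightarrow> g' t = g t"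
  shows "form_on D' off f' g' = form_on D off f g"
  unfolding form_on_def by (rule sum.cong) (use off_J flat_sign_off assms in auto)

lemma real_cr_split: "real_cr D = off \<union> (real_cr D \<inter> inside J D)" "off \<inter> inside J D = {}"
  "real_cr D' = off \<union> (real_cr D' \<inter> inside J D')" "off \<inter> inside J D' = {}"
proof -
  have "c \<in> off \<or> c \<in> inside J D" if "c \<in> real_cr D" for c
    using that real_cr_J[of c] real_cr_double_points[OF D] by (auto simp: off_def inside_def)
  moreover have "c \<in> off \<or> c \<in> inside J D'" if "c \<in> real_cr D'" for c
    using that real_cr_J[of c] real_cr_double_points[OF D'] by (auto simp: off' inside_def)
  moreover have "off \<subseteq> real_cr D" "off \<subseteq> real_cr D'" using off_def off' by auto
  moreover show "off \<inter> inside J D = {}" "off \<inter> inside J D' = {}"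
    using off_J by (auto simp: inside_def)
  ultimately show "real_cr D = off \<union> (real_cr D \<inter> inside J D)" "real_cr D' = off \<union> (real_cr D' \<inter> inside J D')"
    by blast+
qed

lemma finite_off: "finite off"
  using finite_real_cr[OF D] by (simp add: off_def)

lemma form_split:
  "form D f g = form_on D off f g + form_on D (real_cr D \<inter> inside J D) f g"
  "form D' f g = form_on D' off f g + form_on D' (real_cr D' \<inter> inside J D') f g"
proof -
  have "form_on E (off \<union> A) f g = form_on E off f g + form_on E A f g"
    if "finite A" "off \<inter> A = {}" for A E
    using that finite_off by (simp add: form_on_def sum.union_disjoint)
  then show "form D f g = form_on D off f g + form_on D (real_cr D \<inter> inside J D) f g"
    "form D' f g = form_on D' off f g + form_on D' (real_cr D' \<inter> inside J D') f g"
    using real_cr_split finite_real_cr[OF D] finite_real_cr[OF D'] unfolding form_form_on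
    by (metis (no_types, lifting) Int_left_commute finite_Int inf_bot_right)+
qed

text \<open>
  The loop of a crossing off the disc contains each arc in the disc completely or not at all.
\<close>

lemma height_off_constant:
  assumes "c \<in> off" "{l..u} \<subseteq> J" "s \<in> {l..u}" "t \<in> {l..u}"
  shows "height c s = height c t"
  using height_constant[of c l u s t] off_J[OF assms(1)] assms by blast

lemma pair_sum_no_real:
  assumes "real_cr D \<inter> inside J D = {}" "real_cr D' \<inter> inside J D' = {}"
  shows "pair_sum \<kappa> a b D = pair_sum \<kappa> a b D'"
proof (rule pair_sum_bij[OF D D', of id])
  have R: "real_cr D = off" "real_cr D' = off" using real_cr_split assms by auto
  then show "bij_betw id (real_cr D) (real_cr D')" by simp
  have f: "form D' f g = form D f g" for f g
    unfolding form_split assms using form_on_off by (simp add: form_on_def)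
  show "index1 D' (id c) = index1 D c" "index2 D' (id c) (id d) = index2 D c d" for c d
    by (simp_all add: index1_def index2_def f)
  show "weight t D' (id c) = weight t D c" if "c \<in> real_cr D" for c t
    using weight_off that R by simp
qed

end

text \<open>
  The loop of the new crossing stays inside the disc, where it meets no other strand.  The new
  crossing does not affect the other loops either: they have the same height at its two passages.
\<close>

lemma move_I_pair_sum:
  assumes dd: "is_diagram D" "is_diagram D'" and m: "move_I D D'" and \<kappa>: "reduced \<kappa>"
  shows "pair_sum \<kappa> a b D = pair_sum \<kappa> a b D'"
proof -
  obtain l u c where lu: "l < u" "agree_off_disc {l..u} D D'" "inside {l..u} D = {c}" "inside {l..u} D' = {}"
    using m unfolding move_I_def by blast
  interpret local_move "{l..u}" D D' by unfold_locales (use dd lu in auto)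
  show ?thesis
  proof (cases "c \<in> real_cr D")
    case False
    then show ?thesis using pair_sum_no_real lu by simp
  next
    case True
    have ins: "real_cr D \<inter> inside {l..u} D = {c}" "real_cr D' \<inter> inside {l..u} D' = {}"
      using True lu by auto
    have R: "real_cr D' = off" "real_cr D = insert c off" "c \<notin> off"
      using real_cr_split ins lu(3) by auto
    have c: "fst c \<in> {l..u}" "snd c \<in> {l..u}" "fst c < snd c"
      using lu(3) real_cr_less[OF dd(1) True] by (auto simp: inside_def)
    have form_D: "form D f g = form_on D off f g + flat_sign D c * (f (fst c) * g (snd c) - f (snd c) * g (fst c))"
      for f g using form_split(1)[unfolded ins] by (simp add: form_on_def)
    have form_D': "form D' f g = form_on D off f g" for f g
      using form_split(2)[unfolded ins] form_on_off by (simp add: form_on_def)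
    have const: "height x (fst c) = height x (snd c)" if "x \<in> off" for x
      by (rule height_off_constant[OF that order_refl c(1,2)])
    have h0: "height c t = 0" if "t \<notin> {l..u}" for t
      using that c by (auto simp: height_def)
    have c_off: "form_on D off (height c) g = 0" for g
      unfolding form_on_def by (rule sum.neutral) (use off_J h0 in auto)
    show ?thesis
    proof (rule pair_sum_isolated[OF dd \<kappa>, of c], unfold R(1))
      show "real_cr D = insert c off" "c \<notin> off" using R by auto
      show "weight t D' x = weight t D x" if "x \<in> off" for x t by (rule weight_off[OF that])
      show "index1 D' x = index1 D x" if "x \<in> off" for x
        by (simp add: index1_def form_D form_D' const[OF that])
      show "index2 D' x y = index2 D x y" if "x \<in> off" "y \<in> off" for x y
        by (simp add: index2_def form_D form_D' const[OF that(1)] const[OF that(2)])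
      show "index1 D c = 0" by (simp add: index1_def form_D c_off height_corner[OF c(3)])
      show "index2 D c x = 0" if "x \<in> off" for x
        by (simp add: index2_def form_D c_off height_corner[OF c(3)] const[OF that])
    qed
  qed
qed

text \<open>
  The loops of the two new crossings differ by the boundary of the bigon, hence agree off the disc
  and have the same intersection number with every loop.  As the flat signs are opposite, the two
  new crossings cancel in the form of any two loops that are constant on the arcs.
\<close>

lemma move_II_pair_sum:
  assumes dd: "is_diagram D" "is_diagram D'" and m: "move_II D D'"
  shows "pair_sum \<kappa> a b D = pair_sum \<kappa> a b D'"
proof -
  obtain l1 u1 l2 u2 p1 p2 q1 q2 where
    lu: "l1 < u1" "u1 < l2" "l2 < u2" and ag: "agree_off_disc ({l1..u1} \<union> {l2..u2}) D D'"
    and mem: "p1 \<in> {l1..u1}" "q1 \<in> {l1..u1}" "p2 \<in> {l2..u2}" "q2 \<in> {l2..u2}"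
    and neq: "(p1, p2) \<noteq> (q1, q2)"
    and ins: "inside ({l1..u1} \<union> {l2..u2}) D = {(p1, p2), (q1, q2)}" "inside ({l1..u1} \<union> {l2..u2}) D' = {}"
    and sg: "sgn (wedge (velocity D p1) (velocity D p2)) = - sgn (wedge (velocity D q1) (velocity D q2))"
    and re: "(p1, p2) \<notin> real_cr D \<and> (q1, q2) \<notin> real_cr D \<or>
         (p1, p2) \<in> real_cr D \<and> (q1, q2) \<in> real_cr D \<and> ((p1, p2) \<in> first_over D \<longleftrightarrow> (q1, q2) \<in> first_over D)"
    using m unfolding move_II_def by blast
  let ?J = "{l1..u1} \<union> {l2..u2}"
  interpret local_move ?J D D' by unfold_locales (use dd ag in auto)
  let ?c = "(p1, p2)" and ?d = "(q1, q2)"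
  show ?thesis
  proof (cases "?c \<in> real_cr D")
    case False
    then show ?thesis using pair_sum_no_real re ins by auto
  next
    case True
    then have cd: "?c \<in> real_cr D" "?d \<in> real_cr D" "?c \<in> first_over D \<longleftrightarrow> ?d \<in> first_over D" using re by auto
    have insR: "real_cr D \<inter> inside ?J D = {?c, ?d}" "real_cr D' \<inter> inside ?J D' = {}"
      using cd ins by auto
    have R: "real_cr D' = off" "real_cr D = insert ?c (insert ?d off)" "?c \<notin> off" "?d \<notin> off"
      using real_cr_split insR ins by auto
    have dp: "?c \<in> double_points (curve D)" "?d \<in> double_points (curve D)"
      using cd real_cr_double_points[OF dd(1)] by auto
    have fs: "flat_sign D ?d = - flat_sign D ?c"
      using sg double_point_wedge[OF dd(1) dp(1)] double_point_wedge[OF dd(1) dp(2)]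
      by (auto simp: flat_sign_def sgn_if split: if_splits)
    have form_D: "form D f g = form_on D off f g +
        flat_sign D ?c * ((f p1 * g p2 - f p2 * g p1) - (f q1 * g q2 - f q2 * g q1))" for f g
      using form_split(1)[unfolded insR] neq fs by (simp add: form_on_def algebra_simps)
    have form_D': "form D' f g = form_on D off f g" for f g
      using form_split(2)[unfolded insR] form_on_off by (simp add: form_on_def)
    have const: "height x p1 = height x q1" "height x p2 = height x q2" if "x \<in> off" for x
      using height_off_constant[OF that, of l1 u1 p1 q1] height_off_constant[OF that, of l2 u2 p2 q2] mem by auto
    have same: "height ?d t = height ?c t" if "t \<notin> ?J" for t
      by (rule height_cong[of _ l1 u1 _ _ l2 u2]) (use mem that in auto)
    have off_eq: "form_on D off (height ?d) g = form_on D off (height ?c) g" for g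
      unfolding form_on_def by (rule sum.cong) (use off_J same in auto)
    have off_0: "form_on D off (height ?c) (height ?d) = 0"
      unfolding form_on_def by (rule sum.neutral) (use off_J same in auto)
    have less: "p1 < p2" "q1 < q2" "p1 < q2" "q1 < p2" using mem lu by auto
    \<comment> \<open>On each arc, exactly one of the two passages lies inside the other chord.\<close>
    have hd: "height ?d p1 = 2 - height ?c q1" "height ?d p2 = 2 - height ?c q2"
      using less by (auto simp: height_def of_bool_def)
    have hc: "height ?c p1 = 1" "height ?c p2 = 1" "height ?d q1 = 1" "height ?d q2 = 1"
      using height_corner[of ?c] height_corner[of ?d] less by auto
    show ?thesis
    proof (rule pair_sum_cancelling[OF dd, of ?c ?d], unfold R(1))
      show "real_cr D = insert ?c (insert ?d off)" "?c \<notin> off" "?d \<notin> off" "?c \<noteq> ?d" using R neq by auto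
      show "weight t D' x = weight t D x" if "x \<in> off" for x t by (rule weight_off[OF that])
      show "index1 D' x = index1 D x" if "x \<in> off" for x
        by (simp add: index1_def form_D form_D' const[OF that])
      show "index2 D' x y = index2 D x y" if "x \<in> off" "y \<in> off" for x y
        by (simp add: index2_def form_D form_D' const[OF that(1)] const[OF that(2)])
      show "weight t D ?d = - weight t D ?c" for t
        using cd by (simp add: weight_flat[OF dd(1)] fs)
      show "index1 D ?d = index1 D ?c" by (simp add: index1_def form_D off_eq hd hc algebra_simps)
      show "index2 D ?d x = index2 D ?c x" if "x \<in> off" for x
        by (simp add: index2_def form_D off_eq hd hc const[OF that] algebra_simps)
      show "index2 D ?c ?d = 0" by (simp add: index2_def form_D off_0 hd hc algebra_simps)
    qed
  qed
qed

text \<open>A single real crossing that is moved within two arcs keeps all its indices.\<close>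

context local_move
begin

lemma pair_sum_one_real:
  assumes ins: "real_cr D \<inter> inside J D = {c}" "real_cr D' \<inter> inside J D' = {c'}"
    and I: "{l..u} \<subseteq> J" "{l'..u'} \<subseteq> J"
    and c: "fst c \<in> {l..u}" "snd c \<in> {l'..u'}" and c': "fst c' \<in> {l..u}" "snd c' \<in> {l'..u'}"
    and fs: "flat_sign D' c' = flat_sign D c" and fo: "c' \<in> first_over D' \<longleftrightarrow> c \<in> first_over D"
  shows "pair_sum \<kappa> a b D = pair_sum \<kappa> a b D'"
proof -
  have R: "real_cr D = insert c off" "c \<notin> off" "real_cr D' = insert c' off" "c' \<notin> off"
    using real_cr_split ins by auto
  have lt: "fst c < snd c" "fst c' < snd c'"
    using real_cr_less[OF D, of c] real_cr_less[OF D', of c'] R by auto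
  define \<theta> where "\<theta> x = (if x = c then c' else x)" for x
  have \<theta>: "\<theta> c = c'" "\<And>x. x \<in> off \<Longrightarrow> \<theta> x = x" using R by (auto simp: \<theta>_def)
  have fD: "form D f g = form_on D off f g + flat_sign D c * (f (fst c) * g (snd c) - f (snd c) * g (fst c))" for f g
    using form_split(1)[of f g] unfolding ins by (simp add: form_on_def)
  have fD': "form D' f g = form_on D' off f g + flat_sign D c * (f (fst c') * g (snd c') - f (snd c') * g (fst c'))" for f g
    using form_split(2)[of f g] unfolding ins by (simp add: form_on_def fs)
  have out: "height (\<theta> x) t = height x t" if "x \<in> real_cr D" "t \<notin> J" for x t
  proof (cases "x = c")
    case True
    have "t \<notin> {l..u}" "t \<notin> {l'..u'}" using that(2) I by blast+
    then show ?thesis unfolding True \<theta>(1) by (intro height_cong[of c' l u c t l' u'] c c')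
  next
    case False
    then have "x \<in> off" using that(1) R(1) by blast
    then show ?thesis by (simp only: \<theta>)
  qed
  have corner: "height (\<theta> x) (fst c') = height x (fst c) \<and> height (\<theta> x) (snd c') = height x (snd c)"
    if "x \<in> real_cr D" for x
  proof (cases "x = c")
    case True
    then show ?thesis by (simp only: \<theta> height_corner[OF lt(1)] height_corner[OF lt(2)])
  next
    case False
    then have x: "x \<in> off" using that R(1) by blast
    show ?thesis
      using height_off_constant[OF x I(1) c'(1) c(1)] height_off_constant[OF x I(2) c'(2) c(2)]
      by (simp only: \<theta>(2)[OF x])
  qed
  show ?thesis
  proof (rule pair_sum_bij[OF D D', of \<theta>])
    show "bij_betw \<theta> (real_cr D) (real_cr D')"
      unfolding R bij_betw_def inj_on_def using \<theta> R by auto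
    show "weight t D' (\<theta> x) = weight t D x" if "x \<in> real_cr D" for x t
    proof (cases "x = c")
      case True
      then show ?thesis using R \<theta> fs fo by (simp add: weight_flat[OF D] weight_flat[OF D'])
    next
      case False
      then show ?thesis using that R \<theta> weight_off by auto
    qed
    show "index1 D' (\<theta> x) = index1 D x" if "x \<in> real_cr D" for x
      unfolding index1_def fD fD' using corner[OF that] form_on_off[of "height (\<theta> x)" "height x" "\<lambda>_. 2" "\<lambda>_. 2"] out[OF that]
      by simp
    show "index2 D' (\<theta> x) (\<theta> y) = index2 D x y" if "x \<in> real_cr D" "y \<in> real_cr D" for x y
      unfolding index2_def fD fD'
      using corner[OF that(1)] corner[OF that(2)] form_on_off[of "height (\<theta> x)" "height x" "height (\<theta> y)" "height y"]
        out[OF that(1)] out[OF that(2)] by simp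
  qed
qed

end

text \<open>
  The sign of the difference of two distinct parameters.
\<close>

definition side :: "real \<Rightarrow> real \<Rightarrow> int" where
  "side s t = (if s < t then - 1 else 1)"

lemma sgn_side: "s \<noteq> t \<Longrightarrow> sgn (s - t) = of_int (side s t)"
  by (auto simp: side_def sgn_if)

lemma sgn_wedge_flat_sign:
  assumes "is_diagram D" "c \<in> double_points (curve D)"
  shows "sgn (wedge (velocity D (fst c)) (velocity D (snd c))) = of_int (flat_sign D c)"
  using double_point_wedge[OF assms] by (auto simp: flat_sign_def sgn_if)

text \<open>
  The heights of the three crossings of a triangle at each other's passages.  Only the order of
  the two passages on each arc matters, and it enters linearly.
\<close>

lemma triangle_heights:
  fixes P1 P2 Q1 Q3 R2 R3 :: real
  assumes "P1 \<in> {l1..u1}" "Q1 \<in> {l1..u1}" "P2 \<in> {l2..u2}" "R2 \<in> {l2..u2}" "Q3 \<in> {l3..u3}" "R3 \<in> {l3..u3}"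
    and "u1 < l2" "l2 < u2" "u2 < l3" and neq: "P1 \<noteq> Q1" "P2 \<noteq> R2" "Q3 \<noteq> R3"
  shows "height (P1, P2) P1 = 1" "height (P1, P2) P2 = 1" "height (P1, P2) Q1 = 1 - side P1 Q1"
      "height (P1, P2) Q3 = 0" "height (P1, P2) R2 = 1 - side R2 P2" "height (P1, P2) R3 = 0"
    "height (Q1, Q3) P1 = 1 + side P1 Q1" "height (Q1, Q3) P2 = 2" "height (Q1, Q3) Q1 = 1"
      "height (Q1, Q3) Q3 = 1" "height (Q1, Q3) R2 = 2" "height (Q1, Q3) R3 = 1 + side Q3 R3"
    "height (R2, R3) P1 = 0" "height (R2, R3) P2 = 1 - side R2 P2" "height (R2, R3) Q1 = 0"
      "height (R2, R3) Q3 = 1 - side Q3 R3" "height (R2, R3) R2 = 1" "height (R2, R3) R3 = 1"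
proof -
  have less: "P1 < P2" "P1 < R2" "P1 < Q3" "P1 < R3" "Q1 < P2" "Q1 < R2" "Q1 < Q3" "Q1 < R3"
    "P2 < Q3" "P2 < R3" "R2 < Q3" "R2 < R3"
    using assms by auto
  have neq': "P1 < Q1 \<or> Q1 < P1" "P2 < R2 \<or> R2 < P2" "Q3 < R3 \<or> R3 < Q3"
    using neq by auto
  show "height (P1, P2) P1 = 1" "height (P1, P2) P2 = 1" "height (P1, P2) Q1 = 1 - side P1 Q1"
      "height (P1, P2) Q3 = 0" "height (P1, P2) R2 = 1 - side R2 P2" "height (P1, P2) R3 = 0"
    using less neq' by (auto simp: height_def side_def)
  show "height (Q1, Q3) P1 = 1 + side P1 Q1" "height (Q1, Q3) P2 = 2" "height (Q1, Q3) Q1 = 1"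
      "height (Q1, Q3) Q3 = 1" "height (Q1, Q3) R2 = 2" "height (Q1, Q3) R3 = 1 + side Q3 R3"
    using less neq' by (auto simp: height_def side_def)
  show "height (R2, R3) P1 = 0" "height (R2, R3) P2 = 1 - side R2 P2" "height (R2, R3) Q1 = 0"
      "height (R2, R3) Q3 = 1 - side Q3 R3" "height (R2, R3) R2 = 1" "height (R2, R3) R3 = 1"
    using less neq' by (auto simp: height_def side_def)
qed

text \<open>
  Move III changes the sign of the three numbers \<open>side\<close>.  All indices are affine in these numbers
  up to products of two of them, and the linear parts cancel by the orientation conditions of
  \<open>triangle_turns\<close>, which relate the flat signs of the three crossings to the order of the passages
  along the sides.  If at most one of the crossings is real, no order between real crossings
  changes.
\<close>

lemma move_III_pair_sum:
  assumes dd: "is_diagram D" "is_diagram D'" and m: "move_III D D'"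
  shows "pair_sum \<kappa> a b D = pair_sum \<kappa> a b D'"
proof -
  obtain l1 u1 l2 u2 l3 u3 P Q R P' Q' R' where M:
    "l1 < u1 \<and> u1 < l2 \<and> l2 < u2 \<and> u2 < l3 \<and> l3 < u3 \<and>
     agree_off_disc ({l1..u1} \<union> {l2..u2} \<union> {l3..u3}) D D' \<and>
     {P, P'} \<subseteq> {l1..u1} \<times> {l2..u2} \<and> {Q, Q'} \<subseteq> {l1..u1} \<times> {l3..u3} \<and> {R, R'} \<subseteq> {l2..u2} \<times> {l3..u3} \<and>
     inside ({l1..u1} \<union> {l2..u2} \<union> {l3..u3}) D = {P, Q, R} \<and>
     inside ({l1..u1} \<union> {l2..u2} \<union> {l3..u3}) D' = {P', Q', R'} \<and>
     (fst P < fst Q \<longleftrightarrow> fst Q' < fst P') \<and> (snd P < fst R \<longleftrightarrow> fst R' < snd P') \<and>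
     (snd Q < snd R \<longleftrightarrow> snd R' < snd Q') \<and>
     same_crossing D P D' P' \<and> same_crossing D Q D' Q' \<and> same_crossing D R D' R' \<and>
     admissible_III D P Q R \<and> triangle_turns D P Q R"
    using m unfolding move_III_def Let_def by (elim exE) (rule that)
  have lu: "l1 < u1" "u1 < l2" "l2 < u2" "u2 < l3" "l3 < u3"
    and ag: "agree_off_disc ({l1..u1} \<union> {l2..u2} \<union> {l3..u3}) D D'"
    and mP: "{P, P'} \<subseteq> {l1..u1} \<times> {l2..u2}" and mQ: "{Q, Q'} \<subseteq> {l1..u1} \<times> {l3..u3}"
    and mR: "{R, R'} \<subseteq> {l2..u2} \<times> {l3..u3}"
    and ins: "inside ({l1..u1} \<union> {l2..u2} \<union> {l3..u3}) D = {P, Q, R}"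
      "inside ({l1..u1} \<union> {l2..u2} \<union> {l3..u3}) D' = {P', Q', R'}"
    and o: "fst P < fst Q \<longleftrightarrow> fst Q' < fst P'" "snd P < fst R \<longleftrightarrow> fst R' < snd P'" "snd Q < snd R \<longleftrightarrow> snd R' < snd Q'"
    and sm: "same_crossing D P D' P'" "same_crossing D Q D' Q'" "same_crossing D R D' R'"
    and adm: "admissible_III D P Q R" and turns: "triangle_turns D P Q R"
    using M by - (elim conjE, assumption)+
  let ?J = "{l1..u1} \<union> {l2..u2} \<union> {l3..u3}"
  interpret local_move ?J D D' by unfold_locales (use dd ag in auto)
  have dp: "P \<in> double_points (curve D)" "Q \<in> double_points (curve D)" "R \<in> double_points (curve D)"
    "P' \<in> double_points (curve D')" "Q' \<in> double_points (curve D')" "R' \<in> double_points (curve D')"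
    using ins by (auto simp: inside_def)
  have fs: "flat_sign D' P' = flat_sign D P" "flat_sign D' Q' = flat_sign D Q" "flat_sign D' R' = flat_sign D R"
    using flat_sign_eqI[OF dp(1,4) dd] flat_sign_eqI[OF dp(2,5) dd] flat_sign_eqI[OF dp(3,6) dd] sm
    by (auto simp: same_crossing_def)
  have neq: "P \<noteq> Q" "P \<noteq> R" "Q \<noteq> R" "P' \<noteq> Q'" "P' \<noteq> R'" "Q' \<noteq> R'"
    using mP mQ mR lu by (auto simp: mem_Times_iff)
  have re: "P' \<in> real_cr D' \<longleftrightarrow> P \<in> real_cr D" "Q' \<in> real_cr D' \<longleftrightarrow> Q \<in> real_cr D" "R' \<in> real_cr D' \<longleftrightarrow> R \<in> real_cr D"
    and fo: "P' \<in> first_over D' \<longleftrightarrow> P \<in> first_over D" "Q' \<in> first_over D' \<longleftrightarrow> Q \<in> first_over D" "R' \<in> first_over D' \<longleftrightarrow> R \<in> first_over D"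
    using sm by (auto simp: same_crossing_def)
  consider (virtual) "P \<notin> real_cr D" "Q \<notin> real_cr D" "R \<notin> real_cr D"
    | (P) "P \<in> real_cr D" "Q \<notin> real_cr D" "R \<notin> real_cr D"
    | (Q) "P \<notin> real_cr D" "Q \<in> real_cr D" "R \<notin> real_cr D"
    | (R) "P \<notin> real_cr D" "Q \<notin> real_cr D" "R \<in> real_cr D"
    | (all) "P \<in> real_cr D" "Q \<in> real_cr D" "R \<in> real_cr D"
    using adm unfolding admissible_III_def by blast
  then show ?thesis
  proof cases
    case virtual
    then show ?thesis by (intro pair_sum_no_real) (use re in \<open>auto simp: ins\<close>)
  next
    case P
    then have "real_cr D \<inter> inside ?J D = {P}" "real_cr D' \<inter> inside ?J D' = {P'}" using re ins by auto
    then show ?thesis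
      by (rule pair_sum_one_real[where l = l1 and u = u1 and l' = l2 and u' = u2]) (use mP fs fo in auto)
  next
    case Q
    then have "real_cr D \<inter> inside ?J D = {Q}" "real_cr D' \<inter> inside ?J D' = {Q'}" using re ins by auto
    then show ?thesis
      by (rule pair_sum_one_real[where l = l1 and u = u1 and l' = l3 and u' = u3]) (use mQ fs fo in auto)
  next
    case R
    then have "real_cr D \<inter> inside ?J D = {R}" "real_cr D' \<inter> inside ?J D' = {R'}" using re ins by auto
    then show ?thesis
      by (rule pair_sum_one_real[where l = l2 and u = u2 and l' = l3 and u' = u3]) (use mR fs fo in auto)
  next
    case all
    obtain P1 P2 Q1 Q3 R2 R3 P1' P2' Q1' Q3' R2' R3' where
      pts: "P = (P1, P2)" "Q = (Q1, Q3)" "R = (R2, R3)" "P' = (P1', P2')" "Q' = (Q1', Q3')" "R' = (R2', R3')"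
      by (metis prod.collapse)
    have insR: "real_cr D \<inter> inside ?J D = {P, Q, R}" "real_cr D' \<inter> inside ?J D' = {P', Q', R'}"
      using all re ins by auto
    have RD: "real_cr D = insert P (insert Q (insert R off))" "real_cr D' = insert P' (insert Q' (insert R' off))"
      "P \<notin> off" "Q \<notin> off" "R \<notin> off" "P' \<notin> off" "Q' \<notin> off" "R' \<notin> off"
      using real_cr_split insR ins by auto
    have mem: "P1 \<in> {l1..u1}" "Q1 \<in> {l1..u1}" "P2 \<in> {l2..u2}" "R2 \<in> {l2..u2}" "Q3 \<in> {l3..u3}" "R3 \<in> {l3..u3}"
      and mem': "P1' \<in> {l1..u1}" "Q1' \<in> {l1..u1}" "P2' \<in> {l2..u2}" "R2' \<in> {l2..u2}" "Q3' \<in> {l3..u3}" "R3' \<in> {l3..u3}"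
      using mP mQ mR pts by auto
    have cross: "fst c \<noteq> fst d" "snd c \<noteq> fst d" "snd c \<noteq> snd d"
      if "is_diagram E" "c \<in> double_points (curve E)" "d \<in> double_points (curve E)" "c \<noteq> d" for E c d
      using double_points_disjoint[OF that(1-3), of "fst c"] double_points_disjoint[OF that(1-3), of "snd c"] that(4)
      by auto
    have distinct: "P1 \<noteq> Q1" "P2 \<noteq> R2" "Q3 \<noteq> R3"
      using cross(1)[OF dd(1) dp(1,2) neq(1)] cross(2)[OF dd(1) dp(1,3) neq(2)] cross(3)[OF dd(1) dp(2,3) neq(3)]
      unfolding pts by simp_all
    have distinct': "P1' \<noteq> Q1'" "P2' \<noteq> R2'" "Q3' \<noteq> R3'"
      using cross(1)[OF dd(2) dp(4,5) neq(4)] cross(2)[OF dd(2) dp(4,6) neq(5)] cross(3)[OF dd(2) dp(5,6) neq(6)]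
      unfolding pts by simp_all
    have flip: "side P1' Q1' = - side P1 Q1" "side R2' P2' = - side R2 P2" "side Q3' R3' = - side Q3 R3"
      using o distinct distinct' unfolding pts by (auto simp: side_def)
    define p q r where "p = flat_sign D P" and "q = flat_sign D Q" and "r = flat_sign D R"
    \<comment> \<open>The boundary of the triangle turns to the same side at all three corners.\<close>
    have tri: "side P1 Q1 * p = side Q3 R3 * r" "side R2 P2 * r = - (side P1 Q1 * q)" "side R2 P2 * p = - (side Q3 R3 * q)"
    proof -
      have w: "sgn (wedge (velocity D P1) (velocity D P2)) = of_int p"
        "sgn (wedge (velocity D Q1) (velocity D Q3)) = of_int q"
        "sgn (wedge (velocity D R2) (velocity D R3)) = of_int r"
        using sgn_wedge_flat_sign[OF dd(1) dp(1)] sgn_wedge_flat_sign[OF dd(1) dp(2)] sgn_wedge_flat_sign[OF dd(1) dp(3)]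
        by (simp_all add: pts p_def q_def r_def)
      have s: "sgn (P1 - Q1) = of_int (side P1 Q1)" "sgn (R2 - P2) = of_int (side R2 P2)" "sgn (Q3 - R3) = of_int (side Q3 R3)"
        using sgn_side distinct by metis+
      have *: "sgn (x * y * z) = sgn x * sgn y * sgn z" for x y z :: real by (simp add: sgn_mult)
      have T: "side P1 Q1 * side R2 P2 * p = side R2 P2 * side Q3 R3 * r"
        "side R2 P2 * side Q3 R3 * r = - (side Q3 R3 * side P1 Q1 * q)"
      proof -
        have sg: "sgn (real_of_int (side s t)) = of_int (side s t)" for s t by (simp add: side_def)
        have "real_of_int (side P1 Q1 * side R2 P2 * p) = real_of_int (side R2 P2 * side Q3 R3 * r)"
          "real_of_int (side R2 P2 * side Q3 R3 * r) = real_of_int (- (side Q3 R3 * side P1 Q1 * q))"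
          using turns unfolding triangle_turns_def Let_def pts fst_conv snd_conv s * sg
            wedge_swap[of "velocity D Q3" "velocity D Q1"] sgn_minus w
          by (simp_all only: of_int_mult of_int_minus mult_minus_right)
        then show "side P1 Q1 * side R2 P2 * p = side R2 P2 * side Q3 R3 * r"
          "side R2 P2 * side Q3 R3 * r = - (side Q3 R3 * side P1 Q1 * q)"
          by (simp_all only: of_int_eq_iff)
      qed
      show "side P1 Q1 * p = side Q3 R3 * r" "side R2 P2 * r = - (side P1 Q1 * q)" "side R2 P2 * p = - (side Q3 R3 * q)"
        using T by (auto simp: side_def split: if_splits)
    qed
    have fD: "form D f g = form_on D off f g +
        (p * (f P1 * g P2 - f P2 * g P1) + q * (f Q1 * g Q3 - f Q3 * g Q1) + r * (f R2 * g R3 - f R3 * g R2))" for f g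
      using form_split(1)[of f g] neq unfolding insR by (simp add: form_on_def pts p_def q_def r_def)
    have fD': "form D' f g = form_on D' off f g +
        (p * (f P1' * g P2' - f P2' * g P1') + q * (f Q1' * g Q3' - f Q3' * g Q1') + r * (f R2' * g R3' - f R3' * g R2'))" for f g
      using form_split(2)[of f g] neq unfolding insR by (simp add: form_on_def pts p_def[folded fs(1)] q_def[folded fs(2)] r_def[folded fs(3)])
    note H = triangle_heights[OF mem lu(2,3,4) distinct] and H' = triangle_heights[OF mem' lu(2,3,4) distinct', unfolded flip]
    define \<theta> where "\<theta> x = (if x = P then P' else if x = Q then Q' else if x = R then R' else x)" for x
    have \<theta>: "\<theta> P = P'" "\<theta> Q = Q'" "\<theta> R = R'" "\<And>x. x \<in> off \<Longrightarrow> \<theta> x = x"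
      using RD neq by (auto simp: \<theta>_def)
    have out: "height (\<theta> x) t = height x t" if x: "x \<in> real_cr D" and t: "t \<notin> ?J" for x t
    proof -
      have "height P' t = height P t" "height Q' t = height Q t" "height R' t = height R t"
        using height_cong[of P' l1 u1 P t l2 u2] height_cong[of Q' l1 u1 Q t l3 u3] height_cong[of R' l2 u2 R t l3 u3]
          mem mem' t by (simp_all add: pts)
      moreover have "\<theta> x = x \<or> x \<in> {P, Q, R}" using x \<theta>(4) unfolding RD(1) by blast
      ultimately show ?thesis using \<theta>(1-3) by auto
    qed
    have const: "height x P1 = height x P1'" "height x Q1 = height x P1'" "height x Q1' = height x P1'"
      "height x P2 = height x P2'" "height x R2 = height x P2'" "height x R2' = height x P2'"
      "height x Q3 = height x Q3'" "height x R3 = height x Q3'" "height x R3' = height x Q3'" if "x \<in> off" for x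
      using height_off_constant[OF that, of l1 u1] height_off_constant[OF that, of l2 u2] height_off_constant[OF that, of l3 u3]
        mem mem' by blast+
    have off_D': "form_on D' off (height (\<theta> x)) (height (\<theta> y)) = form_on D off (height x) (height y)"
      "form_on D' off (height (\<theta> x)) (\<lambda>_. 2) = form_on D off (height x) (\<lambda>_. 2)"
      if "x \<in> real_cr D" "y \<in> real_cr D" for x y
      using form_on_off[of "height (\<theta> x)" "height x" "height (\<theta> y)" "height y"]
        form_on_off[of "height (\<theta> x)" "height x" "\<lambda>_. 2" "\<lambda>_. 2"] out that by blast+
    have mem_real: "x = P \<or> x = Q \<or> x = R \<or> x \<in> off" if "x \<in> real_cr D" for x using that RD by auto
    show ?thesis
    proof (rule pair_sum_bij[OF dd, of \<theta>])
      show "bij_betw \<theta> (real_cr D) (real_cr D')"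
        unfolding bij_betw_def inj_on_def RD(1,2) using \<theta> RD(3-) neq by (auto simp: image_iff)
      show "weight t D' (\<theta> x) = weight t D x" if "x \<in> real_cr D" for x t
        using mem_real[OF that]
      proof (elim disjE)
        assume "x \<in> off"
        then show ?thesis using \<theta>(4)[of x] weight_off[of x t] by simp
      qed (use all re in \<open>simp_all add: \<theta>(1-3) weight_flat[OF dd(1)] weight_flat[OF dd(2)] fs fo\<close>)
      show "index1 D' (\<theta> x) = index1 D x" if x: "x \<in> real_cr D" for x
        using mem_real[OF x]
      proof (elim disjE)
        assume "x = P"
        show ?thesis unfolding \<open>x = P\<close> \<theta> index1_def fD fD' off_D'(2)[OF all(1) all(1), unfolded \<theta>] unfolding pts H H'
          using tri by algebra
      next
        assume "x = Q"
        show ?thesis unfolding \<open>x = Q\<close> \<theta> index1_def fD fD' off_D'(2)[OF all(2) all(2), unfolded \<theta>] unfolding pts H H'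
          using tri by algebra
      next
        assume "x = R"
        show ?thesis unfolding \<open>x = R\<close> \<theta> index1_def fD fD' off_D'(2)[OF all(3) all(3), unfolded \<theta>] unfolding pts H H'
          using tri by algebra
      next
        assume "x \<in> off"
        then show ?thesis unfolding index1_def fD fD' off_D'(2)[OF x x] by (simp add: \<theta> const)
      qed
      show "index2 D' (\<theta> x) (\<theta> y) = index2 D x y" if x: "x \<in> real_cr D" and y: "y \<in> real_cr D" for x y
      proof -
        have off_any: "index2 D' (\<theta> x) (\<theta> y) = index2 D x y" if x: "x \<in> real_cr D" and y: "y \<in> off" for x y
        proof -
          have y': "y \<in> real_cr D" using y RD by simp
          note E = index2_def fD fD' const[OF y] and O = off_D'(1)[OF _ y', unfolded \<theta>(4)[OF y]]
          from mem_real[OF x] show ?thesis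
          proof (elim disjE)
            assume "x = P"
            show ?thesis unfolding \<open>x = P\<close> \<theta>(1-3) \<theta>(4)[OF y] E O[OF all(1), unfolded \<theta>(1-3)] unfolding pts H H'
              using tri by algebra
          next
            assume "x = Q"
            show ?thesis unfolding \<open>x = Q\<close> \<theta>(1-3) \<theta>(4)[OF y] E O[OF all(2), unfolded \<theta>(1-3)] unfolding pts H H'
              using tri by algebra
          next
            assume "x = R"
            show ?thesis unfolding \<open>x = R\<close> \<theta>(1-3) \<theta>(4)[OF y] E O[OF all(3), unfolded \<theta>(1-3)] unfolding pts H H'
              using tri by algebra
          next
            assume "x \<in> off"
            then show ?thesis unfolding \<theta>(4)[OF y] E O[OF x] by (simp add: \<theta>(4) const)
          qed
        qed
        have PQ: "index2 D' P' Q' = index2 D P Q"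
          unfolding index2_def fD fD' off_D'(1)[of P Q, unfolded \<theta>, OF all(1,2)] unfolding pts H H'
          using tri by algebra
        have PR: "index2 D' P' R' = index2 D P R"
          unfolding index2_def fD fD' off_D'(1)[of P R, unfolded \<theta>, OF all(1,3)] unfolding pts H H'
          using tri by algebra
        have QR: "index2 D' Q' R' = index2 D Q R"
          unfolding index2_def fD fD' off_D'(1)[of Q R, unfolded \<theta>, OF all(2,3)] unfolding pts H H'
          using tri by algebra
        show ?thesis
        proof (cases "x \<in> off \<or> y \<in> off")
          case True
          then show ?thesis
            using off_any[OF x, of y] off_any[OF y, of x] index2_skew[of D x y] index2_skew[of D' "\<theta> x" "\<theta> y"] by auto
        next
          case False
          then show ?thesis
            using mem_real[OF x] mem_real[OF y] PQ PR QR \<theta>(1-3)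
              index2_skew[of D Q P] index2_skew[of D R P] index2_skew[of D R Q]
              index2_skew[of D' Q' P'] index2_skew[of D' R' P'] index2_skew[of D' R' Q']
            by (auto simp: index2_self)
        qed
      qed
    qed
  qed
qed


lemma wedge_linear:
  assumes "linear L"
  shows "wedge (L v) (L w) = wedge (L 1) (L \<i>) * wedge v w"
proof -
  have L: "L z = Re z *\<^sub>R L 1 + Im z *\<^sub>R L \<i>" for z
  proof -
    have "L (Re z *\<^sub>R 1 + Im z *\<^sub>R \<i>) = Re z *\<^sub>R L 1 + Im z *\<^sub>R L \<i>"
      using assms by (simp add: linear_add linear_scale)
    moreover have "Re z *\<^sub>R 1 + Im z *\<^sub>R \<i> = z" by (simp add: complex_eq_iff)
    ultimately show ?thesis by simp
  qed
  show ?thesis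
    unfolding L[of v] L[of w] by (simp add: wedge_def algebra_simps)
qed

lemma velocity_has_vector_derivative:
  assumes "is_diagram D"
  shows "(curve D has_vector_derivative velocity D t) (at t)"
proof -
  have "curve D C1_differentiable_on UNIV" using assms by (simp add: is_diagram_def)
  then obtain v where "(curve D has_vector_derivative v t) (at t)"
    by (auto simp: C1_differentiable_on_def)
  then show ?thesis
    unfolding velocity_def by (simp add: vector_derivative_at)
qed

text \<open>
  An orientation preserving diffeomorphism of the plane multiplies the determinant of the two
  directions at a crossing by its positive Jacobian determinant, and an increasing
  reparametrization preserves the order of the passages.
\<close>

lemma isotopic_pair_sum:
  assumes dd: "is_diagram D" "is_diagram D'" and iso: "isotopic D D'"
  shows "pair_sum \<kappa> a b D = pair_sum \<kappa> a b D'"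
proof -
  obtain h \<phi> where h: "plane_diffeo h" and \<phi>: "reparametrization \<phi>"
    and cv: "curve D' = h \<circ> curve D \<circ> \<phi>"
    and re: "real_cr D = map_prod \<phi> \<phi> ` real_cr D'" and fo: "first_over D = map_prod \<phi> \<phi> ` first_over D'"
    using iso unfolding isotopic_def by blast
  obtain h' where h': "\<And>z. (h has_derivative h' z) (at z)" and det: "\<And>z. wedge (h' z 1) (h' z \<i>) > 0"
    using h unfolding plane_diffeo_def by blast
  have d\<phi>: "(\<phi> has_vector_derivative deriv \<phi> t) (at t)" and pos: "deriv \<phi> t > 0" for t
  proof -
    have "\<phi> C1_differentiable_on UNIV" using \<phi> by (simp add: reparametrization_def)
    then obtain v where v: "(\<phi> has_vector_derivative v t) (at t)"
      by (auto simp: C1_differentiable_on_def)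
    then have "deriv \<phi> t = v t"
      by (intro DERIV_imp_deriv) (simp add: has_real_derivative_iff_has_vector_derivative)
    with v show "(\<phi> has_vector_derivative deriv \<phi> t) (at t)" by simp
    show "deriv \<phi> t > 0" using \<phi> by (simp add: reparametrization_def)
  qed
  have mono: "\<phi> s < \<phi> t" if "s < t" for s t
    by (rule DERIV_pos_imp_increasing[OF that])
       (use d\<phi> pos in \<open>auto simp: has_real_derivative_iff_has_vector_derivative\<close>)
  then have less: "\<phi> s < \<phi> t \<longleftrightarrow> s < t" and le: "\<phi> s \<le> \<phi> t \<longleftrightarrow> s \<le> t" for s t
    by (metis linorder_neqE_linordered_idom order_less_asym less_irrefl, metis linorder_not_le order_less_imp_le mono nle_le)
  have inj: "inj \<phi>" using \<phi> by (simp add: reparametrization_def bij_is_inj)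
  then have injp: "inj (map_prod \<phi> \<phi>)" by (simp add: prod.inj_map)
  have vel: "velocity D' t = h' (curve D (\<phi> t)) (deriv \<phi> t *\<^sub>R velocity D (\<phi> t))" for t
  proof -
    have "((curve D \<circ> \<phi>) has_vector_derivative deriv \<phi> t *\<^sub>R velocity D (\<phi> t)) (at t)"
      by (rule vector_diff_chain_at[OF d\<phi> velocity_has_vector_derivative[OF dd(1)]])
    moreover have "(h has_derivative h' (curve D (\<phi> t))) (at ((curve D \<circ> \<phi>) t) within range (curve D \<circ> \<phi>))"
      using h' by (simp add: has_derivative_at_withinI)
    ultimately have "((h \<circ> (curve D \<circ> \<phi>)) has_vector_derivative
        h' (curve D (\<phi> t)) (deriv \<phi> t *\<^sub>R velocity D (\<phi> t))) (at t)"
      by (rule vector_derivative_diff_chain_within)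
    then show ?thesis
      unfolding velocity_def[of D'] cv by (simp add: vector_derivative_at comp_assoc)
  qed
  have pos_mult: "0 < x * y \<longleftrightarrow> 0 < y" if "0 < x" for x y :: real
    using that by (simp add: zero_less_mult_iff)
  have fs: "flat_sign D' c = flat_sign D (map_prod \<phi> \<phi> c)" if c: "c \<in> real_cr D'" for c
  proof -
    have "map_prod \<phi> \<phi> c \<in> real_cr D" using c re by blast
    then have "curve D (\<phi> (fst c)) = curve D (\<phi> (snd c))"
      using real_cr_double_points[OF dd(1)] by (cases c) (auto simp: double_points_def)
    then have "wedge (velocity D' (fst c)) (velocity D' (snd c)) =
        wedge (h' (curve D (\<phi> (fst c))) (deriv \<phi> (fst c) *\<^sub>R velocity D (\<phi> (fst c))))
          (h' (curve D (\<phi> (fst c))) (deriv \<phi> (snd c) *\<^sub>R velocity D (\<phi> (snd c))))"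
      by (simp only: vel)
    also have "\<dots> = wedge (h' (curve D (\<phi> (fst c))) 1) (h' (curve D (\<phi> (fst c))) \<i>) *
        wedge (deriv \<phi> (fst c) *\<^sub>R velocity D (\<phi> (fst c))) (deriv \<phi> (snd c) *\<^sub>R velocity D (\<phi> (snd c)))"
      by (rule wedge_linear[OF has_derivative_linear[OF h']])
    also have "wedge (deriv \<phi> (fst c) *\<^sub>R velocity D (\<phi> (fst c))) (deriv \<phi> (snd c) *\<^sub>R velocity D (\<phi> (snd c))) =
        deriv \<phi> (fst c) * deriv \<phi> (snd c) * wedge (velocity D (\<phi> (fst c))) (velocity D (\<phi> (snd c)))"
      by (simp add: wedge_def algebra_simps)
    finally have "wedge (velocity D' (fst c)) (velocity D' (snd c)) =
        wedge (h' (curve D (\<phi> (fst c))) 1) (h' (curve D (\<phi> (fst c))) \<i>) *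
        (deriv \<phi> (fst c) * deriv \<phi> (snd c) * wedge (velocity D (\<phi> (fst c))) (velocity D (\<phi> (snd c))))" .
    then show ?thesis
      by (simp add: flat_sign_def pos_mult mult.assoc det pos)
  qed
  have form: "form D f g = form D' (f \<circ> \<phi>) (g \<circ> \<phi>)" for f g
    unfolding form_def re
    by (subst sum.reindex[OF inj_on_subset[OF injp subset_UNIV]]) (simp add: fs)
  have ht: "height (map_prod \<phi> \<phi> c) \<circ> \<phi> = height c" for c
    by (simp add: height_def less le fun_eq_iff)
  have "pair_sum \<kappa> a b D' = pair_sum \<kappa> a b D"
  proof (rule pair_sum_bij[OF dd(2,1), of "map_prod \<phi> \<phi>"])
    show "bij_betw (map_prod \<phi> \<phi>) (real_cr D') (real_cr D)"
      unfolding bij_betw_def re using inj_on_subset[OF injp] by blast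
    show "weight t D (map_prod \<phi> \<phi> c) = weight t D' c" if "c \<in> real_cr D'" for c t
    proof -
      have "map_prod \<phi> \<phi> c \<in> first_over D \<longleftrightarrow> c \<in> first_over D'"
        unfolding fo by (rule inj_image_mem_iff[OF injp])
      moreover have "map_prod \<phi> \<phi> c \<in> real_cr D" using that re by blast
      ultimately show ?thesis using that fs[OF that] by (simp add: weight_flat[OF dd(1)] weight_flat[OF dd(2)])
    qed
    have two: "(\<lambda>_. 2) \<circ> \<phi> = (\<lambda>_. 2::int)" by (simp add: fun_eq_iff)
    show "index1 D (map_prod \<phi> \<phi> c) = index1 D' c" for c
      by (simp only: index1_def form ht two)
    show "index2 D (map_prod \<phi> \<phi> c) (map_prod \<phi> \<phi> d) = index2 D' c d" for c d
      by (simp only: index2_def form ht)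
  qed
  then show ?thesis by simp
qed

lemma pair_sum_invariant:
  assumes "reduced \<kappa>"
  shows "long_virtual_knot_invariant (pair_sum \<kappa> a b)"
proof -
  have step: "pair_sum \<kappa> a b D = pair_sum \<kappa> a b D'" if "diagram_move D D'" for D D'
    using that isotopic_pair_sum move_I_pair_sum[OF _ _ _ assms] move_II_pair_sum move_III_pair_sum
    unfolding diagram_move_def by metis
  have "pair_sum \<kappa> a b D = pair_sum \<kappa> a b D'" if "equivclp diagram_move D D'" for D D'
    using that by (induction rule: equivclp_induct) (use step in metis)+
  then show ?thesis
    by (simp add: long_virtual_knot_invariant_def same_long_virtual_knot_def)
qed

section \<open>Alternating sums over crossing changes\<close>

lemma crossing_change_simps [simp]:
  "curve (crossing_change A D) = curve D" "real_cr (crossing_change A D) = real_cr D"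
  "first_over (crossing_change A D) = (first_over D - A) \<union> (A - first_over D)"
  by (simp_all add: crossing_change_def)

lemma velocity_crossing_change [simp]: "velocity (crossing_change A D) = velocity D"
  by (simp add: velocity_def fun_eq_iff)

lemma flat_sign_crossing_change [simp]: "flat_sign (crossing_change A D) = flat_sign D"
  by (simp add: flat_sign_def fun_eq_iff)

lemma index_crossing_change [simp]:
  "index1 (crossing_change A D) = index1 D" "index2 (crossing_change A D) = index2 D"
  by (simp_all add: index1_def index2_def form_def fun_eq_iff)

lemma is_diagram_crossing_change:
  assumes "is_diagram D" "A \<subseteq> real_cr D"
  shows "is_diagram (crossing_change A D)"
proof -
  have "first_over D - A \<union> (A - first_over D) \<subseteq> real_cr D"
    using first_over_subset[OF assms(1)] assms(2) by blast
  then show ?thesis using assms(1) unfolding is_diagram_def crossing_change_simps velocity_crossing_change by blast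
qed

lemma weight_crossing_change:
  assumes "is_diagram D" "A \<subseteq> real_cr D" "c \<in> real_cr D"
  shows "weight a (crossing_change A D) c =
    (if (c \<in> first_over D) \<noteq> (c \<in> A) then (if a = 0 then flat_sign D c else 0)
     else if a = 1 then - flat_sign D c else 0)"
  using weight_flat[OF is_diagram_crossing_change[OF assms(1,2)], of c a] assms(3) by auto

definition signed_sum :: "'a set \<Rightarrow> ('a set \<Rightarrow> 'v::ab_group_add) \<Rightarrow> 'v" where
  "signed_sum C f = (\<Sum>A \<in> Pow C. if even (card A) then f A else - f A)"

lemma signed_sum_cong: "(\<And>A. A \<subseteq> C \<Longrightarrow> f A = g A) \<Longrightarrow> signed_sum C f = signed_sum C g"
  unfolding signed_sum_def by (rule sum.cong) auto

lemma signed_sum_sum: "signed_sum C (\<lambda>A. \<Sum>x\<in>X. f x A) = (\<Sum>x\<in>X. signed_sum C (f x))"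
  unfolding signed_sum_def
  by (subst sum.swap) (auto intro!: sum.cong simp: sum_negf)

text \<open>
  Pairing each set of changed crossings with the one that differs from it in \<open>z\<close>.
\<close>

lemma signed_sum_insert:
  assumes "finite C" "z \<notin> C"
  shows "signed_sum (insert z C) f = signed_sum C (\<lambda>A. f A - f (insert z A))"
proof -
  have fin: "finite A" if "A \<subseteq> C" for A using finite_subset[OF that assms(1)] .
  have z: "z \<notin> A" if "A \<subseteq> C" for A using that assms(2) by blast
  have inj: "inj_on (insert z) (Pow C)" using assms(2) by (auto simp: inj_on_def)
  have "Pow C \<inter> insert z ` Pow C = {}" using assms(2) by auto
  then have "signed_sum (insert z C) f = signed_sum C f + (\<Sum>A\<in>Pow C. if even (card (insert z A)) then f (insert z A) else - f (insert z A))"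
    unfolding signed_sum_def Pow_insert using assms(1) inj
    by (subst sum.union_disjoint) (auto simp: sum.reindex)
  also have "\<dots> = signed_sum C (\<lambda>A. f A - f (insert z A))"
    unfolding signed_sum_def sum.distrib[symmetric]
    by (rule sum.cong) (auto simp: fin z)
  finally show ?thesis .
qed

lemma alternating_sum_signed_sum: "alternating_sum v D C = signed_sum C (\<lambda>A. v (crossing_change A D))"
  by (simp add: alternating_sum_def signed_sum_def)

text \<open>
  Each summand depends on the over/under information at two crossings only, so the changes at a
  third marked crossing \<open>z\<close> cancel it.
\<close>

lemma alternating_sum_three:
  assumes m: "marked_diagram 3 D C"
  shows "alternating_sum (pair_sum \<kappa> a b) D C = 0"
proof -
  have D: "is_diagram D" and C: "C \<subseteq> real_cr D" "card C = 3"
    using m by (auto simp: marked_diagram_def)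
  have finC: "finite C" using C(2) by (simp add: card_ge_0_finite)
  have zero: "signed_sum C (\<lambda>A. pair_term \<kappa> a b (crossing_change A D) c d) = 0"
    if cd: "c \<in> real_cr D" "d \<in> real_cr D" for c d
  proof -
    \<comment> \<open>A marked crossing that the summand of \<open>c\<close> and \<open>d\<close> does not see.\<close>
    have "card {c, d} < card C" using C(2) card_insert_le_m1[of 2 "{d}" c] by (simp add: card_insert_if)
    then have "\<not> C \<subseteq> {c, d}" using card_mono[of "{c, d}" C] by auto
    then obtain z where z: "z \<in> C" "z \<noteq> c" "z \<noteq> d" by blast
    have "signed_sum (insert z (C - {z})) (\<lambda>A. pair_term \<kappa> a b (crossing_change A D) c d) =
        signed_sum (C - {z}) (\<lambda>A. pair_term \<kappa> a b (crossing_change A D) c d - pair_term \<kappa> a b (crossing_change (insert z A) D) c d)"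
      by (rule signed_sum_insert) (use finC in auto)
    also have "\<dots> = signed_sum (C - {z}) (\<lambda>A. 0)"
    proof (rule signed_sum_cong)
      fix A assume "A \<subseteq> C - {z}"
      then have "A \<subseteq> real_cr D" "insert z A \<subseteq> real_cr D" using C z by auto
      then show "pair_term \<kappa> a b (crossing_change A D) c d - pair_term \<kappa> a b (crossing_change (insert z A) D) c d = 0"
        using z cd by (simp add: pair_term_def weight_crossing_change[OF D])
    qed
    also have "\<dots> = 0" unfolding signed_sum_def by (rule sum.neutral) simp
    finally show ?thesis using z(1) by (simp add: insert_absorb)
  qed
  have "alternating_sum (pair_sum \<kappa> a b) D C =
      signed_sum C (\<lambda>A. \<Sum>c\<in>real_cr D. \<Sum>d\<in>real_cr D. pair_term \<kappa> a b (crossing_change A D) c d)"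
    unfolding alternating_sum_signed_sum
    by (rule signed_sum_cong) (use C(1) in \<open>auto simp: pair_sum_terms is_diagram_crossing_change[OF D]\<close>)
  also have "\<dots> = 0"
    unfolding signed_sum_sum by (simp add: zero)
  finally show ?thesis .
qed

text \<open>
  Only the two orders of the marked pair survive.  The change of a crossing alters its weight by its
  flat sign, whichever type is counted; this is why the result does not depend on \<open>a\<close> and \<open>b\<close>.
\<close>

lemma alternating_sum_two:
  assumes D: "is_diagram D" and R: "real_cr D = {x, y}" "x \<noteq> y" "first_over D = {}"
    and ab: "a \<in> {0, 1}" "b \<in> {0, 1}"
  shows "alternating_sum (pair_sum \<kappa> a b) D {x, y} =
    of_int (flat_sign D x * flat_sign D y) *
      (\<kappa> (index1 D x) (index1 D y) (index2 D x y) + \<kappa> (index1 D y) (index1 D x) (index2 D y x))"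
proof -
  have v: "pair_sum \<kappa> a b (crossing_change A D) = pair_term \<kappa> a b (crossing_change A D) x x + pair_term \<kappa> a b (crossing_change A D) x y
      + pair_term \<kappa> a b (crossing_change A D) y x + pair_term \<kappa> a b (crossing_change A D) y y" if "A \<subseteq> {x, y}" for A
    using that R by (subst pair_sum_terms[OF is_diagram_crossing_change[OF D]]) auto
  have w: "weight t (crossing_change A D) c =
      (if c \<in> A then (if t = 0 then flat_sign D c else 0) else if t = 1 then - flat_sign D c else 0)"
    if "A \<subseteq> {x, y}" "c \<in> {x, y}" for t A c
    using weight_crossing_change[OF D, of A c t] that R by simp
  have "alternating_sum (pair_sum \<kappa> a b) D {x, y} =
      pair_sum \<kappa> a b (crossing_change {} D) - pair_sum \<kappa> a b (crossing_change {y} D)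
      - (pair_sum \<kappa> a b (crossing_change {x} D) - pair_sum \<kappa> a b (crossing_change {x, y} D))"
    using R(2) by (simp add: alternating_sum_signed_sum signed_sum_insert) (simp add: signed_sum_def algebra_simps)
  also have "\<dots> = of_int (flat_sign D x * flat_sign D y) *
      (\<kappa> (index1 D x) (index1 D y) (index2 D x y) + \<kappa> (index1 D y) (index1 D x) (index2 D y x))"
    using ab R(2) by (auto simp: v w pair_term_def algebra_simps)
  finally show ?thesis .
qed


section \<open>A diagram with nonvanishing alternating sum\<close>

text \<open>
  The line has the shadow of the long trefoil, with Gauss word \<open>1 2 3 1 2 3\<close>.  A diagram
  without virtual crossings is realized on the sphere, where all intersection numbers vanish.  With
  crossing \<open>2\<close> virtual, the linked crossings \<open>1\<close> and \<open>3\<close> have equal flat signs, and the intersection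
  number of their loops is \<open>1\<close>.  The cubic first coordinate takes equal values only
  at parameters in the interval from \<open>-2\<close> to \<open>2\<close>, so the second coordinate may be cut off there.
\<close>

definition cubic :: "real \<Rightarrow> real" where
  "cubic t = t ^ 3 - 3 * t"

definition bump :: "real \<Rightarrow> real" where
  "bump t = (max 0 (4 - t\<^sup>2))\<^sup>2 * (t\<^sup>2 - 1)"

definition trefoil_line :: diagram where
  "trefoil_line = \<lparr>curve = (\<lambda>t. Complex (cubic t) (bump t)), real_cr = {(-2, 1), (-1, 2)}, first_over = {}\<rparr>"

lemma trefoil_line_simps [simp]: "curve trefoil_line t = Complex (cubic t) (bump t)"
  "real_cr trefoil_line = {(-2, 1), (-1, 2)}" "first_over trefoil_line = {}"
  by (simp_all add: trefoil_line_def)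

text \<open>
  The square makes the cut-off differentiable at its ends.
\<close>

lemma DERIV_max_square: "((\<lambda>z::real. (max 0 z)\<^sup>2) has_real_derivative 2 * max 0 z) (at z)"
proof (cases z "0 :: real" rule: linorder_cases)
  case less
  have "((\<lambda>z::real. 0) has_real_derivative 0) (at z)" by simp
  then have "((\<lambda>z::real. (max 0 z)\<^sup>2) has_real_derivative 0) (at z)"
    by (rule has_field_derivative_transform_within_open[of _ _ _ "{..<0}"]) (use less in auto)
  then show ?thesis using less by simp
next
  case greater
  have "((\<lambda>z::real. z\<^sup>2) has_real_derivative 2 * z) (at z)" by (auto intro!: derivative_eq_intros)
  then have "((\<lambda>z::real. (max 0 z)\<^sup>2) has_real_derivative 2 * z) (at z)"
    by (rule has_field_derivative_transform_within_open[of _ _ _ "{0<..}"]) (use greater in auto)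
  then show ?thesis using greater by simp
next
  case equal
  have "((\<lambda>h::real. max 0 h) \<longlongrightarrow> max 0 0) (at 0)" by (intro tendsto_intros)
  moreover have "\<forall>\<^sub>F h::real in at 0. max 0 h = ((max 0 (0 + h))\<^sup>2 - (max 0 0)\<^sup>2) / h"
    by (auto simp: eventually_at_filter max_def power2_eq_square)
  ultimately have "((\<lambda>h::real. ((max 0 (0 + h))\<^sup>2 - (max 0 0)\<^sup>2) / h) \<longlongrightarrow> 0) (at 0)"
    using tendsto_cong by force
  then show ?thesis using equal by (simp add: DERIV_def)
qed

lemma DERIV_cubic: "(cubic has_real_derivative 3 * t\<^sup>2 - 3) (at t)"
  unfolding cubic_def by (auto intro!: derivative_eq_intros)

definition bump' :: "real \<Rightarrow> real" where
  "bump' t = 2 * t * max 0 (4 - t\<^sup>2) * (max 0 (4 - t\<^sup>2) - 2 * (t\<^sup>2 - 1))"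

lemma DERIV_bump: "(bump has_real_derivative bump' t) (at t)"
proof -
  have "((\<lambda>t. (max 0 (4 - t\<^sup>2))\<^sup>2) has_real_derivative 2 * max 0 (4 - t\<^sup>2) * (- 2 * t)) (at t)"
    by (rule DERIV_chain2[OF DERIV_max_square]) (auto intro!: derivative_eq_intros)
  moreover have "((\<lambda>t. t\<^sup>2 - 1) has_real_derivative 2 * t) (at t)" by (auto intro!: derivative_eq_intros)
  ultimately have "((\<lambda>t. (max 0 (4 - t\<^sup>2))\<^sup>2 * (t\<^sup>2 - 1)) has_real_derivative
      2 * max 0 (4 - t\<^sup>2) * (- 2 * t) * (t\<^sup>2 - 1) + 2 * t * (max 0 (4 - t\<^sup>2))\<^sup>2) (at t)"
    by (rule DERIV_mult)
  moreover have "2 * m * (- 2 * t) * (t\<^sup>2 - 1) + 2 * t * m\<^sup>2 = 2 * t * m * (m - 2 * (t\<^sup>2 - 1))" for m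
    by (simp add: power2_eq_square algebra_simps)
  ultimately show ?thesis unfolding bump_def[abs_def] bump'_def by simp
qed

lemma trefoil_line_derivative:
  "(curve trefoil_line has_vector_derivative Complex (3 * t\<^sup>2 - 3) (bump' t)) (at t)"
  using DERIV_cubic[of t] DERIV_bump[of t]
  by (simp add: has_vector_derivative_complex_iff has_real_derivative_iff_has_vector_derivative)

lemma velocity_trefoil_line: "velocity trefoil_line t = Complex (3 * t\<^sup>2 - 3) (bump' t)"
  unfolding velocity_def using trefoil_line_derivative by (rule vector_derivative_at)

text \<open>
  On distinct parameters, equality of the cubics means \<open>s\<^sup>2 + s t + t\<^sup>2 = 3\<close>, which forces both
  parameters into the interval where the bump is a polynomial; modulo this relation the difference
  of the bumps is \<open>3 (s - t) (s + t) ((s + t)\<^sup>2 - 1)\<close>.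
\<close>

lemma double_points_trefoil_line:
  "double_points (curve trefoil_line) = {(-2, 1), (- sqrt 3, sqrt 3), (-1, 2)}"
proof (intro equalityI subsetI)
  fix c assume "c \<in> double_points (curve trefoil_line)"
  then obtain s t where c: "c = (s, t)" and st: "s < t" "cubic s = cubic t" "bump s = bump t"
    by (auto simp: double_points_def)
  have "(t - s) * (s\<^sup>2 + s * t + t\<^sup>2 - 3) = 0"
    using st(2) by (simp add: cubic_def power2_eq_square power3_eq_cube algebra_simps)
  then have q: "s\<^sup>2 + s * t + t\<^sup>2 = 3" using st(1) by simp
  have "s\<^sup>2 \<le> 4" "t\<^sup>2 \<le> 4"
    using q zero_le_power2[of "s + 2 * t"] zero_le_power2[of "2 * s + t"]
    by (simp_all add: power2_eq_square algebra_simps)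
  then have "(4 - s\<^sup>2)\<^sup>2 * (s\<^sup>2 - 1) = (4 - t\<^sup>2)\<^sup>2 * (t\<^sup>2 - 1)"
    using st(3) by (simp add: bump_def max_def split: if_splits)
  then have "(t - s) * (s + t) * ((s\<^sup>2)\<^sup>2 + s\<^sup>2 * t\<^sup>2 + (t\<^sup>2)\<^sup>2 - 9 * (s\<^sup>2 + t\<^sup>2) + 24) = 0"
    by (simp add: power2_eq_square algebra_simps)
  then have d: "(s + t) * ((s\<^sup>2)\<^sup>2 + s\<^sup>2 * t\<^sup>2 + (t\<^sup>2)\<^sup>2 - 9 * (s\<^sup>2 + t\<^sup>2) + 24) = 0" using st(1) by simp
  have e: "(s\<^sup>2)\<^sup>2 + s\<^sup>2 * t\<^sup>2 + (t\<^sup>2)\<^sup>2 - 9 * (s\<^sup>2 + t\<^sup>2) + 24 = 3 * ((s + t)\<^sup>2 - 1)"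
  proof -
    have st: "s * t = (s + t)\<^sup>2 - 3" and uv: "s\<^sup>2 + t\<^sup>2 = 6 - (s + t)\<^sup>2"
      using q by (simp_all add: power2_eq_square algebra_simps)
    have "(s\<^sup>2)\<^sup>2 + s\<^sup>2 * t\<^sup>2 + (t\<^sup>2)\<^sup>2 - 9 * (s\<^sup>2 + t\<^sup>2) + 24 = (s\<^sup>2 + t\<^sup>2)\<^sup>2 - (s * t)\<^sup>2 - 9 * (s\<^sup>2 + t\<^sup>2) + 24"
      by (simp add: power2_eq_square algebra_simps)
    moreover have "(6 - m)\<^sup>2 - (m - 3)\<^sup>2 - 9 * (6 - m) + 24 = 3 * (m - 1)" for m :: real
      by (simp add: power2_eq_square algebra_simps)
    ultimately show ?thesis by (simp only: st uv)
  qed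
  have "(s + t) * ((s + t - 1) * (s + t + 1)) = 0"
    using d unfolding e by (simp add: power2_eq_square algebra_simps)
  then consider "s + t = 0" | "s + t = 1" | "s + t = - 1" by force
  then show "c \<in> {(-2, 1), (- sqrt 3, sqrt 3), (-1, 2)}"
  proof cases
    case 1
    then have s: "s = - t" by simp
    then have "t\<^sup>2 = 3" "0 < t" using q st(1) by (auto simp: power2_eq_square)
    then have "t = sqrt 3" using real_sqrt_unique[of t 3] by simp
    then show ?thesis using c s by simp
  next
    case 2
    then have s: "s = 1 - t" by simp
    then have "(t - 2) * (t + 1) = 0" using q unfolding s by (simp add: power2_eq_square algebra_simps)
    then have "t = 2" using s st(1) by auto
    then show ?thesis using c s by simp
  next
    case 3
    then have s: "s = - 1 - t" by simp
    then have "(t - 1) * (t + 2) = 0" using q unfolding s by (simp add: power2_eq_square algebra_simps)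
    then have "t = 1" using s st(1) by auto
    then show ?thesis using c s by simp
  qed
next
  fix c :: crossing assume "c \<in> {(-2, 1), (- sqrt 3, sqrt 3), (-1, 2)}"
  moreover have "- sqrt 3 < sqrt 3" by simp
  ultimately show "c \<in> double_points (curve trefoil_line)"
    by (auto simp: double_points_def cubic_def bump_def power3_eq_cube)
qed

lemma wedge_trefoil_line:
  "wedge (velocity trefoil_line (-2)) (velocity trefoil_line 1) = 162"
  "wedge (velocity trefoil_line (-1)) (velocity trefoil_line 2) = 162"
  "wedge (velocity trefoil_line (- sqrt 3)) (velocity trefoil_line (sqrt 3)) < 0"
  by (simp_all add: velocity_trefoil_line wedge_def bump'_def)

lemma is_diagram_trefoil_line: "is_diagram trefoil_line"
  unfolding is_diagram_def
proof (intro conjI)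
  have "continuous_on UNIV (\<lambda>t. Complex (3 * t\<^sup>2 - 3) (bump' t))"
    unfolding Complex_eq bump'_def by (intro continuous_intros)
  then show "curve trefoil_line C1_differentiable_on UNIV"
    unfolding C1_differentiable_on_def using trefoil_line_derivative
    by (intro exI[of _ "\<lambda>t. Complex (3 * t\<^sup>2 - 3) (bump' t)"] conjI ballI)
  show "\<forall>t. velocity trefoil_line t \<noteq> 0"
  proof
    fix t
    show "velocity trefoil_line t \<noteq> 0"
    proof
      assume "velocity trefoil_line t = 0"
      then have "3 * t\<^sup>2 - 3 = 0" "bump' t = 0"
        by (auto simp: velocity_trefoil_line complex_eq_iff)
      then have "t\<^sup>2 = 1" "bump' t = 0" by auto
      then show False by (auto simp: bump'_def)
    qed
  qed
  show "finite (double_points (curve trefoil_line))" by (simp add: double_points_trefoil_line)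
  show "\<forall>(s, t)\<in>double_points (curve trefoil_line). wedge (velocity trefoil_line s) (velocity trefoil_line t) \<noteq> 0"
    unfolding double_points_trefoil_line using wedge_trefoil_line by auto
  show "real_cr trefoil_line \<subseteq> double_points (curve trefoil_line)"
    unfolding double_points_trefoil_line by simp
  show "\<forall>s t u. s < t \<and> t < u \<longrightarrow> \<not> (curve trefoil_line s = curve trefoil_line t \<and> curve trefoil_line t = curve trefoil_line u)"
  proof (intro allI impI notI)
    fix s t u :: real
    assume "s < t \<and> t < u" "curve trefoil_line s = curve trefoil_line t \<and> curve trefoil_line t = curve trefoil_line u"
    then have "(s, t) \<in> double_points (curve trefoil_line)" "(t, u) \<in> double_points (curve trefoil_line)"
      unfolding double_points_def by auto
    then have "t = 1 \<or> t = sqrt 3 \<or> t = 2" "t = - 2 \<or> t = - sqrt 3 \<or> t = - 1"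
      unfolding double_points_trefoil_line by blast+
    moreover have "sqrt 3 > (0 :: real)" by simp
    ultimately show False by linarith
  qed
  show "first_over trefoil_line \<subseteq> real_cr trefoil_line" by simp
  have "Im (curve trefoil_line t) = 0" if "2 \<le> \<bar>t\<bar>" for t
  proof -
    have "2\<^sup>2 \<le> \<bar>t\<bar>\<^sup>2" using that by (intro power_mono) auto
    then show ?thesis by (simp add: bump_def max_def)
  qed
  then show "\<exists>N. \<forall>t. N \<le> \<bar>t\<bar> \<longrightarrow> Im (curve trefoil_line t) = 0" by blast
  show "filterlim (\<lambda>t. Re (curve trefoil_line t)) at_bot at_bot"
    unfolding trefoil_line_simps complex.sel cubic_def by real_asymp
  show "filterlim (\<lambda>t. Re (curve trefoil_line t)) at_top at_top"
    unfolding trefoil_line_simps complex.sel cubic_def by real_asymp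
qed

lemma flat_sign_trefoil_line: "flat_sign trefoil_line (-2, 1) = 1" "flat_sign trefoil_line (-1, 2) = 1"
  by (simp_all add: flat_sign_def wedge_trefoil_line)

lemma index_trefoil_line:
  "index1 trefoil_line (-2, 1) = 4" "index1 trefoil_line (-1, 2) = -4"
  "index2 trefoil_line (-2, 1) (-1, 2) = 4"
  by (simp_all add: index1_def index2_def form_def flat_sign_trefoil_line height_def)

text \<open>
  The three sums are \<open>t + t\<^sup>-\<^sup>1 - 2\<close>, up to sign.
\<close>

lemma kernel_values:
  "Poly_Mapping.lookup (kernel_F 4 (-4) 4 + kernel_F (-4) 4 (-4)) 0 = - 2"
  "Poly_Mapping.lookup (kernel_G 4 (-4) 4 + kernel_G (-4) 4 (-4)) 0 = 2"
  "Poly_Mapping.lookup (kernel_H 4 (-4) 4 + kernel_H (-4) 4 (-4)) 0 = 2"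
  by (simp_all add: kernel_F_def kernel_G_def kernel_H_def tpow_def lookup_add lookup_minus lookup_single lookup_one lookup_numeral)

lemma alternating_sum_trefoil_line:
  assumes "a \<in> {0, 1}" "b \<in> {0, 1}" and "\<kappa> \<in> {kernel_F, kernel_G, kernel_H}"
  shows "alternating_sum (pair_sum \<kappa> a b) trefoil_line {(-2, 1), (-1, 2)} \<noteq> 0"
proof -
  have "alternating_sum (pair_sum \<kappa> a b) trefoil_line {(-2, 1), (-1, 2)} = \<kappa> 4 (-4) 4 + \<kappa> (-4) 4 (-4)"
    using alternating_sum_two[OF is_diagram_trefoil_line, of "(-2, 1)" "(-1, 2)" a b \<kappa>] assms(1,2)
      index2_skew[of trefoil_line "(-1, 2)" "(-2, 1)"]
    by (simp add: flat_sign_trefoil_line index_trefoil_line)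
  moreover have "\<kappa> 4 (-4) 4 + \<kappa> (-4) 4 (-4) \<noteq> 0"
    using kernel_values assms(3) by auto
  ultimately show ?thesis by simp
qed

lemma alternating_sum_cong:
  assumes "\<And>D. is_diagram D \<Longrightarrow> v D = v' D" "marked_diagram k D C"
  shows "alternating_sum v D C = alternating_sum v' D C"
  unfolding alternating_sum_signed_sum
  by (rule signed_sum_cong) (use assms is_diagram_crossing_change in \<open>auto simp: marked_diagram_def\<close>)

theorem theorem8p2:
  fixes X :: "nat \<Rightarrow> nat \<Rightarrow> diagram \<Rightarrow> laurent_poly" and a b :: nat
  assumes "X \<in> {poly_F, poly_G, poly_H}" and "a \<in> {0, 1}" and "b \<in> {0, 1}"
  shows "finite_type_invariant 2 (X a b)"
proof -
  consider "X = poly_F" | "X = poly_G" | "X = poly_H" using assms(1) by blast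
  then have "\<exists>\<kappa> \<in> {kernel_F, kernel_G, kernel_H}. \<forall>D. is_diagram D \<longrightarrow> X a b D = pair_sum \<kappa> a b D"
    by cases (simp_all add: poly_F_pair_sum poly_G_pair_sum poly_H_pair_sum)
  then obtain \<kappa> where \<kappa>: "\<kappa> \<in> {kernel_F, kernel_G, kernel_H}"
    and X: "\<And>D. is_diagram D \<Longrightarrow> X a b D = pair_sum \<kappa> a b D" by blast
  have "reduced \<kappa>" using \<kappa> reduced_kernels by auto
  then have "long_virtual_knot_invariant (X a b)"
    using pair_sum_invariant[of \<kappa> a b] X by (simp add: long_virtual_knot_invariant_def)
  moreover have "alternating_sum (X a b) D C = 0" if "marked_diagram (2 + 1) D C" for D C
    using alternating_sum_cong[OF X that] alternating_sum_three[of D C \<kappa> a b] that by simp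
  moreover have m: "marked_diagram 2 trefoil_line {(-2, 1), (-1, 2)}"
    by (simp add: marked_diagram_def is_diagram_trefoil_line)
  moreover have "alternating_sum (X a b) trefoil_line {(-2, 1), (-1, 2)} \<noteq> 0"
    using alternating_sum_cong[OF X m] alternating_sum_trefoil_line[OF assms(2,3) \<kappa>] by simp
  ultimately show ?thesis unfolding finite_type_invariant_def by blast
qed

end
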